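(* There exists a linear-time algorithm that, given strings $X,Y$ and an integer $k\in\mathbb{Z}_+$, constructs strings $X',Y'$ of lengths at most $85k^4$ such that $\mathsf{ed}^w_{\le k}(X,Y)=\mathsf{ed}^w_{\le k}(X',Y')$ holds for every weight function $w$.
   Context: Let $\bar\Sigma=\Sigma\cup\{\varepsilon\}$. A weight function is $w:\bar\Sigma\times\bar\Sigma\to\mathbb{R}_{\ge0}$ with $w(a,a)=0$ and $w(a,b)\ge1$ for $a\ne b$. An alignment of $X$ onto $Y$ is a monotone path $(x_t,y_t)_{t=0}^m$ from $(0,0)$ to $(|X|,|Y|)$ with steps $(1,1)$, $(1,0)$ or $(0,1)$. A step $(1,0)$ deletes $X[x_t]$ at cost $w(X[x_t],\varepsilon)$. A step $(0,1)$ inserts $Y[y_t]$ at cost $w(\varepsilon,Y[y_t])$. A step $(1,1)$ costs $w(X[x_t],Y[y_t])$. $\mathsf{ed}^w(X,Y)$ is the minimum total cost of an alignment. $\mathsf{ed}^w_{\le k}(X,Y)$ equals $\mathsf{ed}^w(X,Y)$ if this value is at most $k$, and $\infty$ otherwise. *)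

theory Defs
  imports Complex_Main "HOL-Library.Extended_Real"
begin

section \<open>Weighted edit distance\<close>

text \<open>The alphabet is the type \<open>'a\<close>; the extended alphabet is \<open>'a option\<close>, where \<open>None\<close> is
  the empty string \<open>\<epsilon>\<close>.\<close>

definition weight_function :: "('a option \<Rightarrow> 'a option \<Rightarrow> real) \<Rightarrow> bool" where
  "weight_function w \<longleftrightarrow>
     (\<forall>a b. 0 \<le> w a b) \<and> (\<forall>a. w a a = 0) \<and> (\<forall>a b. a \<noteq> b \<longrightarrow> 1 \<le> w a b)"

definition alignment_step :: "nat \<times> nat \<Rightarrow> nat \<times> nat \<Rightarrow> bool" where
  "alignment_step p q \<longleftrightarrow>
     q = (fst p + 1, snd p + 1) \<or> q = (fst p + 1, snd p) \<or> q = (fst p, snd p + 1)"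

definition alignment :: "'a list \<Rightarrow> 'a list \<Rightarrow> (nat \<times> nat) list \<Rightarrow> bool" where
  "alignment X Y A \<longleftrightarrow>
     A \<noteq> [] \<and> hd A = (0, 0) \<and> last A = (length X, length Y) \<and>
     (\<forall>t. Suc t < length A \<longrightarrow> alignment_step (A ! t) (A ! Suc t))"

definition step_cost ::
    "('a option \<Rightarrow> 'a option \<Rightarrow> real) \<Rightarrow> 'a list \<Rightarrow> 'a list \<Rightarrow> nat \<times> nat \<Rightarrow> nat \<times> nat \<Rightarrow> real" where
  "step_cost w X Y p q =
     (if q = (fst p + 1, snd p) then w (Some (X ! fst p)) None
      else if q = (fst p, snd p + 1) then w None (Some (Y ! snd p))
      else w (Some (X ! fst p)) (Some (Y ! snd p)))"

definition alignment_cost ::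
    "('a option \<Rightarrow> 'a option \<Rightarrow> real) \<Rightarrow> 'a list \<Rightarrow> 'a list \<Rightarrow> (nat \<times> nat) list \<Rightarrow> real" where
  "alignment_cost w X Y A = (\<Sum>t<length A - 1. step_cost w X Y (A ! t) (A ! Suc t))"

definition ed :: "('a option \<Rightarrow> 'a option \<Rightarrow> real) \<Rightarrow> 'a list \<Rightarrow> 'a list \<Rightarrow> real" where
  "ed w X Y = Min (alignment_cost w X Y ` {A. alignment X Y A})"

definition ed_le :: "('a option \<Rightarrow> 'a option \<Rightarrow> real) \<Rightarrow> nat \<Rightarrow> 'a list \<Rightarrow> 'a list \<Rightarrow> ereal" where
  "ed_le w k X Y = (if ed w X Y \<le> real k then ereal (ed w X Y) else \<infinity>)"

text \<open>The two lemmas below show that the minimum in the definition of \<open>ed\<close> is taken over a finite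
  nonempty set.\<close>

lemma finite_alignments: "finite {A. alignment X Y A}"
proof -
  let ?B = "{..length X} \<times> {..length Y}"
  let ?n = "Suc (length X + length Y)"
  have "set A \<subseteq> ?B \<and> length A \<le> ?n" if "alignment X Y A" for A
  proof -
    from that have ne: "A \<noteq> []" and h: "A ! 0 = (0, 0)"
      and l: "A ! (length A - 1) = (length X, length Y)"
      and st: "\<And>t. Suc t < length A \<Longrightarrow> alignment_step (A ! t) (A ! Suc t)"
      by (auto simp: alignment_def hd_conv_nth last_conv_nth)
    have lower: "t < length A \<Longrightarrow> t \<le> fst (A ! t) + snd (A ! t)" for t
    proof (induction t)
      case (Suc t)
      with st[of t] show ?case by (auto simp: alignment_step_def)
    qed simp
    have upper: "n < length A \<Longrightarrow> fst (A ! (length A - 1 - n)) \<le> length X \<and>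
        snd (A ! (length A - 1 - n)) \<le> length Y" for n
    proof (induction n)
      case (Suc n)
      have "Suc (length A - 1 - Suc n) = length A - 1 - n" "length A - 1 - n < length A"
        using Suc.prems by simp_all
      then have "alignment_step (A ! (length A - 1 - Suc n)) (A ! (length A - 1 - n))"
        using st[of "length A - 1 - Suc n"] by simp
      moreover have "fst (A ! (length A - 1 - n)) \<le> length X" "snd (A ! (length A - 1 - n)) \<le> length Y"
        using Suc by simp_all
      ultimately show ?case unfolding alignment_step_def by (elim disjE) simp_all
    qed (use l in simp)
    have "A ! t \<in> ?B" if "t < length A" for t
    proof -
      have "length A - 1 - (length A - 1 - t) = t" using that by simp
      with upper[of "length A - 1 - t"] that show ?thesis by (auto simp: mem_Times_iff)
    qed
    moreover have "length A \<le> ?n" using lower[of "length A - 1"] ne l by simp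
    ultimately show ?thesis by (metis in_set_conv_nth subsetI)
  qed
  then have "{A. alignment X Y A} \<subseteq> {A. set A \<subseteq> ?B \<and> length A \<le> ?n}" by blast
  moreover have "finite {A. set A \<subseteq> ?B \<and> length A \<le> ?n}"
    by (rule finite_lists_length_le) simp
  ultimately show ?thesis by (rule finite_subset)
qed

lemma alignments_nonempty: "{A. alignment X Y A} \<noteq> {}"
proof -
  let ?A = "map (\<lambda>i. (i, 0)) [0..<length X] @ map (\<lambda>j. (length X, j)) [0..<Suc (length Y)]"
  have "hd ?A = (0, 0)" by (cases "length X") (auto simp: hd_append hd_map upt_rec)
  moreover have "alignment_step (?A ! t) (?A ! Suc t)" if "Suc t < length ?A" for t
    using that by (auto simp: alignment_step_def nth_append not_less Suc_diff_le le_Suc_eq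
        simp del: upt_Suc)
  ultimately have "alignment X Y ?A" unfolding alignment_def by auto
  then show ?thesis by blast
qed

section \<open>A word RAM\<close>

text \<open>Linear time is measured on a word RAM, whose programs are given in structured form. A program
  uses finitely many registers, finitely many integer arrays (\<open>mem\<close>) and finitely many symbol arrays
  (\<open>syms\<close>), all named by constants in the program text. Registers and integer arrays hold machine
  words, i.e. numbers smaller than \<open>2 ^ b\<close>. A cell of a symbol array holds a symbol of the alphabet
  or is blank (\<open>None\<close>). Nothing is assumed about the alphabet: symbols can only be copied and tested
  for equality, each in constant time.\<close>

record 'a state =
  reg :: "nat \<Rightarrow> nat"
  mem :: "nat \<Rightarrow> nat \<Rightarrow> nat"
  syms :: "nat \<Rightarrow> nat \<Rightarrow> 'a option"

datatype arith = Add | Sub | Mul | Div | Mod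

text \<open>Subtraction is truncated at 0; division by 0 follows the conventions of HOL.\<close>

fun arith_val :: "arith \<Rightarrow> nat \<Rightarrow> nat \<Rightarrow> nat" where
  "arith_val Add x y = x + y"
| "arith_val Sub x y = x - y"
| "arith_val Mul x y = x * y"
| "arith_val Div x y = x div y"
| "arith_val Mod x y = x mod y"

text \<open>In \<open>SymEq a i b j\<close>, the symbol array \<open>a\<close> is read at the address held by register \<open>i\<close> and the
  symbol array \<open>b\<close> at the address held by register \<open>j\<close>.\<close>

datatype test =
    Less nat nat
  | Equal nat nat
  | SymEq nat nat nat nat
  | Neg test
  | Conj test test

fun test_val :: "test \<Rightarrow> 'a state \<Rightarrow> bool" where
  "test_val (Less i j) s \<longleftrightarrow> reg s i < reg s j"
| "test_val (Equal i j) s \<longleftrightarrow> reg s i = reg s j"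
| "test_val (SymEq a i b j) s \<longleftrightarrow> syms s a (reg s i) = syms s b (reg s j)"
| "test_val (Neg p) s \<longleftrightarrow> \<not> test_val p s"
| "test_val (Conj p q) s \<longleftrightarrow> test_val p s \<and> test_val q s"

fun test_cost :: "test \<Rightarrow> nat" where
  "test_cost (Neg p) = test_cost p + 1"
| "test_cost (Conj p q) = test_cost p + test_cost q + 1"
| "test_cost _ = 1"

datatype com =
    Skip
  | Const nat nat
  | Arith arith nat nat nat
  | Load nat nat nat
  | Store nat nat nat
  | SymCopy nat nat nat nat
  | Seq com com
  | Cond test com com
  | While test com

text \<open>\<open>exec b P s t s'\<close>: with words of \<open>b\<close> bits, program \<open>P\<close> started in state \<open>s\<close> halts after
  \<open>t\<close> unit-cost operations in state \<open>s'\<close>. Only \<open>Const\<close> and \<open>Arith\<close> can create new numbers, and a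
  run in which one of them overflows is not a run of the machine (it has no derivation).\<close>

inductive exec :: "nat \<Rightarrow> com \<Rightarrow> 'a state \<Rightarrow> nat \<Rightarrow> 'a state \<Rightarrow> bool" for b :: nat where
  Skip: "exec b Skip s 1 s"
| Const: "v < 2 ^ b \<Longrightarrow> exec b (Const r v) s 1 (s\<lparr>reg := (reg s)(r := v)\<rparr>)"
| Arith: "v = arith_val f (reg s i) (reg s j) \<Longrightarrow> v < 2 ^ b \<Longrightarrow>
    exec b (Arith f r i j) s 1 (s\<lparr>reg := (reg s)(r := v)\<rparr>)"
| Load: "exec b (Load r a i) s 1 (s\<lparr>reg := (reg s)(r := mem s a (reg s i))\<rparr>)"
| Store: "exec b (Store a i r) s 1
    (s\<lparr>mem := (mem s)(a := (mem s a)(reg s i := reg s r))\<rparr>)"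
| SymCopy: "exec b (SymCopy a i a' j) s 1
    (s\<lparr>syms := (syms s)(a := (syms s a)(reg s i := syms s a' (reg s j)))\<rparr>)"
| Seq: "exec b P s t s' \<Longrightarrow> exec b Q s' t' s'' \<Longrightarrow> exec b (Seq P Q) s (t + t') s''"
| CondTrue: "test_val p s \<Longrightarrow> exec b P s t s' \<Longrightarrow> exec b (Cond p P Q) s (test_cost p + t) s'"
| CondFalse: "\<not> test_val p s \<Longrightarrow> exec b Q s t s' \<Longrightarrow> exec b (Cond p P Q) s (test_cost p + t) s'"
| WhileFalse: "\<not> test_val p s \<Longrightarrow> exec b (While p P) s (test_cost p) s"
| WhileTrue: "test_val p s \<Longrightarrow> exec b P s t s' \<Longrightarrow> exec b (While p P) s' t' s'' \<Longrightarrow>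
    exec b (While p P) s (test_cost p + t + t') s''"

definition sym_array :: "'a list \<Rightarrow> nat \<Rightarrow> 'a option" where
  "sym_array X i = (if i < length X then Some (X ! i) else None)"

text \<open>Input: the strings are in symbol arrays 0 and 1, their lengths in registers 0 and 1, and \<open>k\<close> in
  register 2; all other registers and cells are 0 or blank.\<close>

definition input_state :: "'a list \<Rightarrow> 'a list \<Rightarrow> nat \<Rightarrow> 'a state" where
  "input_state X Y k =
     \<lparr>reg = (\<lambda>_. 0)(0 := length X, 1 := length Y, 2 := k),
      mem = (\<lambda>_ _. 0),
      syms = (\<lambda>_ _. None)(0 := sym_array X, 1 := sym_array Y)\<rparr>"

text \<open>Output: as for the input, the strings are prefixes of symbol arrays 0 and 1, with their lengths
  in registers 0 and 1; what else is stored is irrelevant.\<close>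

definition outputs :: "'a state \<Rightarrow> 'a list \<Rightarrow> 'a list \<Rightarrow> bool" where
  "outputs s X Y \<longleftrightarrow>
     reg s 0 = length X \<and> (\<forall>i<length X. syms s 0 i = Some (X ! i)) \<and>
     reg s 1 = length Y \<and> (\<forall>i<length Y. syms s 1 i = Some (Y ! i))"

text \<open>\<open>P\<close> is a linear-time algorithm that, given strings \<open>X\<close>, \<open>Y\<close> and a positive integer \<open>k\<close>,
  constructs strings \<open>X'\<close>, \<open>Y'\<close> related to the input by \<open>R\<close>. The running time is linear in the total
  length of the strings. As usual on the word RAM, words have logarithmically many bits: the program
  has to run correctly whenever \<open>b \<ge> d * log 2 (length X + length Y + k + 2)\<close>, for a constant \<open>d\<close>.\<close>

definition linear_time_algorithm ::
    "com \<Rightarrow> ('a list \<Rightarrow> 'a list \<Rightarrow> nat \<Rightarrow> 'a list \<Rightarrow> 'a list \<Rightarrow> bool) \<Rightarrow> bool" where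
  "linear_time_algorithm P R \<longleftrightarrow>
     (\<exists>c d. \<forall>X Y k b. 0 < k \<longrightarrow> (length X + length Y + k + 2) ^ d \<le> (2::nat) ^ b \<longrightarrow>
        (\<exists>t s X' Y'. exec b P (input_state X Y k) t s \<and> t \<le> c * (length X + length Y + 1) \<and>
           outputs s X' Y' \<and> R X Y k X' Y'))"

end

theory Submission
  imports Defs
begin

text \<open>Call a fragment \<open>P\<close> matched if it occurs in \<open>X\<close> and \<open>Y\<close> on a common diagonal that an alignment
  with at most \<open>k\<close> edits could visit. Two reductions apply to both copies of \<open>P\<close> at once. First, an
  alignment with at most \<open>k\<close> edits leaves one of \<open>k + 1\<close> disjoint fragments of \<open>P\<close> untouched, and if
  that fragment has no period up to \<open>k\<close>, it can only be aligned on the diagonal of \<open>P\<close>. So anything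
  between two groups of \<open>k + 1\<close> such fragments is irrelevant, because the alignment can follow the
  diagonal between them. Second, a run with period \<open>q \<le> k\<close> may lose \<open>q\<close> symbols as long as
  \<open>(k + 1) * q + 2 * k\<close> remain, because one of \<open>k + 1\<close> disjoint blocks of length \<open>q\<close> is untouched.
  Cutting \<open>P\<close> into phrases that end where a periodic run breaks, shortening the runs, and keeping
  the first and the last \<open>k + 1\<close> phrases leaves \<open>O(k\<^sup>3)\<close> symbols.

  The matched fragments are found greedily: from the current position, take the longest match over
  the at most \<open>k + 1\<close> diagonals of the band and skip the mismatch behind it. No diagonal passes it,
  so every such strip costs an edit, and after \<open>k + 1\<close> strips the distance exceeds \<open>k\<close>.

  Symbol comparisons suffice for linear time. Inputs of length at most \<open>85 * k ^ 4\<close> are left alone.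
  Otherwise \<open>O(k\<^sup>2)\<close> comparisons per strip are affordable to find the diagonals on which the next
  \<open>k\<close> symbols match; if there are several, periodicity leaves only three candidates for the longest
  match. Testing all periods of a window of length \<open>2 * k\<close> costs \<open>O(k\<^sup>2)\<close> and is paid for by
  the phrase, whose length is at least \<open>k\<^sup>2\<close>.\<close>


text \<open>Both reductions change the two copies of \<open>P\<close> alike and so preserve length
  differences: once some fragments are shortened, the next one still satisfies the condition on its
  diagonal, and the reductions can be chained. They turn any alignment with at most \<open>k\<close>
  edits into one that is no more expensive for the given \<open>w\<close>, while the new strings do
  not depend on \<open>w\<close>. The obstacle is that consecutive strips may use different
  diagonals, so their matches, disjoint in \<open>X\<close>, may overlap in \<open>Y\<close>.
  Diagonals of the band differ by at most \<open>k\<close>; hence the first \<open>k\<close> symbols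
  of every match are exempt from shortening. The size is that of \<open>k + 1\<close> strips, each
  with \<open>k\<close> exempt symbols, \<open>2 * k + 2\<close> phrases and a remainder of at most
  \<open>k\<^sup>2 + 4 * k\<close> symbols each, and one mismatch. With the unread end of
  \<open>X\<close> and the length difference to \<open>Y\<close>, this is a polynomial of degree 4
  in \<open>k\<close> with coefficient sum 56, so 85 is generous. If \<open>k + 1\<close> strips do
  not exhaust \<open>X\<close>, any two strings of distance above \<open>k\<close> will do, such as
  \<open>k + 1\<close> symbols against none.\<close>

section \<open>Alignments as lists of columns\<close>

text \<open>Alignments without coordinates: a column pairs a symbol or \<open>None\<close> of
  \<open>X\<close> with one of \<open>Y\<close>, so alignments can be split and glued by
  \<open>@\<close>. Columns \<open>(None, None)\<close> are harmless, as they are free and count as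
  no edit.\<close>

definition upper :: "('a option \<times> 'a option) list \<Rightarrow> 'a list" where
  "upper zs = List.map_filter fst zs"

definition lower :: "('a option \<times> 'a option) list \<Rightarrow> 'a list" where
  "lower zs = List.map_filter snd zs"

definition edits :: "('a option \<times> 'a option) list \<Rightarrow> nat" where
  "edits zs = length (filter (\<lambda>(a, b). a \<noteq> b) zs)"

definition columns_cost ::
    "('a option \<Rightarrow> 'a option \<Rightarrow> real) \<Rightarrow> ('a option \<times> 'a option) list \<Rightarrow> real" where
  "columns_cost w zs = (\<Sum>(a, b)\<leftarrow>zs. w a b)"

definition diagonal :: "'a list \<Rightarrow> ('a option \<times> 'a option) list" where
  "diagonal A = map (\<lambda>a. (Some a, Some a)) A"

lemma upper_simps [simp]:
  "upper [] = []" "upper ((Some a, b) # zs) = a # upper zs" "upper ((None, b) # zs) = upper zs"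
  by (simp_all add: upper_def List.map_filter_def)

lemma lower_simps [simp]:
  "lower [] = []" "lower ((b, Some a) # zs) = a # lower zs" "lower ((b, None) # zs) = lower zs"
  by (simp_all add: lower_def List.map_filter_def)

lemma upper_append [simp]: "upper (zs @ zs') = upper zs @ upper zs'"
  by (simp add: upper_def List.map_filter_def)

lemma lower_append [simp]: "lower (zs @ zs') = lower zs @ lower zs'"
  by (simp add: lower_def List.map_filter_def)

lemma edits_append [simp]: "edits (zs @ zs') = edits zs + edits zs'"
  by (simp add: edits_def)

lemma edits_Nil [simp]: "edits [] = 0"
  by (simp add: edits_def)

lemma edits_Cons: "edits (z # zs) = (if fst z = snd z then 0 else 1) + edits zs"
  by (auto simp: edits_def split: prod.splits)

lemma columns_cost_append [simp]:
  "columns_cost w (zs @ zs') = columns_cost w zs + columns_cost w zs'"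
  by (simp add: columns_cost_def)

lemma columns_cost_Nil [simp]: "columns_cost w [] = 0"
  by (simp add: columns_cost_def)

lemma columns_cost_Cons: "columns_cost w (z # zs) = w (fst z) (snd z) + columns_cost w zs"
  by (auto simp: columns_cost_def split: prod.splits)

lemma diagonal_simps [simp]:
  "upper (diagonal A) = A" "lower (diagonal A) = A" "edits (diagonal A) = 0"
  by (induction A) (auto simp: diagonal_def edits_Cons)

lemma columns_cost_diagonal [simp]: "weight_function w \<Longrightarrow> columns_cost w (diagonal A) = 0"
  by (induction A) (auto simp: diagonal_def columns_cost_Cons weight_function_def)

text \<open>Unequal columns weigh at least 1, so a cost of at most \<open>k\<close> leaves at most
  \<open>k\<close> edits. The combinatorial arguments use only this count and thus serve every
  weight function.\<close>

lemma edits_le_columns_cost: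
  assumes "weight_function w"
  shows "real (edits zs) \<le> columns_cost w zs"
proof (induction zs)
  case (Cons z zs)
  have "(if fst z = snd z then 0 else 1) \<le> w (fst z) (snd z)"
    using assms by (simp add: weight_function_def)
  with Cons show ?case by (auto simp: edits_Cons columns_cost_Cons split: if_splits)
qed simp

lemma columns_cost_nonneg: "weight_function w \<Longrightarrow> 0 \<le> columns_cost w zs"
  using edits_le_columns_cost[of w zs] by linarith

lemma edits_0_lower:
  assumes "edits zs = 0"
  shows "lower zs = upper zs"
  using assms
proof (induction zs)
  case (Cons z zs)
  then show ?case by (cases z; cases "fst z") (auto simp: edits_Cons split: if_splits)
qed simp

lemma length_upper_le: "length (upper zs) \<le> length (lower zs) + edits zs"
proof (induction zs)
  case (Cons z zs)
  then show ?case by (cases z; cases "fst z"; cases "snd z") (auto simp: edits_Cons)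
qed simp

lemma length_lower_le: "length (lower zs) \<le> length (upper zs) + edits zs"
proof (induction zs)
  case (Cons z zs)
  then show ?case by (cases z; cases "fst z"; cases "snd z") (auto simp: edits_Cons)
qed simp

lemma upper_split:
  assumes "upper zs = A @ B"
  obtains zs1 zs2 where "zs = zs1 @ zs2" "upper zs1 = A" "upper zs2 = B"
proof -
  have "\<exists>zs1 zs2. zs = zs1 @ zs2 \<and> upper zs1 = A \<and> upper zs2 = B"
    using assms
  proof (induction zs arbitrary: A)
    case (Cons z zs)
    show ?case
    proof (cases "A = []")
      case True
      then show ?thesis using Cons.prems by (intro exI[of _ "[]"] exI[of _ "z # zs"]) simp
    next
      case False
      obtain a b where z: "z = (a, b)" by (cases z)
      obtain A' where A': "upper zs = A' @ B" "A = (case a of None \<Rightarrow> A' | Some x \<Rightarrow> x # A')"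
      proof (cases a)
        case None
        then show ?thesis using Cons.prems that[of A] by (simp add: z)
      next
        case (Some x)
        then show ?thesis using Cons.prems False that by (cases A) (auto simp: z)
      qed
      from Cons.IH[OF this(1)] obtain zs1 zs2
        where "zs = zs1 @ zs2" "upper zs1 = A'" "upper zs2 = B" by blast
      then show ?thesis
        by (intro exI[of _ "z # zs1"] exI[of _ zs2]) (auto simp: z A'(2) split: option.split)
    qed
  qed simp
  with that show ?thesis by blast
qed

section \<open>Grid paths and column lists describe the same alignments\<close>

fun path_cost ::
    "('a option \<Rightarrow> 'a option \<Rightarrow> real) \<Rightarrow> 'a list \<Rightarrow> 'a list \<Rightarrow> (nat \<times> nat) list \<Rightarrow> real" where
  "path_cost w X Y (p # q # A) = step_cost w X Y p q + path_cost w X Y (q # A)"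
| "path_cost w X Y _ = 0"

lemma alignment_cost_eq_path_cost: "alignment_cost w X Y A = path_cost w X Y A"
  by (induction A rule: induct_list012)
    (simp_all add: alignment_cost_def sum.lessThan_Suc_shift del: sum.lessThan_Suc)

lemma alignment_iff_successively:
  "alignment X Y A \<longleftrightarrow> A \<noteq> [] \<and> hd A = (0, 0) \<and> last A = (length X, length Y) \<and>
     successively alignment_step A"
  by (auto simp: alignment_def successively_conv_nth less_diff_conv)

definition kept :: "'a list \<Rightarrow> nat set \<Rightarrow> nat \<Rightarrow> nat \<Rightarrow> 'a list" where
  "kept L M a b = map ((!) L) (filter (\<lambda>x. x \<notin> M) [a..<b])"

abbreviation slice :: "'a list \<Rightarrow> nat \<Rightarrow> nat \<Rightarrow> 'a list" where
  "slice L a b \<equiv> kept L {} a b"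

lemma slice_eq: "slice L a b = map ((!) L) [a..<b]"
  by (simp add: kept_def)

lemma length_slice [simp]: "length (slice L a b) = b - a"
  by (simp add: slice_eq)

lemma nth_slice [simp]: "i < b - a \<Longrightarrow> slice L a b ! i = L ! (a + i)"
  by (simp add: slice_eq)

lemma slice_same [simp]: "slice L a a = []"
  by (simp add: slice_eq)

lemma slice_Cons: "a < b \<Longrightarrow> slice L a b = L ! a # slice L (Suc a) b"
  by (simp add: slice_eq upt_conv_Cons)

lemma slice_full [simp]: "slice L 0 (length L) = L"
  by (simp add: slice_eq map_nth)

lemma path_columns:
  assumes "A \<noteq> []" "successively alignment_step A" "hd A = (x, y)" "last A = (x', y')"
  shows "\<exists>zs. x \<le> x' \<and> y \<le> y' \<and> upper zs = slice X x x' \<and> lower zs = slice Y y y' \<and>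
           columns_cost w zs = path_cost w X Y A"
  using assms
proof (induction A arbitrary: x y rule: induct_list012)
  case (2 p)
  then show ?case by (auto intro: exI[of _ "[]"])
next
  case (3 p q A)
  obtain x1 y1 where q: "q = (x1, y1)" by (cases q)
  have p: "p = (x, y)" using 3 by simp
  have st: "alignment_step p q" using 3 by simp
  from 3(2)[of x1 y1] 3(3-) q obtain zs where zs: "x1 \<le> x'" "y1 \<le> y'" "upper zs = slice X x1 x'"
    "lower zs = slice Y y1 y'" "columns_cost w zs = path_cost w X Y (q # A)" by auto
  define c where "c = (if x1 = x then None else Some (X ! x), if y1 = y then None else Some (Y ! y))"
  have "columns_cost w (c # zs) = path_cost w X Y (p # q # A)"
    using st by (auto simp: columns_cost_Cons zs c_def step_cost_def p q alignment_step_def)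
  moreover have "upper (c # zs) = slice X x x'" "lower (c # zs) = slice Y y y'" "x \<le> x'" "y \<le> y'"
    using st zs by (auto simp: c_def alignment_step_def p q slice_Cons)
  ultimately show ?case by blast
qed simp

lemma columns_path:
  assumes "x + length (upper zs) = length X" "y + length (lower zs) = length Y"
    "upper zs = drop x X" "lower zs = drop y Y" "weight_function w"
  shows "\<exists>A. A \<noteq> [] \<and> hd A = (x, y) \<and> last A = (length X, length Y) \<and>
          successively alignment_step A \<and> path_cost w X Y A = columns_cost w zs"
  using assms(1-4)
proof (induction zs arbitrary: x y)
  case Nil
  then show ?case by (intro exI[of _ "[(length X, length Y)]"]) auto
next
  case (Cons z zs)
  obtain a b where z: "z = (a, b)" by (cases z)
  have ha: "x < length X \<and> X ! x = a' \<and> upper zs = drop (Suc x) X" if "a = Some a'" for a'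
  proof -
    have "a' # upper zs = drop x X" using Cons.prems(3) that z by simp
    then show ?thesis
      by (metis Cons_nth_drop_Suc drop_eq_Nil leI list.distinct(1) list.inject)
  qed
  have hb: "y < length Y \<and> Y ! y = b' \<and> lower zs = drop (Suc y) Y" if "b = Some b'" for b'
  proof -
    have "b' # lower zs = drop y Y" using Cons.prems(4) that z by simp
    then show ?thesis
      by (metis Cons_nth_drop_Suc drop_eq_Nil leI list.distinct(1) list.inject)
  qed
  define x1 where "x1 = (if a = None then x else Suc x)"
  define y1 where "y1 = (if b = None then y else Suc y)"
  have "\<exists>A. A \<noteq> [] \<and> hd A = (x1, y1) \<and> last A = (length X, length Y) \<and>
          successively alignment_step A \<and> path_cost w X Y A = columns_cost w zs"
  proof (rule Cons.IH)
    show "x1 + length (upper zs) = length X" "upper zs = drop x1 X"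
      using Cons.prems ha by (cases a; simp add: x1_def z)+
    show "y1 + length (lower zs) = length Y" "lower zs = drop y1 Y"
      using Cons.prems hb by (cases b; simp add: y1_def z)+
  qed
  then obtain A where A: "A \<noteq> []" "hd A = (x1, y1)" "last A = (length X, length Y)"
    "successively alignment_step A" "path_cost w X Y A = columns_cost w zs" by blast
  \<comment> \<open>An empty column is no step of a path; it is dropped, which is free because
    \<open>w None None = 0\<close>.\<close>
  show ?case
  proof (cases "a = None \<and> b = None")
    case True
    then show ?thesis using A assms(5)
      by (intro exI[of _ A]) (auto simp: x1_def y1_def z columns_cost_Cons weight_function_def)
  next
    case False
    obtain A' where A': "A = (x1, y1) # A'" using A by (cases A) auto
    have "step_cost w X Y (x, y) (x1, y1) = w a b"
      using False ha hb by (cases a; cases b) (auto simp: step_cost_def x1_def y1_def)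
    moreover have "alignment_step (x, y) (x1, y1)"
      using False by (auto simp: alignment_step_def x1_def y1_def)
    ultimately show ?thesis using A
      by (intro exI[of _ "(x, y) # A"]) (auto simp: A' z columns_cost_Cons)
  qed
qed

lemma ed_le_iff:
  assumes "weight_function w"
  shows "ed w X Y \<le> r \<longleftrightarrow> (\<exists>zs. upper zs = X \<and> lower zs = Y \<and> columns_cost w zs \<le> r)"
proof -
  have "ed w X Y \<le> r \<longleftrightarrow> (\<exists>A. alignment X Y A \<and> path_cost w X Y A \<le> r)"
    unfolding ed_def using finite_alignments[of X Y] alignments_nonempty[of X Y]
    by (subst Min_le_iff) (auto simp: alignment_cost_eq_path_cost)
  also have "\<dots> \<longleftrightarrow> (\<exists>zs. upper zs = X \<and> lower zs = Y \<and> columns_cost w zs \<le> r)"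
  proof
    assume "\<exists>A. alignment X Y A \<and> path_cost w X Y A \<le> r"
    then obtain A where A: "alignment X Y A" "path_cost w X Y A \<le> r" by blast
    with path_columns[of A 0 0 "length X" "length Y" X Y w] show
      "\<exists>zs. upper zs = X \<and> lower zs = Y \<and> columns_cost w zs \<le> r"
      by (auto simp: alignment_iff_successively)
  next
    assume "\<exists>zs. upper zs = X \<and> lower zs = Y \<and> columns_cost w zs \<le> r"
    with columns_path[of 0 _ X 0 Y w] assms show "\<exists>A. alignment X Y A \<and> path_cost w X Y A \<le> r"
      by (fastforce simp: alignment_iff_successively)
  qed
  finally show ?thesis .
qed

text \<open>A distance of at most \<open>k\<close> is attained by an alignment with at most
  \<open>k\<close> edits, so only such alignments need to be transformed. If neither distance is at
  most \<open>k\<close>, both sides are \<open>\<infinity>\<close>.\<close>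

lemma ed_le_eqI:
  assumes "weight_function w"
    and "\<And>zs. upper zs = X \<Longrightarrow> lower zs = Y \<Longrightarrow> edits zs \<le> k \<Longrightarrow>
      \<exists>zs'. upper zs' = X' \<and> lower zs' = Y' \<and> columns_cost w zs' \<le> columns_cost w zs"
    and "\<And>zs. upper zs = X' \<Longrightarrow> lower zs = Y' \<Longrightarrow> edits zs \<le> k \<Longrightarrow>
      \<exists>zs'. upper zs' = X \<and> lower zs' = Y \<and> columns_cost w zs' \<le> columns_cost w zs"
  shows "ed_le w k X Y = ed_le w k X' Y'"
proof -
  have mono: "ed w U' V' \<le> ed w U V" if k: "ed w U V \<le> real k"
    and "\<And>zs. upper zs = U \<Longrightarrow> lower zs = V \<Longrightarrow> edits zs \<le> k \<Longrightarrow>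
      \<exists>zs'. upper zs' = U' \<and> lower zs' = V' \<and> columns_cost w zs' \<le> columns_cost w zs" for U V U' V'
  proof -
    obtain zs where zs: "upper zs = U" "lower zs = V" "columns_cost w zs \<le> ed w U V"
      using ed_le_iff[OF assms(1), of U V "ed w U V"] by auto
    with k edits_le_columns_cost[OF assms(1), of zs] have "edits zs \<le> k" by linarith
    with that(2) zs obtain zs' where "upper zs' = U'" "lower zs' = V'"
      "columns_cost w zs' \<le> columns_cost w zs" by blast
    with zs show ?thesis using ed_le_iff[OF assms(1), of U' V' "ed w U V"] by force
  qed
  show ?thesis
    using mono[of X Y X' Y', OF _ assms(2)] mono[of X' Y' X Y, OF _ assms(3)]
    by (force simp: ed_le_def)
qed

section \<open>Equivalence of matched fragments\<close>

definition absdiff :: "nat \<Rightarrow> nat \<Rightarrow> nat" where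
  "absdiff a b = (a - b) + (b - a)"

text \<open>Every alignment with at most \<open>k\<close> edits stays on diagonals \<open>\<delta>\<close> with
  \<open>\<bar>\<delta>\<bar> + \<bar>\<delta> - (\<bar>Y\<bar> - \<bar>X\<bar>)\<bar> \<le> k\<close>. The side condition puts the matched copies of \<open>P\<close> on such a
  diagonal; any two of these are at distance at most \<open>k\<close>.\<close>

definition fragment_equiv :: "nat \<Rightarrow> 'a list \<Rightarrow> 'a list \<Rightarrow> bool" where
  "fragment_equiv k P P' \<longleftrightarrow> (\<forall>w U U' V V'. weight_function w \<longrightarrow>
     absdiff (length U) (length U') + absdiff (length V) (length V') \<le> k \<longrightarrow>
     ed_le w k (U @ P @ V) (U' @ P @ V') = ed_le w k (U @ P' @ V) (U' @ P' @ V'))"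

lemma fragment_equiv_refl [simp]: "fragment_equiv k P P"
  by (simp add: fragment_equiv_def)

lemma fragment_equiv_trans [trans]:
  "fragment_equiv k P Q \<Longrightarrow> fragment_equiv k Q R \<Longrightarrow> fragment_equiv k P R"
  by (simp add: fragment_equiv_def)

text \<open>The context \<open>A\<close>, \<open>B\<close> is absorbed into the surroundings of both
  copies, whose length differences do not change.\<close>

lemma fragment_equiv_append:
  assumes "fragment_equiv k P P'"
  shows "fragment_equiv k (A @ P @ B) (A @ P' @ B)"
  unfolding fragment_equiv_def
proof (intro allI impI)
  fix w :: "'a option \<Rightarrow> 'a option \<Rightarrow> real" and U U' V V' :: "'a list"
  assume "weight_function w" "absdiff (length U) (length U') + absdiff (length V) (length V') \<le> k"
  then show "ed_le w k (U @ (A @ P @ B) @ V) (U' @ (A @ P @ B) @ V') =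
      ed_le w k (U @ (A @ P' @ B) @ V) (U' @ (A @ P' @ B) @ V')"
    using assms[unfolded fragment_equiv_def, rule_format, of w "U @ A" "U' @ A" "B @ V" "B @ V'"]
    by (simp add: absdiff_def)
qed

text \<open>\<open>S\<close> and \<open>S'\<close> play symmetric roles, so one transformation,
  stated for either order of the pair, gives both inequalities.\<close>

lemma fragment_equivI:
  assumes "\<And>P P' w U U' V V' zs. (P, P') = (S, S') \<or> (P, P') = (S', S) \<Longrightarrow> weight_function w \<Longrightarrow>
      absdiff (length U) (length U') + absdiff (length V) (length V') \<le> k \<Longrightarrow>
      upper zs = U @ P @ V \<Longrightarrow> lower zs = U' @ P @ V' \<Longrightarrow> edits zs \<le> k \<Longrightarrow>
      \<exists>zs'. upper zs' = U @ P' @ V \<and> lower zs' = U' @ P' @ V' \<and> columns_cost w zs' \<le> columns_cost w zs"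
  shows "fragment_equiv k S S'"
  unfolding fragment_equiv_def
proof (intro allI impI)
  fix w :: "'a option \<Rightarrow> 'a option \<Rightarrow> real" and U U' V V' :: "'a list"
  assume *: "weight_function w" "absdiff (length U) (length U') + absdiff (length V) (length V') \<le> k"
  show "ed_le w k (U @ S @ V) (U' @ S @ V') = ed_le w k (U @ S' @ V) (U' @ S' @ V')"
    using assms[of S S', OF _ *] assms[of S' S, OF _ *] by (intro ed_le_eqI[OF *(1)]) auto
qed

section \<open>Periods, and the two reductions of a matched fragment\<close>

definition has_period :: "nat \<Rightarrow> 'a list \<Rightarrow> bool" where
  "has_period q W \<longleftrightarrow> (\<forall>u. u + q < length W \<longrightarrow> W ! u = W ! (u + q))"

text \<open>A string of length at most \<open>q\<close> has period \<open>q\<close> vacuously, so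
  for positive \<open>k\<close> an aperiodic string is longer than \<open>k\<close>.\<close>

definition aperiodic :: "nat \<Rightarrow> 'a list \<Rightarrow> bool" where
  "aperiodic k W \<longleftrightarrow> (\<forall>q. 0 < q \<longrightarrow> q \<le> k \<longrightarrow> \<not> has_period q W)"

lemma aperiodic_append:
  assumes "aperiodic k W"
  shows "aperiodic k (A @ W @ B)"
  unfolding aperiodic_def
proof (intro allI impI notI)
  fix q assume q: "0 < q" "q \<le> k" "has_period q (A @ W @ B)"
  have "has_period q W"
    unfolding has_period_def
  proof (intro allI impI)
    fix u assume "u + q < length W"
    then show "W ! u = W ! (u + q)"
      using q(3)[unfolded has_period_def, rule_format, of "length A + u"]
      by (simp add: nth_append)
  qed
  with q assms show False by (simp add: aperiodic_def)
qed

text \<open>Pigeonhole: \<open>e\<close> edits cannot touch all of more than \<open>e\<close> disjoint fragments.\<close>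

lemma untouched_fragment:
  assumes "upper zs = concat Ws @ V" "edits zs < length Ws"
  shows "\<exists>z1 z z2 Ws1 W Ws2. zs = z1 @ z @ z2 \<and> Ws = Ws1 @ W # Ws2 \<and> upper z1 = concat Ws1 \<and>
    upper z = W \<and> edits z = 0"
  using assms
proof (induction Ws arbitrary: zs)
  case (Cons W Ws)
  from Cons.prems(1) have "upper zs = W @ concat Ws @ V" by simp
  then obtain z zs' where z: "zs = z @ zs'" "upper z = W" "upper zs' = concat Ws @ V"
    by (rule upper_split)
  show ?case
  proof (cases "edits z = 0")
    case True
    then show ?thesis using z
      by (intro exI[of _ "[]"] exI[of _ z] exI[of _ zs'] exI[of _ W] exI[of _ Ws]) simp
  next
    case False
    with Cons.prems z have "edits zs' < length Ws" by simp
    from Cons.IH[OF z(3) this] obtain z1 z' z2 Ws1 W' Ws2 where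
      "zs' = z1 @ z' @ z2" "Ws = Ws1 @ W' # Ws2" "upper z1 = concat Ws1"
      "upper z' = W'" "edits z' = 0" by blast
    with z show ?thesis
      by (intro exI[of _ "z @ z1"] exI[of _ z'] exI[of _ z2] exI[of _ "W # Ws1"] exI[of _ W']
          exI[of _ Ws2]) simp
  qed
qed simp

text \<open>Let \<open>d\<close> be the signed difference of \<open>length (lower z1)\<close> and
  \<open>length U'\<close>. The edits of \<open>z1\<close> and the difference of \<open>U\<close>,
  \<open>U'\<close> bound its absolute value, and so do the edits of \<open>z2\<close> and the
  difference of \<open>V\<close>, \<open>V'\<close>. Adding the two bounds gives twice the absolute
  value of \<open>d\<close> on one side and at most \<open>2 * k\<close> on the other.\<close>

lemma prefix_shift_bound:
  assumes "upper (z1 @ z2) = U @ V" "lower (z1 @ z2) = U' @ V'" "upper z1 = U"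
    and "absdiff (length U) (length U') + absdiff (length V) (length V') \<le> k"
    and "edits (z1 @ z2) \<le> k"
  shows "absdiff (length (lower z1)) (length U') \<le> k"
proof -
  have "length (upper z2) = length V" using assms(1,3) by simp
  moreover have "length (lower z1) + length (lower z2) = length U' + length V'"
    using arg_cong[OF assms(2), of length] by simp
  ultimately show ?thesis
    using assms(3-5) length_upper_le[of z1] length_lower_le[of z1]
      length_upper_le[of z2] length_lower_le[of z2]
    by (simp add: absdiff_def)
qed

text \<open>An aperiodic fragment that is aligned without edits lies on the diagonal on which it is
  matched, for otherwise it would have the distance of the two diagonals as a period.\<close>

lemma touches_diagonal:
  assumes "upper zs = U @ concat Ws @ V" "lower zs = U' @ concat Ws @ V'" "edits zs \<le> k"
    and "absdiff (length U) (length U') + absdiff (length V) (length V') \<le> k"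
    and "k < length Ws" "\<forall>W\<in>set Ws. aperiodic k W"
  obtains z1 z2 A B where "zs = z1 @ z2" "concat Ws = A @ B"
    "upper z1 = U @ A" "lower z1 = U' @ A" "upper z2 = B @ V" "lower z2 = B @ V'"
proof -
  obtain z0 zs' where z0: "zs = z0 @ zs'" "upper z0 = U" "upper zs' = concat Ws @ V"
    using upper_split[OF assms(1)] by blast
  have "edits zs' < length Ws" using assms(3,5) z0 by simp
  from untouched_fragment[OF z0(3) this] obtain z1' z z2 Ws1 W Ws2 where
    d: "zs' = z1' @ z @ z2" "Ws = Ws1 @ W # Ws2" "upper z1' = concat Ws1" "upper z = W"
      "edits z = 0" by blast
  define z1 where "z1 = z0 @ z1'"
  define A where "A = concat Ws1"
  define B where "B = W @ concat Ws2"
  have zs: "zs = z1 @ (z @ z2)" and u1: "upper z1 = U @ A" and c: "concat Ws = A @ B"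
    using z0 d by (simp_all add: z1_def A_def B_def)
  have lz: "lower z = W" using d edits_0_lower by metis
  have low: "lower z1 @ W @ lower z2 = U' @ A @ B @ V'"
    using assms(2) zs lz c by simp
  have le: "absdiff (length (lower z1)) (length (U' @ A)) \<le> k"
    by (rule prefix_shift_bound[of z1 "z @ z2" "U @ A" "B @ V" "U' @ A" "B @ V'"])
      (use assms(1-4) zs c u1 in \<open>auto simp: absdiff_def\<close>)
  have "absdiff (length (lower z1)) (length (U' @ A)) = 0"
  proof (rule ccontr)
    let ?p = "absdiff (length (lower z1)) (length (U' @ A))"
    assume "?p \<noteq> 0"
    \<comment> \<open>\<open>W\<close> occurs in \<open>F\<close> at
      \<open>length (lower z1)\<close>, where it is aligned, and at \<open>length (U' @ A)\<close>,
      where it is matched; comparing the two occurrences yields the period.\<close>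
    define F where "F = lower z1 @ W @ lower z2"
    have F1: "W ! v = F ! (length (lower z1) + v)" if "v < length W" for v
      using that by (simp add: F_def nth_append)
    have F2: "W ! v = F ! (length (U' @ A) + v)" if "v < length W" for v
    proof -
      have "F = (U' @ A) @ (W @ concat Ws2 @ V')" by (simp add: F_def low B_def)
      then show ?thesis using that by (simp only: nth_append_length_plus) (simp add: nth_append)
    qed
    have "has_period ?p W"
      unfolding has_period_def
    proof (intro allI impI)
      fix v assume v: "v + ?p < length W"
      then have v': "v < length W" by simp
      consider "length (lower z1) + ?p = length (U' @ A)" | "length (U' @ A) + ?p = length (lower z1)"
        by (cases "length (lower z1) \<le> length (U' @ A)") (auto simp: absdiff_def)
      then show "W ! v = W ! (v + ?p)"
      proof cases
        case 1
        then have "length (lower z1) + (v + ?p) = length (U' @ A) + v" by simp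
        then show ?thesis by (simp only: F1[OF v] F2[OF v'])
      next
        case 2
        then have "length (U' @ A) + (v + ?p) = length (lower z1) + v" by simp
        then show ?thesis by (simp only: F2[OF v] F1[OF v'])
      qed
    qed
    moreover have "aperiodic k W" using assms(6) d by simp
    ultimately show False
      using \<open>?p \<noteq> 0\<close> le by (auto simp: aperiodic_def)
  qed
  then have "length (lower z1) = length (U' @ A)" by (simp add: absdiff_def)
  with low have l1: "lower z1 = U' @ A" "W @ lower z2 = B @ V'"
    by (metis append_assoc append_eq_append_conv)+
  have "upper (z @ z2) = B @ V" using assms(1) u1 unfolding zs c upper_append by simp
  moreover have "lower (z @ z2) = B @ V'" by (simp add: lz l1(2))
  ultimately show ?thesis by (rule that[OF zs c u1 l1(1)])
qed

lemma fragment_equiv_cut: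
  assumes "k < length Ws" "\<forall>W\<in>set Ws. aperiodic k W"
    and "k < length Ws'" "\<forall>W\<in>set Ws'. aperiodic k W"
  shows "fragment_equiv k (concat Ws @ P @ concat Ws') (concat Ws @ P' @ concat Ws')"
proof (rule fragment_equivI)
  fix R R' U U' V V' zs and w :: "'a option \<Rightarrow> 'a option \<Rightarrow> real"
  assume R: "(R, R') = (concat Ws @ P @ concat Ws', concat Ws @ P' @ concat Ws') \<or>
      (R, R') = (concat Ws @ P' @ concat Ws', concat Ws @ P @ concat Ws')"
    and w: "weight_function w"
    and UV: "absdiff (length U) (length U') + absdiff (length V) (length V') \<le> k"
    and zs: "upper zs = U @ R @ V" "lower zs = U' @ R @ V'" "edits zs \<le> k"
  from R obtain Q Q' where Q: "R = concat Ws @ Q @ concat Ws'" "R' = concat Ws @ Q' @ concat Ws'"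
    by blast
  obtain z1 z2 A B where t1: "zs = z1 @ z2" "concat Ws = A @ B" "upper z1 = U @ A"
    "lower z1 = U' @ A" "upper z2 = B @ Q @ concat Ws' @ V" "lower z2 = B @ Q @ concat Ws' @ V'"
    by (rule touches_diagonal[of zs U Ws "Q @ concat Ws' @ V" U' "Q @ concat Ws' @ V'" k])
      (use zs Q UV assms in \<open>auto simp: absdiff_def\<close>)
  obtain z3 z4 A' B' where t2: "z2 = z3 @ z4" "concat Ws' = A' @ B'" "upper z3 = (B @ Q) @ A'"
    "lower z3 = (B @ Q) @ A'" "upper z4 = B' @ V" "lower z4 = B' @ V'"
    by (rule touches_diagonal[of z2 "B @ Q" Ws' V "B @ Q" V' k])
      (use zs t1 UV assms in \<open>auto simp: absdiff_def\<close>)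
  show "\<exists>zs'. upper zs' = U @ R' @ V \<and> lower zs' = U' @ R' @ V' \<and>
      columns_cost w zs' \<le> columns_cost w zs"
    \<comment> \<open>Both ends of \<open>z3\<close> lie on the diagonal of the fragment, so it can
      be replaced by free columns over the new middle part.\<close>
    by (rule exI[of _ "z1 @ diagonal (B @ Q' @ A') @ z4"])
      (use t1 t2 Q w columns_cost_nonneg[OF w, of z3] in simp)
qed

text \<open>Removing a window shifts what follows by \<open>q\<close>, which a period
  \<open>q\<close> does not notice. So it does not matter where the window lies, and the copies in
  \<open>X\<close> and in \<open>Y\<close> may lose different windows and still become
  equal.\<close>

lemma has_period_diff:
  assumes "has_period q R" "R = A @ W @ B" "length W = q"
  shows "A @ B = drop q R"
proof (rule nth_equalityI)
  fix u assume u: "u < length (A @ B)"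
  show "(A @ B) ! u = drop q R ! u"
  proof (cases "u < length A")
    case True
    then have "(A @ B) ! u = R ! u" by (simp add: assms nth_append)
    also have "\<dots> = R ! (u + q)" using assms(1) u by (simp add: has_period_def assms(2,3))
    also have "\<dots> = drop q R ! u"
    proof -
      have "q \<le> length R" using assms(3) by (simp add: assms(2))
      then show ?thesis by (simp add: add.commute)
    qed
    finally show ?thesis .
  next
    case False
    have R: "R = (A @ W) @ B" by (simp add: assms(2))
    have "drop q R ! u = R ! (q + u)" using assms(3) by (intro nth_drop) (simp add: assms(2))
    also have "\<dots> = B ! (u - length A)" unfolding R nth_append using False assms(3) by simp
    finally show ?thesis using False by (simp add: nth_append)
  qed
qed (use assms in simp)

text \<open>The converse of \<open>has_period_diff\<close>: repeating a window of length
  \<open>q\<close> anywhere restores the dropped period.\<close>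

lemma has_period_dup:
  assumes "has_period q R" "drop q R = A @ W @ B" "length W = q"
  shows "R = A @ W @ W @ B"
proof -
  have len: "length R = q + length (A @ W @ B)"
  proof -
    have "length (drop q R) = length (A @ W @ B)" using assms(2) by simp
    then show ?thesis using assms(3) by (cases "q = 0") auto
  qed
  have per: "R ! u = (A @ W @ B) ! u" if "u < length (A @ W @ B)" for u
  proof -
    have "R ! u = R ! (u + q)" using assms(1) that len by (simp add: has_period_def)
    also have "\<dots> = drop q R ! u" using that len by (simp add: add.commute)
    finally show ?thesis by (simp add: assms(2))
  qed
  have "take (length (A @ W)) R = A @ W"
    by (rule nth_equalityI) (use per len in \<open>auto simp: nth_append\<close>)
  moreover have "drop (length (A @ W)) R = W @ B"
  proof -
    have "drop (length (A @ W)) R = drop (length A) (drop q R)"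
      using assms(3) by (simp add: add.commute)
    then show ?thesis by (simp add: assms(2))
  qed
  ultimately show ?thesis by (metis append_assoc append_take_drop_id)
qed

text \<open>The candidate blocks keep \<open>k\<close> symbols of \<open>R\<close> free at either
  end. By \<open>prefix_shift_bound\<close> the untouched block is displaced by at most
  \<open>k\<close> in the lower string, so its image still lies inside that copy of
  \<open>R\<close>.\<close>

lemma untouched_block:
  assumes "upper zs = U @ R @ V" "lower zs = U' @ R @ V'" "edits zs \<le> k"
    and "absdiff (length U) (length U') + absdiff (length V) (length V') \<le> k"
    and "(k + 1) * q + 2 * k \<le> length R"
  obtains z1 z z2 A B A' B' W where "zs = z1 @ z @ z2" "upper z = W" "lower z = W" "length W = q"
    "upper z1 = U @ A" "lower z1 = U' @ A'" "upper z2 = B @ V" "lower z2 = B' @ V'"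
    "R = A @ W @ B" "R = A' @ W @ B'"
proof -
  define Ws where "Ws = map (\<lambda>i. take q (drop (k + i * q) R)) [0..<Suc k]"
  have cc: "concat (map (\<lambda>i. take q (drop (i * q) L)) [0..<j]) = take (j * q) L" for j and L :: "'a list"
    by (induction j) (simp_all add: add.commute flip: take_add)
  have Ws: "concat Ws = take (Suc k * q) (drop k R)"
    using cc[of "drop k R" "Suc k"] by (simp add: Ws_def add.commute del: upt_Suc mult_Suc)
  define Re where "Re = drop (Suc k * q) (drop k R)"
  have R: "R = take k R @ concat Ws @ Re" by (simp add: Ws Re_def del: drop_drop)
  have Re: "k \<le> length Re" using assms(5) by (simp add: Re_def)
  have "upper zs = (U @ take k R) @ (concat Ws @ Re @ V)" using assms(1) R by simp
  then obtain z0 zs' where z0: "zs = z0 @ zs'" "upper z0 = U @ take k R"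
    "upper zs' = concat Ws @ Re @ V" by (rule upper_split)
  have "edits zs' < length Ws" using assms(3) z0 by (simp add: Ws_def)
  from untouched_fragment[OF z0(3) this] obtain z1' z z2 Ws1 W Ws2 where
    d: "zs' = z1' @ z @ z2" "Ws = Ws1 @ W # Ws2" "upper z1' = concat Ws1" "upper z = W"
      "edits z = 0" by blast
  define z1 where "z1 = z0 @ z1'"
  define A where "A = take k R @ concat Ws1"
  define B where "B = concat Ws2 @ Re"
  have zs: "zs = z1 @ (z @ z2)" and u1: "upper z1 = U @ A" and RW: "R = A @ W @ B"
    using z0 d R by (simp_all add: z1_def A_def B_def)
  have lz: "lower z = W" using d edits_0_lower by metis
  have "W \<in> set Ws" by (simp add: d)
  then have "W \<in> (\<lambda>i. take q (drop (k + i * q) R)) ` {0..<Suc k}"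
    by (simp add: Ws_def del: upt_Suc)
  then obtain i where "i \<in> {0..<Suc k}" and W: "W = take q (drop (k + i * q) R)" by blast
  then have i: "i \<le> k" by simp
  have "i * q \<le> k * q" "(k + 1) * q = k * q + q" using i by simp_all
  with assms(5) have "k + i * q + q \<le> length R" by linarith
  then have lW: "length W = q" by (simp add: W)
  have lA: "k \<le> length A" using assms(5) by (simp add: A_def)
  have lB: "k \<le> length B" using Re by (simp add: B_def)
  have low: "lower z1 @ W @ lower z2 = U' @ R @ V'"
    using assms(2) zs lz by simp
  have "absdiff (length (lower z1)) (length (U' @ A)) \<le> k"
    by (rule prefix_shift_bound[of z1 "z @ z2" "U @ A" "W @ B @ V" "U' @ A" "W @ B @ V'"])
      (use assms(1-4) zs RW u1 in \<open>auto simp: absdiff_def\<close>)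
  then have b: "length U' \<le> length (lower z1)" "length (lower z1 @ W) \<le> length (U' @ R)"
    using lA lB by (auto simp: absdiff_def RW)
  define A' where "A' = drop (length U') (lower z1)"
  have l1: "lower z1 = U' @ A'"
  proof -
    have "take (length U') (lower z1 @ W @ lower z2) = U'" by (simp add: low)
    then have "take (length U') (lower z1) = U'" using b(1) by simp
    then show ?thesis by (metis A'_def append_take_drop_id)
  qed
  have low2: "(A' @ W) @ lower z2 = R @ V'" using low by (simp add: l1)
  define B' where "B' = drop (length (A' @ W)) R"
  have "take (length (A' @ W)) R = A' @ W"
  proof -
    have "take (length (A' @ W)) (R @ V') = A' @ W" by (simp flip: low2)
    then show ?thesis using b(2) by (simp add: l1)
  qed
  then have RB': "R = A' @ W @ B'" by (metis B'_def append_assoc append_take_drop_id)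
  have "upper z2 = B @ V" using assms(1) u1 d(4) by (simp add: zs RW)
  moreover have "lower z2 = B' @ V'" using low2 by (simp add: RB')
  ultimately show ?thesis by (intro that[OF zs d(4) lz lW u1 l1 _ _ RW RB'])
qed

text \<open>The untouched block is cut out of the alignment, or repeated in it at no cost. The
  length bound is that of \<open>untouched_block\<close> for the shorter string
  \<open>drop q R\<close>, from which the second direction starts.\<close>

lemma fragment_equiv_drop_period:
  assumes "has_period q R" "(k + 1) * q + 2 * k + q \<le> length R"
  shows "fragment_equiv k R (drop q R)"
proof (rule fragment_equivI)
  fix P P' U U' V V' zs and w :: "'a option \<Rightarrow> 'a option \<Rightarrow> real"
  assume P: "(P, P') = (R, drop q R) \<or> (P, P') = (drop q R, R)"
    and w: "weight_function w"
    and UV: "absdiff (length U) (length U') + absdiff (length V) (length V') \<le> k"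
    and zs: "upper zs = U @ P @ V" "lower zs = U' @ P @ V'" "edits zs \<le> k"
  have "(k + 1) * q + 2 * k \<le> length P" using P assms(2) by auto
  then obtain z1 z z2 A B A' B' W where s: "zs = z1 @ z @ z2" "upper z = W" "lower z = W"
    "length W = q" "upper z1 = U @ A" "lower z1 = U' @ A'" "upper z2 = B @ V" "lower z2 = B' @ V'"
    "P = A @ W @ B" "P = A' @ W @ B'"
    by (rule untouched_block[OF zs UV])
  from P show "\<exists>zs'. upper zs' = U @ P' @ V \<and> lower zs' = U' @ P' @ V' \<and>
      columns_cost w zs' \<le> columns_cost w zs"
  proof
    assume P: "(P, P') = (R, drop q R)"
    then have PR: "P = R" and P': "P' = drop q R" by simp_all
    have "P' = A @ B" "P' = A' @ B'"
      unfolding P' using has_period_diff[OF assms(1) s(9)[unfolded PR] s(4)]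
        has_period_diff[OF assms(1) s(10)[unfolded PR] s(4)] by simp_all
    then have "upper (z1 @ z2) = U @ P' @ V \<and> lower (z1 @ z2) = U' @ P' @ V'"
      using s(5-8) by simp
    then show ?thesis
      using columns_cost_nonneg[OF w, of z] by (intro exI[of _ "z1 @ z2"]) (simp add: s(1))
  next
    assume P: "(P, P') = (drop q R, R)"
    then have PR: "P = drop q R" and P': "P' = R" by simp_all
    have "P' = A @ W @ W @ B" "P' = A' @ W @ W @ B'"
      unfolding P' by (rule has_period_dup[OF assms(1) _ s(4)], use s(9,10) PR in metis)+
    then have "upper (z1 @ diagonal W @ z @ z2) = U @ P' @ V"
      "lower (z1 @ diagonal W @ z @ z2) = U' @ P' @ V'"
      using s(2,3,5-8) by simp_all
    then show ?thesis
      using w by (intro exI[of _ "z1 @ diagonal W @ z @ z2"]) (simp add: s(1))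
  qed
qed

lemma has_period_drop: "has_period q R \<Longrightarrow> has_period q (drop n R)"
  unfolding has_period_def
proof (intro allI impI)
  fix u assume *: "\<forall>u. u + q < length R \<longrightarrow> R ! u = R ! (u + q)" "u + q < length (drop n R)"
  from *(1)[rule_format, of "n + u"] *(2) show "drop n R ! u = drop n R ! (u + q)"
    by (simp add: add.assoc)
qed

lemma fragment_equiv_drop_periods:
  assumes "has_period q R" "(k + 1) * q + 2 * k + c * q \<le> length R"
  shows "fragment_equiv k R (drop (c * q) R)"
  using assms(2)
proof (induction c)
  case (Suc c)
  then have "fragment_equiv k R (drop (c * q) R)" by simp
  also have "fragment_equiv k (drop (c * q) R) (drop q (drop (c * q) R))"
    by (rule fragment_equiv_drop_period) (use assms(1) Suc.prems has_period_drop in auto)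
  finally show ?case by (simp add: add.commute)
qed simp

text \<open>For two periods \<open>p, q \<le> k\<close> of long strings, stepping back by \<open>p + q\<close> shows that the first
  position which breaks one of them also breaks the other.\<close>

lemma aperiodic_break:
  assumes "has_period q W" "2 * k \<le> length W" "0 < q" "q \<le> k" "W ! (length W - q) \<noteq> a"
  shows "aperiodic k (W @ [a])"
  unfolding aperiodic_def
proof (intro allI impI notI)
  fix p assume p: "0 < p" "p \<le> k" "has_period p (W @ [a])"
  let ?l = "length W"
  have "0 < ?l" using assms(2-4) by linarith
  then have lt: "?l - p < ?l" "?l - q < ?l" "?l - (q + p) < ?l" using p(1) assms(3) by simp_all
  then have "W ! (?l - p) = a"
    using p(3)[unfolded has_period_def, rule_format, of "?l - p"] p(1,2) assms(2-4)
    by (simp add: nth_append)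
  moreover have "W ! (?l - p - q) = W ! (?l - p)"
    using assms(1)[unfolded has_period_def, rule_format, of "?l - p - q"] p(1,2) assms(2-4)
    by simp
  moreover have "W ! (?l - q - p) = W ! (?l - q)"
    using p(3)[unfolded has_period_def, rule_format, of "?l - q - p"] p(1,2) assms(2-4) lt
    by (simp add: nth_append)
  ultimately show False using assms(5) by (simp add: add.commute)
qed

section \<open>Deleting sets of positions, and matches between two strings\<close>

lemma kept_append:
  assumes "a \<le> b" "b \<le> c"
  shows "kept L M a c = kept L M a b @ kept L M b c"
  using upt_add_eq_append[OF assms(1), of "c - b"] assms(2) by (simp add: kept_def)

lemma kept_cong:
  assumes "\<And>x. a \<le> x \<Longrightarrow> x < b \<Longrightarrow> x \<in> M \<longleftrightarrow> x \<in> M'"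
  shows "kept L M a b = kept L M' a b"
  unfolding kept_def by (intro arg_cong[of _ _ "map ((!) L)"] filter_cong) (use assms in auto)

lemma kept_eq_slice: "(\<And>x. a \<le> x \<Longrightarrow> x < b \<Longrightarrow> x \<notin> M) \<Longrightarrow> kept L M a b = slice L a b"
  by (rule kept_cong) simp

lemma kept_eq_Nil: "(\<And>x. a \<le> x \<Longrightarrow> x < b \<Longrightarrow> x \<in> M) \<Longrightarrow> kept L M a b = []"
  by (simp add: kept_def filter_empty_conv)

lemma kept_same [simp]: "kept L M a a = []"
  by (simp add: kept_def)

lemma length_kept_le: "length (kept L M a b) \<le> b - a"
  unfolding kept_def by (metis length_filter_le length_map length_upt)

lemma length_kept_interval:
  assumes "D \<subseteq> {a..<b}"
  shows "length (kept L D a b) + card D = b - a"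
proof -
  have "set (filter (\<lambda>x. x \<notin> D) [a..<b]) = {a..<b} - D" by auto
  then have "length (kept L D a b) = card ({a..<b} - D)"
    using distinct_card[of "filter (\<lambda>x. x \<notin> D) [a..<b]"] by (simp add: kept_def)
  moreover have "card ({a..<b} - D) + card D = b - a"
    using assms card_Diff_subset[of D "{a..<b}"] card_mono[of "{a..<b}" D] finite_subset[OF assms]
    by simp
  ultimately show ?thesis by simp
qed

lemma length_kept:
  assumes "M \<subseteq> {..<b}"
  shows "length (kept L M 0 b) + card M = b"
  using length_kept_interval[of M 0 b L] assms by (simp add: atLeast0LessThan)

lemma kept_shift:
  assumes "\<And>u. u < l \<Longrightarrow> L ! (a + u) = L' ! (a' + u)"
    and "\<And>u. u < l \<Longrightarrow> a + u \<in> M \<longleftrightarrow> a' + u \<in> M'"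
  shows "kept L M a (a + l) = kept L' M' a' (a' + l)"
proof -
  have *: "kept L M a (a + l) = map (\<lambda>u. L ! (a + u)) (filter (\<lambda>u. a + u \<notin> M) [0..<l])" for L a M
  proof -
    have "[a..<a + l] = map (\<lambda>u. a + u) [0..<l]"
      using map_add_upt[of a l] by (simp add: add.commute)
    then show ?thesis by (simp add: kept_def filter_map comp_def)
  qed
  have "filter (\<lambda>u. a + u \<notin> M) [0..<l] = filter (\<lambda>u. a' + u \<notin> M') [0..<l]"
    by (rule filter_cong) (use assms(2) in auto)
  then show ?thesis unfolding * using assms(1) by simp
qed

text \<open>Since \<open>sym_array\<close> is blank behind the end, a position of \<open>X\<close>
  never matches one behind \<open>Y\<close>. Bounding the positions in \<open>X\<close> therefore
  suffices, in the proofs and in the program.\<close>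

definition matches :: "'a list \<Rightarrow> 'a list \<Rightarrow> nat \<Rightarrow> nat \<Rightarrow> nat \<Rightarrow> bool" where
  "matches X Y i j l \<longleftrightarrow> (\<forall>u<l. sym_array X (i + u) = sym_array Y (j + u))"

lemma matches_bound:
  assumes "matches X Y i j l" "i + l \<le> length X" "0 < l"
  shows "j + l \<le> length Y"
proof -
  have "sym_array X (i + (l - 1)) = sym_array Y (j + (l - 1))"
    using assms(1,3) unfolding matches_def by (metis diff_less zero_less_one)
  then show ?thesis using assms(2,3) by (auto simp: sym_array_def split: if_splits)
qed

lemma matches_nth:
  assumes "matches X Y i j l" "i + l \<le> length X" "u < l"
  shows "X ! (i + u) = Y ! (j + u)"
  using assms by (auto simp: matches_def sym_array_def split: if_splits)

section \<open>Greedy matching\<close>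

text \<open>All insertions at column \<open>i\<close> may be missing in \<open>z1\<close>, so that edits of successive strips of columns
  are not counted twice.\<close>

definition edit_progress :: "nat \<Rightarrow> 'a list \<Rightarrow> 'a list \<Rightarrow> nat \<Rightarrow> nat \<Rightarrow> bool" where
  "edit_progress k X Y i c \<longleftrightarrow> (\<forall>z1 z2. upper (z1 @ z2) = X \<longrightarrow> lower (z1 @ z2) = Y \<longrightarrow>
     edits (z1 @ z2) \<le> k \<longrightarrow> upper z1 = take i X \<longrightarrow> c \<le> edits z1)"

lemma edit_progress_0 [simp]: "edit_progress k X Y i 0"
  by (simp add: edit_progress_def)

text \<open>If the columns between \<open>i\<close> and \<open>i'\<close> contained no edit, they
  would form a match at the position \<open>j\<close> reached in \<open>Y\<close>. The edits before
  and after them force \<open>j\<close> into the band, where no such match exists.\<close>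

lemma edit_progress_step:
  assumes "edit_progress k X Y i c" "i \<le> i'" "i' \<le> length X"
    and mis: "\<And>j. j \<le> length Y \<Longrightarrow> absdiff i j + absdiff (length X - i) (length Y - j) \<le> k \<Longrightarrow>
      \<not> matches X Y i j (i' - i)"
  shows "edit_progress k X Y i' (Suc c)"
  unfolding edit_progress_def
proof (intro allI impI)
  fix z1 z2
  assume a: "upper (z1 @ z2) = X" "lower (z1 @ z2) = Y" "edits (z1 @ z2) \<le> k" "upper z1 = take i' X"
  have "upper z1 = take i X @ take (i' - i) (drop i X)"
    using a(4) assms(2) by (metis le_add_diff_inverse take_add)
  then obtain z0 z where z: "z1 = z0 @ z" "upper z0 = take i X" "upper z = take (i' - i) (drop i X)"
    by (rule upper_split)
  have "c \<le> edits z0"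
    using assms(1)[unfolded edit_progress_def, rule_format, of z0 "z @ z2"] a z by simp
  moreover have "edits z \<noteq> 0"
  proof
    assume "edits z = 0"
    then have lz: "lower z = take (i' - i) (drop i X)" using edits_0_lower z(3) by metis
    let ?j = "length (lower z0)"
    have lX: "length (upper z0) = i" "length (upper (z @ z2)) = length X - i"
      using z(2) assms(2,3) arg_cong[OF a(1), of length] z(1) by simp_all
    have lY: "length (lower (z @ z2)) = length Y - ?j" "?j \<le> length Y"
      using arg_cong[OF a(2), of length] z(1) by simp_all
    have "absdiff i ?j + absdiff (length X - i) (length Y - ?j) \<le> k"
      using a(3) z(1) lX lY length_upper_le[of z0] length_lower_le[of z0]
        length_upper_le[of "z @ z2"] length_lower_le[of "z @ z2"]
      unfolding absdiff_def by (simp only: edits_append append_assoc) linarith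
    moreover have "matches X Y i ?j (i' - i)"
      unfolding matches_def
    proof (intro allI impI)
      fix u assume u: "u < i' - i"
      have "Y = lower z0 @ take (i' - i) (drop i X) @ lower z2" using a(2) z(1) lz by simp
      then have "Y ! (?j + u) = X ! (i + u)" "?j + u < length Y"
        using u assms(2,3) by (simp_all add: nth_append)
      then show "sym_array X (i + u) = sym_array Y (?j + u)"
        using u assms(2,3) by (simp add: sym_array_def)
    qed
    ultimately show False using mis lY by blast
  qed
  ultimately show "Suc c \<le> edits z1" using z(1) by simp
qed

lemma edit_progress_imp_ed_gt:
  assumes "edit_progress k X Y i (Suc k)" "weight_function w"
  shows "real k < ed w X Y"
proof (rule ccontr)
  assume "\<not> real k < ed w X Y"
  then obtain zs where zs: "upper zs = X" "lower zs = Y" "columns_cost w zs \<le> real k"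
    using ed_le_iff[OF assms(2), of X Y "real k"] by auto
  have "edits zs \<le> k" using zs(3) edits_le_columns_cost[OF assms(2), of zs] by linarith
  obtain z1 z2 where z: "zs = z1 @ z2" "upper z1 = take i X" "upper z2 = drop i X"
    using upper_split[of zs "take i X" "drop i X"] zs(1) by auto
  have "Suc k \<le> edits z1"
    using assms(1)[unfolded edit_progress_def, rule_format, of z1 z2] zs z \<open>edits zs \<le> k\<close> by simp
  with z \<open>edits zs \<le> k\<close> show False by simp
qed

lemma length_diff_imp_ed_gt:
  assumes "k < absdiff (length X) (length Y)" "weight_function w"
  shows "real k < ed w X Y"
proof (rule ccontr)
  assume "\<not> real k < ed w X Y"
  then obtain zs where zs: "upper zs = X" "lower zs = Y" "columns_cost w zs \<le> real k"
    using ed_le_iff[OF assms(2), of X Y "real k"] by auto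
  have "edits zs \<le> k" using zs(3) edits_le_columns_cost[OF assms(2), of zs] by linarith
  with assms(1) zs(1,2) length_upper_le[of zs] length_lower_le[of zs] show False
    by (auto simp: absdiff_def)
qed

text \<open>A diagonal between those of the two corners uses up exactly \<open>absdiff n m\<close>;
  each diagonal further out costs 2 more. Hence half of the slack \<open>k - absdiff n m\<close> is
  available on either side.\<close>

lemma band_iff:
  assumes "i \<le> n" "j \<le> m" "absdiff n m \<le> k"
  shows "absdiff i j + absdiff (n - i) (m - j) \<le> k \<longleftrightarrow>
    i \<le> j + ((k - absdiff n m) div 2 + (n - m)) \<and> j \<le> i + ((k - absdiff n m) div 2 + (m - n))"
proof -
  obtain p q where n: "n = i + p" and m: "m = j + q"
    using assms(1,2) le_Suc_ex by blast
  show ?thesis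
    using assms(3) unfolding absdiff_def n m by (cases "i \<le> j"; cases "p \<le> q"; simp; linarith)
qed

text \<open>\<open>t\<close> and \<open>u\<close> are the lengths of the longest matches of \<open>x\<close> at \<open>r\<close> and \<open>l\<close>. If a match at some
  \<open>j\<close> in between is longer than both, then \<open>x\<close> has periods \<open>r - j\<close> and \<open>j - l\<close>, and both are first
  broken at the same position \<open>u = t + (r - j)\<close>.\<close>

lemma longest_match_between:
  fixes x y :: "nat \<Rightarrow> 'b"
  assumes "l < j" "j < r" "r - l \<le> t" "r - l \<le> u"
    and t: "\<And>a. a < t \<Longrightarrow> x a = y (r + a)" "x t \<noteq> y (r + t)"
    and u: "\<And>a. a < u \<Longrightarrow> x a = y (l + a)" "x u \<noteq> y (l + u)"
    and h: "\<And>a. a < h \<Longrightarrow> x a = y (j + a)" "t < h" "u < h"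
  shows "j + u = r + t"
proof -
  define p p' where "p = j - l" and "p' = r - j"
  have pp: "p + p' = r - l" "0 < p" "0 < p'" using assms(1,2) by (auto simp: p_def p'_def)
  have per': "x (a + p') = x a" if "a < t" "a + p' < h" for a
  proof -
    have "r + a = j + (a + p')" using assms(2) by (simp add: p'_def)
    then show ?thesis using t(1)[OF that(1)] h(1)[OF that(2)] by metis
  qed
  have per: "x (a + p) = x a" if "a + p < u" for a
  proof -
    have "l + (a + p) = j + a" using assms(1) by (simp add: p_def)
    moreover have "x a = y (j + a)" using h(1) that h(3) by simp
    ultimately show ?thesis using u(1)[OF that] by metis
  qed
  \<comment> \<open>The symbol \<open>y (l + u)\<close> that ends the match at \<open>l\<close> is
    matched at \<open>j\<close> with \<open>x (u - p)\<close>.\<close>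
  have xu: "x (u - p) \<noteq> x u"
  proof -
    have "l + u = j + (u - p)" using assms(1,4) pp by (simp add: p_def)
    moreover have "x (u - p) = y (j + (u - p))" using h(1)[of "u - p"] h(3) by simp
    ultimately show ?thesis using u(2) by simp
  qed
  \<comment> \<open>Otherwise the steps \<open>- p'\<close>, \<open>- p\<close>, \<open>+ p'\<close>
    lead from \<open>u\<close> to \<open>u - p\<close> within the reach of both periods, against
    \<open>xu\<close>.\<close>
  have ge: "t + p' \<le> u"
  proof (rule ccontr)
    assume "\<not> t + p' \<le> u"
    then have lt: "u - p' < t" using pp assms(4) by linarith
    have "x u = x (u - p')" using per'[of "u - p'"] lt h(3) pp assms(4) by simp
    also have "\<dots> = x (u - p' - p)" using per[of "u - p' - p"] pp assms(4) by simp
    also have "\<dots> = x (u - p)"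
    proof -
      have eq: "u - p' - p + p' = u - p" and "u - p' - p < t" "u - p < h"
        using lt h(3) pp assms(4) by linarith+
      then show ?thesis using per'[of "u - p' - p"] unfolding eq by simp
    qed
    finally show False using xu by simp
  qed
  have "x (t + p') = y (j + (t + p'))" using h(1)[of "t + p'"] h(3) ge by simp
  also have "j + (t + p') = r + t" using assms(2) by (simp add: p'_def)
  finally have xt: "x (t + p') \<noteq> x t" using t(2) by metis
  \<comment> \<open>The same argument from the other end: the steps \<open>- p\<close>,
    \<open>- p'\<close>, \<open>+ p\<close> would lead from \<open>t + p'\<close> to
    \<open>t\<close>, against \<open>xt\<close>.\<close>
  have "u \<le> t + p'"
  proof (rule ccontr)
    assume "\<not> u \<le> t + p'"
    then have "x (t + p') = x (t + p' - p)" using per[of "t + p' - p"] pp assms(3) by simp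
    also have "\<dots> = x (t - p)"
      using per'[of "t - p"] pp assms(3) h(3) ge by simp
    also have "\<dots> = x t" using per[of "t - p"] pp assms(3) ge by simp
    finally show False using xt by simp
  qed
  with ge have "u = t + p'" by simp
  then show ?thesis using assms(2) by (simp add: p'_def)
qed

section \<open>Shortening a matched fragment\<close>

text \<open>This is the bound \<open>(k + 1) * q + 2 * k\<close> of \<open>untouched_block\<close>
  for the largest period \<open>q = k\<close>. It serves for all periods as the length below which
  runs are not shortened, and also as the least length of a phrase.\<close>

definition threshold :: "nat \<Rightarrow> nat" where
  "threshold k = k * k + 3 * k"

text \<open>\<open>D\<close> is the set of deleted positions; what remains of \<open>[s0, s)\<close> consists of \<open>N\<close> aperiodic phrases
  starting at \<open>S 0, \<dots>, S (N - 1)\<close>.\<close>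

definition parsed ::
    "nat \<Rightarrow> 'a list \<Rightarrow> nat set \<Rightarrow> (nat \<Rightarrow> nat) \<Rightarrow> nat \<Rightarrow> nat \<Rightarrow> nat \<Rightarrow> bool" where
  "parsed k X D S s0 N s \<longleftrightarrow> s0 \<le> s \<and> D \<subseteq> {s0..<s} \<and>
     fragment_equiv k (slice X s0 s) (kept X D s0 s) \<and>
     (\<exists>Ws. length Ws = N \<and> (\<forall>W\<in>set Ws. aperiodic k W \<and> length W \<le> threshold k + k) \<and>
        kept X D s0 s = concat Ws \<and>
        (\<forall>p<N. s0 \<le> S p \<and> S p \<le> s \<and> kept X D s0 (S p) = concat (take p Ws)))"

lemma parsed_0: "parsed k X {} S s0 0 s0"
  by (simp add: parsed_def)

lemma fragment_equiv_append2:
  assumes "fragment_equiv k P P'" "fragment_equiv k R R'"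
  shows "fragment_equiv k (P @ R) (P' @ R')"
  using fragment_equiv_append[OF assms(1), of "[]" R] fragment_equiv_append[OF assms(2), of P' "[]"]
  by (auto intro: fragment_equiv_trans)

lemma parsed_Suc:
  assumes p: "parsed k X D S s0 N s" and S': "\<And>p. p < N \<Longrightarrow> S' p = S p" "S' N = s"
    and s': "s \<le> s'" "D' \<subseteq> {s..<s'}" "fragment_equiv k (slice X s s') (kept X D' s s')"
    and W: "aperiodic k (kept X D' s s')" "length (kept X D' s s') \<le> threshold k + k"
  shows "parsed k X (D \<union> D') S' s0 (Suc N) s'"
proof -
  from p obtain Ws where s0: "s0 \<le> s" and D: "D \<subseteq> {s0..<s}"
    and eq: "fragment_equiv k (slice X s0 s) (kept X D s0 s)"
    and Ws: "length Ws = N" "\<forall>W\<in>set Ws. aperiodic k W \<and> length W \<le> threshold k + k"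
      "kept X D s0 s = concat Ws"
      "\<forall>p<N. s0 \<le> S p \<and> S p \<le> s \<and> kept X D s0 (S p) = concat (take p Ws)"
    by (auto simp: parsed_def)
  have k1: "kept X (D \<union> D') s0 b = kept X D s0 b" if "b \<le> s" for b
    by (rule kept_cong) (use s'(2) that in auto)
  have k2: "kept X (D \<union> D') s s' = kept X D' s s'"
    by (rule kept_cong) (use D in auto)
  have k3: "kept X (D \<union> D') s0 s' = kept X D s0 s @ kept X D' s s'"
    using kept_append[OF s0 s'(1), of X "D \<union> D'"] by (simp add: k1 k2)
  show ?thesis
    unfolding parsed_def
  proof (intro conjI exI[of _ "Ws @ [kept X D' s s']"] allI impI)
    show "fragment_equiv k (slice X s0 s') (kept X (D \<union> D') s0 s')"
      unfolding k3 kept_append[OF s0 s'(1), of X "{}"]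
      by (rule fragment_equiv_append2[OF eq s'(3)])
    show "s0 \<le> s'" using s0 s'(1) by simp
    show "D \<union> D' \<subseteq> {s0..<s'}" using s0 s'(1,2) D by auto
    show "length (Ws @ [kept X D' s s']) = Suc N" using Ws(1) by simp
    show "\<forall>V\<in>set (Ws @ [kept X D' s s']). aperiodic k V \<and> length V \<le> threshold k + k"
      using Ws(2) W by simp
    show "kept X (D \<union> D') s0 s' = concat (Ws @ [kept X D' s s'])" using Ws(3) by (simp add: k3)
  next
    fix p assume "p < Suc N"
    then consider "p < N" | "p = N" by linarith
    then have "s0 \<le> S' p \<and> S' p \<le> s \<and> kept X D s0 (S' p) = concat (take p Ws)"
    proof cases
      case 1
      then show ?thesis using Ws(4) S'(1) by simp
    next
      case 2
      then show ?thesis using Ws(1,3) S'(2) s0 by simp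
    qed
    moreover have "p \<le> length Ws" using \<open>p < Suc N\<close> Ws(1) by simp
    ultimately show "s0 \<le> S' p" "S' p \<le> s'"
      "kept X (D \<union> D') s0 (S' p) = concat (take p (Ws @ [kept X D' s s']))"
      using s'(1) by (simp_all add: k1)
  qed
qed

text \<open>\<open>M\<close> spares the first and the last \<open>k + 1\<close> phrases, to which
  \<open>fragment_equiv_cut\<close> applies. Together with the rest \<open>[s, t)\<close> behind the
  last phrase they make up the factor \<open>2 * k + 3\<close>.\<close>

lemma parsed_finish:
  assumes p: "parsed k X D S s0 N s"
    and t: "s \<le> t" "D' \<subseteq> {s..<t}" "fragment_equiv k (slice X s t) (kept X D' s t)"
      "length (kept X D' s t) \<le> threshold k + k"
    and M: "M = (if 2 * k + 2 < N then {S (Suc k)..<S (N - Suc k)} else {})"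
  shows "M \<subseteq> {s0..<t}" "fragment_equiv k (slice X s0 t) (kept X (D \<union> D' \<union> M) s0 t)"
    "length (kept X (D \<union> D' \<union> M) s0 t) \<le> (2 * k + 3) * (threshold k + k)"
proof -
  let ?L = "threshold k + k"
  from p obtain Ws where s0: "s0 \<le> s" and D: "D \<subseteq> {s0..<s}"
    and eq: "fragment_equiv k (slice X s0 s) (kept X D s0 s)"
    and Ws: "length Ws = N" "\<forall>W\<in>set Ws. aperiodic k W \<and> length W \<le> ?L"
      "kept X D s0 s = concat Ws"
      "\<forall>p<N. s0 \<le> S p \<and> S p \<le> s \<and> kept X D s0 (S p) = concat (take p Ws)"
    by (auto simp: parsed_def)
  have len: "length (concat Vs) \<le> length Vs * ?L" if "set Vs \<subseteq> set Ws" for Vs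
    using that Ws(2) by (induction Vs) (auto intro: add_mono)
  have Ms: "M \<subseteq> {s0..<s}"
    using Ws(4)[rule_format, of "Suc k"] Ws(4)[rule_format, of "N - Suc k"]
    by (auto simp: M split: if_splits)
  then show "M \<subseteq> {s0..<t}" using t(1) by auto
  have k2: "kept X (D \<union> D' \<union> M) s t = kept X D' s t"
    by (rule kept_cong) (use D Ms in auto)
  have k1: "kept X (D \<union> D' \<union> M) s0 s = kept X (D \<union> M) s0 s"
    by (rule kept_cong) (use t(2) in auto)
  have k3: "kept X (D \<union> D' \<union> M) s0 t = kept X (D \<union> M) s0 s @ kept X D' s t"
    using kept_append[OF s0 t(1), of X "D \<union> D' \<union> M"] by (simp add: k1 k2)
  have main: "fragment_equiv k (kept X D s0 s) (kept X (D \<union> M) s0 s) \<and>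
      length (kept X (D \<union> M) s0 s) \<le> (2 * k + 2) * ?L"
  proof (cases "2 * k + 2 < N")
    case False
    then have "length (concat Ws) \<le> N * ?L" using len[of Ws] Ws(1) by simp
    also have "\<dots> \<le> (2 * k + 2) * ?L" using False by (intro mult_right_mono) auto
    finally show ?thesis using False Ws(3) by (simp add: M)
  next
    case True
    let ?a = "S (Suc k)" and ?b = "S (N - Suc k)"
    have ab: "s0 \<le> ?a" "?a \<le> s" "kept X D s0 ?a = concat (take (Suc k) Ws)"
      "s0 \<le> ?b" "?b \<le> s" "kept X D s0 ?b = concat (take (N - Suc k) Ws)"
      using Ws(4)[rule_format, of "Suc k"] Ws(4)[rule_format, of "N - Suc k"] True by auto
    define V where "V = concat (take (Suc k) Ws)"
    define V' where "V' = concat (drop (N - Suc k) Ws)"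
    have keb: "kept X D ?b s = V'"
    proof -
      have "kept X D s0 ?b @ kept X D ?b s = concat (take (N - Suc k) Ws) @ V'"
        using kept_append[OF ab(4,5), of X D] Ws(3)
        by (simp add: V'_def flip: concat_append)
      then show ?thesis using ab(6) by simp
    qed
    have lV: "length V \<le> Suc k * ?L"
      using len[OF set_take_subset[of "Suc k" Ws]] Ws(1) True by (simp add: V_def min_def)
    have lV': "length V' \<le> Suc k * ?L"
      using len[OF set_drop_subset[of "N - Suc k" Ws]] Ws(1) True by (simp add: V'_def)
    have apV: "k < length (take (Suc k) Ws)" "\<forall>W\<in>set (take (Suc k) Ws). aperiodic k W"
      using Ws(1,2) True by (auto dest: in_set_takeD)
    have apV': "k < length (drop (N - Suc k) Ws)" "\<forall>W\<in>set (drop (N - Suc k) Ws). aperiodic k W"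
      using Ws(1,2) True by (auto dest: in_set_dropD)
    show ?thesis
    proof (cases "?a \<le> ?b")
      \<comment> \<open>\<open>parsed\<close> does not record that \<open>S\<close> is monotone.
        Here the interval is empty, and what is kept before \<open>?b\<close> is already part of
        \<open>V\<close>.\<close>
      case False
      then have "M = {}" by (simp add: M)
      have "kept X D s0 ?a = kept X D s0 ?b @ kept X D ?b ?a"
        using kept_append[of s0 ?b ?a X D] ab False by simp
      then have "length (concat (take (N - Suc k) Ws)) \<le> length V"
        using arg_cong[of _ _ length] ab V_def by (metis length_append le_add1)
      moreover have "length (concat Ws) = length (concat (take (N - Suc k) Ws)) + length V'"
        by (simp add: V'_def flip: length_append concat_append)
      ultimately have "length (concat Ws) \<le> Suc k * ?L + Suc k * ?L" using lV lV' by linarith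
      then have "length (concat Ws) \<le> (2 * k + 2) * ?L" by (simp add: algebra_simps)
      then show ?thesis using Ws(3) \<open>M = {}\<close> by simp
    next
      case ab': True
      have "kept X (D \<union> M) s0 ?a = V"
        unfolding V_def ab(3)[symmetric] by (rule kept_cong) (use True in \<open>auto simp: M\<close>)
      moreover have "kept X (D \<union> M) ?a ?b = []"
        by (rule kept_eq_Nil) (use True in \<open>auto simp: M\<close>)
      moreover have "kept X (D \<union> M) ?b s = V'"
        unfolding keb[symmetric] by (rule kept_cong) (use True in \<open>auto simp: M\<close>)
      ultimately have kM: "kept X (D \<union> M) s0 s = V @ [] @ V'"
        using kept_append[OF ab(1,2), of X "D \<union> M"] kept_append[OF ab' ab(5), of X "D \<union> M"] by simp
      have kD: "kept X D s0 s = V @ kept X D ?a ?b @ V'"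
        using kept_append[OF ab(1,2), of X D] kept_append[OF ab' ab(5), of X D] keb ab(3)
        by (simp add: V_def)
      have "fragment_equiv k (kept X D s0 s) (kept X (D \<union> M) s0 s)"
        unfolding kM kD V_def V'_def by (rule fragment_equiv_cut[OF apV apV'])
      moreover have "length (kept X (D \<union> M) s0 s) \<le> (2 * k + 2) * ?L"
        using lV lV' by (simp add: kM algebra_simps)
      ultimately show ?thesis by blast
    qed
  qed
  show "fragment_equiv k (slice X s0 t) (kept X (D \<union> D' \<union> M) s0 t)"
    unfolding k3 kept_append[OF s0 t(1), of X "{}"]
    using fragment_equiv_append2[OF fragment_equiv_trans[OF eq] t(3)] main by blast
  show "length (kept X (D \<union> D' \<union> M) s0 t) \<le> (2 * k + 3) * ?L"
    unfolding k3 using main t(4) by (simp add: algebra_simps)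
qed

section \<open>From periodic runs to aperiodic phrases\<close>

lemma has_period_sliceI:
  assumes "\<And>x. s + q \<le> x \<Longrightarrow> x < e \<Longrightarrow> X ! x = X ! (x - q)"
  shows "has_period q (slice X s e)"
  unfolding has_period_def
proof (intro allI impI)
  fix u assume "u + q < length (slice X s e)"
  then show "slice X s e ! u = slice X s e ! (u + q)"
    using assms[of "s + u + q"] by (simp add: add.assoc)
qed

lemma drop_slice: "drop a (slice L s e) = slice L (s + a) e"
  by (simp add: slice_eq drop_map)

text \<open>\<open>a\<close> is the largest multiple of \<open>q\<close> whose removal leaves at
  least \<open>threshold k\<close> symbols; truncated subtraction makes it 0 for shorter
  runs.\<close>

lemma periodic_run:
  assumes "\<And>x. s + q \<le> x \<Longrightarrow> x < e \<Longrightarrow> X ! x = X ! (x - q)" "0 < q" "q \<le> k" "s + 2 * k \<le> e"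
    and a: "a = (e - s - threshold k) div q * q"
  shows "s + a \<le> e" "kept X {s..<s + a} s e = slice X (s + a) e"
    "fragment_equiv k (slice X s e) (slice X (s + a) e)"
    "e - (s + a) \<le> threshold k + q - 1" "s + a + 2 * k \<le> e" "threshold k \<le> e - s \<or> a = 0"
proof -
  have q: "(k + 1) * q + 2 * k \<le> threshold k"
  proof -
    have "(k + 1) * q \<le> (k + 1) * k" using assms(3) by (intro mult_left_mono) auto
    then show ?thesis by (simp add: threshold_def)
  qed
  have le: "a \<le> e - s - threshold k" by (simp add: a)
  show "threshold k \<le> e - s \<or> a = 0" using le by linarith
  have 2: "2 * k \<le> threshold k" using q by simp
  show sae: "s + a + 2 * k \<le> e" using le assms(4) 2 by linarith
  then show le': "s + a \<le> e" by simp
  have "kept X {s..<s + a} s (s + a) = []" by (rule kept_eq_Nil) simp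
  moreover have "kept X {s..<s + a} (s + a) e = slice X (s + a) e" by (rule kept_eq_slice) simp
  ultimately show "kept X {s..<s + a} s e = slice X (s + a) e"
    using kept_append[OF _ le', of s X "{s..<s + a}"] by simp
  have "(e - s - threshold k) mod q < q" using assms(2) by simp
  then have "e - s - threshold k < a + q"
    using div_mult_mod_eq[of "e - s - threshold k" q] unfolding a by linarith
  then show "e - (s + a) \<le> threshold k + q - 1" by linarith
  show "fragment_equiv k (slice X s e) (slice X (s + a) e)"
  proof (cases "a = 0")
    case False
    then have "threshold k + a \<le> e - s" using le by linarith
    moreover define c where "c = (e - s - threshold k) div q"
    ultimately have "fragment_equiv k (slice X s e) (drop (c * q) (slice X s e))"
      using q by (intro fragment_equiv_drop_periods has_period_sliceI assms(1)) (simp_all add: a)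
    then show ?thesis by (simp add: a c_def drop_slice)
  qed simp
qed

text \<open>The shortened run retains at least \<open>2 * k\<close> symbols, so the break at
  \<open>e\<close> makes it aperiodic by \<open>aperiodic_break\<close>. The phrase must include the
  position \<open>e\<close> and is padded to length \<open>threshold k\<close> before deletion,
  which pays for the search for the period.\<close>

lemma broken_run:
  assumes per: "\<And>x. s + q \<le> x \<Longrightarrow> x < e \<Longrightarrow> X ! x = X ! (x - q)" "0 < q" "q \<le> k" "s + 2 * k \<le> e"
    and a: "a = (e - s - threshold k) div q * q"
    and "X ! e \<noteq> X ! (e - q)" and s': "s' = max (e + 1) (s + threshold k)"
  shows "s + a \<le> s'" "fragment_equiv k (slice X s s') (kept X {s..<s + a} s s')"
    "aperiodic k (kept X {s..<s + a} s s')"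
    "length (kept X {s..<s + a} s s') \<le> threshold k + k"
proof -
  note r = periodic_run[OF per a]
  have es: "s \<le> e" "e \<le> s'" "e < s'" using assms(4) s' by auto
  show "s + a \<le> s'" using r(1) es by simp
  have k: "kept X {s..<s + a} s s' = slice X (s + a) e @ slice X e s'"
  proof -
    have "kept X {s..<s + a} e s' = slice X e s'" by (rule kept_eq_slice) (use r(1) in simp)
    then show ?thesis using kept_append[OF es(1,2), of X "{s..<s + a}"] r(2) by simp
  qed
  show "fragment_equiv k (slice X s s') (kept X {s..<s + a} s s')"
    unfolding k kept_append[OF es(1,2), of X "{}"]
    by (rule fragment_equiv_append2[OF r(3) fragment_equiv_refl])
  have "aperiodic k (slice X (s + a) e @ [X ! e])"
  proof (rule aperiodic_break)
    show "has_period q (slice X (s + a) e)" by (rule has_period_sliceI) (use per(1) in simp)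
    show "slice X (s + a) e ! (length (slice X (s + a) e) - q) \<noteq> X ! e"
      using assms(6) r(5) per(2,3) by simp
  qed (use per r(5) in auto)
  from aperiodic_append[OF this, of "[]" "slice X (Suc e) s'"]
  show "aperiodic k (kept X {s..<s + a} s s')" using es by (simp add: k slice_Cons[of e])
  have "s' - (s + a) \<le> threshold k + k"
  proof (cases "e + 1 \<le> s + threshold k")
    case True
    then show ?thesis using s' by simp
  next
    case False
    then show ?thesis using s' r(4) per(2,3) by simp
  qed
  then show "length (kept X {s..<s + a} s s') \<le> threshold k + k"
    using r(1) es by (simp add: k)
qed

lemma aperiodic_sliceI:
  assumes "\<And>q. 0 < q \<Longrightarrow> q \<le> k \<Longrightarrow> \<exists>x. s + q \<le> x \<and> x < e \<and> X ! x \<noteq> X ! (x - q)" "e \<le> s'"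
    "s + 2 * k \<le> e"
  shows "aperiodic k (slice X s s')"
proof -
  have "aperiodic k (slice X s e)"
    unfolding aperiodic_def
  proof (intro allI impI notI)
    fix q assume q: "0 < q" "q \<le> k" "has_period q (slice X s e)"
    obtain x where "s + q \<le> x" "x < e" "X ! x \<noteq> X ! (x - q)" using assms(1) q(1,2) by blast
    moreover from this have "x - s - q + q < e - s" by linarith
    ultimately show False using q(3)[unfolded has_period_def, rule_format, of "x - s - q"] by simp
  qed
  from aperiodic_append[OF this, of "[]" "slice X e s'"] show ?thesis
    using kept_append[of s e s' X "{}"] assms(2,3) by simp
qed

definition kernel_equiv :: "nat \<Rightarrow> 'a list \<Rightarrow> 'a list \<Rightarrow> 'a list \<Rightarrow> 'a list \<Rightarrow> bool" where
  "kernel_equiv k X Y X' Y' \<longleftrightarrow>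
     (\<forall>w. weight_function w \<longrightarrow> ed_le w k X Y = ed_le w k X' Y')"

text \<open>Earlier strips removed equally many positions before \<open>s\<close> and before
  \<open>s'\<close>. So the remaining prefixes \<open>U\<close>, \<open>U'\<close> differ in length
  as \<open>s\<close> and \<open>s'\<close> do, and the band condition on original positions applies
  to the shortened strings.\<close>

lemma kernel_equiv_marks:
  assumes ke: "kernel_equiv k X Y (kept X M 0 (length X)) (kept Y M' 0 (length Y))"
    and M: "M \<subseteq> {..<s}" "M' \<subseteq> {..<s'}" "card M = card M'"
    and t: "s + l \<le> length X" "s' + l \<le> length Y" "matches X Y s s' l"
    and band: "absdiff s s' + absdiff (length X - (s + l)) (length Y - (s' + l)) \<le> k"
    and D: "D \<subseteq> {s..<s + l}" "D' = (\<lambda>x. s' + (x - s)) ` D"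
      "fragment_equiv k (slice X s (s + l)) (kept X D s (s + l))"
  shows "kernel_equiv k X Y (kept X (M \<union> D) 0 (length X)) (kept Y (M' \<union> D') 0 (length Y))"
    "card (M \<union> D) = card (M' \<union> D')" "card (M \<union> D) = card M + card D"
proof -
  have inj: "inj_on (\<lambda>x. s' + (x - s)) D" 
  proof (rule inj_onI)
    fix x y assume "x \<in> D" "y \<in> D" "s' + (x - s) = s' + (y - s)"
    moreover from this have "s \<le> x" "s \<le> y" using D(1) by auto
    ultimately show "x = y" by linarith
  qed
  have D': "D' \<subseteq> {s'..<s' + l}"
  proof
    fix y assume "y \<in> D'"
    then obtain x where "x \<in> D" "y = s' + (x - s)" by (auto simp: D(2))
    moreover from this have "s \<le> x" "x < s + l" using D(1) by auto
    ultimately show "y \<in> {s'..<s' + l}" by auto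
  qed
  have fin: "finite M" "finite M'" "finite D" "finite D'"
    using M D(1) D' finite_subset by blast+
  have "card D' = card D" by (simp add: D(2) card_image inj)
  moreover have "M \<inter> D = {}" "M' \<inter> D' = {}" using M D(1) D' by fastforce+
  ultimately show "card (M \<union> D) = card (M' \<union> D')" "card (M \<union> D) = card M + card D"
    using fin M(3) by (simp_all add: card_Un_disjoint)
  have split: "kept L N 0 (length L) = kept L N 0 a @ kept L N a (a + l) @ kept L N (a + l) (length L)"
    if "a + l \<le> length L" for L :: "'a list" and N a
    using that kept_append[of 0 a "length L" L N] kept_append[of a "a + l" "length L" L N] by simp
  define U V where "U = kept X M 0 s" and "V = slice X (s + l) (length X)"
  define U' V' where "U' = kept Y M' 0 s'" and "V' = slice Y (s' + l) (length Y)"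
  have eqs: "kept X D s (s + l) = kept Y D' s' (s' + l)" "slice X s (s + l) = slice Y s' (s' + l)"
  proof -
    have "s + u \<in> D \<longleftrightarrow> s' + u \<in> D'" if "u < l" for u
    proof
      assume "s + u \<in> D"
      then show "s' + u \<in> D'" unfolding D(2) by (rule rev_image_eqI) simp
    next
      assume "s' + u \<in> D'"
      then obtain x where "x \<in> D" "s' + u = s' + (x - s)" by (auto simp: D(2))
      then show "s + u \<in> D" using D(1) by auto
    qed
    then show "kept X D s (s + l) = kept Y D' s' (s' + l)" "slice X s (s + l) = slice Y s' (s' + l)"
      using matches_nth[OF t(3,1)] by (intro kept_shift; simp)+
  qed
  have X0: "kept X M 0 (length X) = U @ slice X s (s + l) @ V"
    unfolding split[OF t(1)] U_def V_def using M(1)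
    by (intro arg_cong2[of _ _ _ _ "(@)"] kept_eq_slice refl) auto
  have Y0: "kept Y M' 0 (length Y) = U' @ slice X s (s + l) @ V'"
    unfolding split[OF t(2)] U'_def V'_def eqs(2) using M(2)
    by (intro arg_cong2[of _ _ _ _ "(@)"] kept_eq_slice refl) auto
  have X1: "kept X (M \<union> D) 0 (length X) = U @ kept X D s (s + l) @ V"
    unfolding split[OF t(1)] U_def V_def using M(1) D(1)
    by (intro arg_cong2[of _ _ _ _ "(@)"] kept_cong) auto
  have Y1: "kept Y (M' \<union> D') 0 (length Y) = U' @ kept X D s (s + l) @ V'"
    unfolding split[OF t(2)] U'_def V'_def eqs(1) using M(2) D'
    by (intro arg_cong2[of _ _ _ _ "(@)"] kept_cong) auto
  have "length U + card M = s" "length U' + card M = s'"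
    unfolding U_def U'_def using length_kept[OF M(1), of X] length_kept[OF M(2), of Y] M(3) by simp_all
  then have "absdiff (length U) (length U') = absdiff s s'" unfolding absdiff_def by linarith
  then have bd: "absdiff (length U) (length U') + absdiff (length V) (length V') \<le> k"
    using band by (simp add: V_def V'_def)
  show "kernel_equiv k X Y (kept X (M \<union> D) 0 (length X)) (kept Y (M' \<union> D') 0 (length Y))"
    unfolding kernel_equiv_def
  proof (intro allI impI)
    fix w :: "'a option \<Rightarrow> 'a option \<Rightarrow> real"
    assume w: "weight_function w"
    show "ed_le w k X Y = ed_le w k (kept X (M \<union> D) 0 (length X)) (kept Y (M' \<union> D') 0 (length Y))"
      unfolding X1 Y1 D(3)[unfolded fragment_equiv_def, rule_format, OF w bd, symmetric]
      using ke[unfolded kernel_equiv_def, rule_format, OF w] unfolding X0 Y0 .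
  qed
qed

section \<open>Total correctness with time bounds\<close>

text \<open>The postcondition also receives the running time. As overflowing runs have no
  derivation, \<open>wp\<close> includes the absence of overflow as well as termination.\<close>

definition wp :: "nat \<Rightarrow> com \<Rightarrow> (nat \<Rightarrow> 'a state \<Rightarrow> bool) \<Rightarrow> 'a state \<Rightarrow> bool" where
  "wp b P Q s \<longleftrightarrow> (\<exists>t s'. exec b P s t s' \<and> Q t s')"

inductive_cases exec_SkipE: "exec b Skip s t s'"
inductive_cases exec_ConstE: "exec b (Const r v) s t s'"
inductive_cases exec_ArithE: "exec b (Arith f r i j) s t s'"
inductive_cases exec_LoadE: "exec b (Load r a i) s t s'"
inductive_cases exec_StoreE: "exec b (Store a i r) s t s'"
inductive_cases exec_SymCopyE: "exec b (SymCopy a i a' j) s t s'"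
inductive_cases exec_SeqE: "exec b (Seq P Q) s t s'"
inductive_cases exec_CondE: "exec b (Cond p P Q) s t s'"

lemma wp_mono: "wp b P Q s \<Longrightarrow> (\<And>t s'. Q t s' \<Longrightarrow> Q' t s') \<Longrightarrow> wp b P Q' s"
  by (auto simp: wp_def)

lemma wp_Skip: "wp b Skip Q s \<longleftrightarrow> Q (Suc 0) s"
  unfolding wp_def by (auto elim!: exec_SkipE intro: exec.Skip[unfolded One_nat_def])

lemma wp_Const: "wp b (Const r v) Q s \<longleftrightarrow> v < 2 ^ b \<and> Q (Suc 0) (s\<lparr>reg := (reg s)(r := v)\<rparr>)"
  unfolding wp_def by (auto elim!: exec_ConstE intro: exec.Const[unfolded One_nat_def])

lemma wp_Arith: "wp b (Arith f r i j) Q s \<longleftrightarrow> arith_val f (reg s i) (reg s j) < 2 ^ b \<and>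
    Q (Suc 0) (s\<lparr>reg := (reg s)(r := arith_val f (reg s i) (reg s j))\<rparr>)"
  unfolding wp_def by (auto elim!: exec_ArithE intro: exec.Arith[unfolded One_nat_def])

lemma wp_Load:
  "wp b (Load r a i) Q s \<longleftrightarrow> Q (Suc 0) (s\<lparr>reg := (reg s)(r := mem s a (reg s i))\<rparr>)"
  unfolding wp_def by (auto elim!: exec_LoadE intro: exec.Load[unfolded One_nat_def])

lemma wp_Store:
  "wp b (Store a i r) Q s \<longleftrightarrow>
     Q (Suc 0) (s\<lparr>mem := (mem s)(a := (mem s a)(reg s i := reg s r))\<rparr>)"
  unfolding wp_def by (auto elim!: exec_StoreE intro: exec.Store[unfolded One_nat_def])

lemma wp_SymCopy:
  "wp b (SymCopy a i a' j) Q s \<longleftrightarrow>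
     Q (Suc 0) (s\<lparr>syms := (syms s)(a := (syms s a)(reg s i := syms s a' (reg s j)))\<rparr>)"
  unfolding wp_def by (auto elim!: exec_SymCopyE intro: exec.SymCopy[unfolded One_nat_def])

lemma wp_Seq: "wp b (Seq P P') Q s \<longleftrightarrow> wp b P (\<lambda>t s'. wp b P' (\<lambda>t'. Q (t + t')) s') s"
  unfolding wp_def by (blast elim: exec_SeqE intro: exec.Seq)

lemma wp_Cond: "wp b (Cond p P P') Q s \<longleftrightarrow>
    (if test_val p s then wp b P (\<lambda>t. Q (test_cost p + t)) s
     else wp b P' (\<lambda>t. Q (test_cost p + t)) s)"
  unfolding wp_def by (auto elim!: exec_CondE intro: exec.CondTrue exec.CondFalse)

lemmas wp_simps = wp_Skip wp_Const wp_Arith wp_Load wp_Store wp_SymCopy wp_Seq wp_Cond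

lemma test_cost_pos: "0 < test_cost p"
  by (induction p) simp_all

text \<open>The potential \<open>V\<close> pays for the remaining iterations.\<close>

lemma wp_While:
  assumes "I s"
    and body: "\<And>s. I s \<Longrightarrow> test_val p s \<Longrightarrow>
      wp b P (\<lambda>t s'. I s' \<and> test_cost p + t + V s' \<le> V s) s"
    and Q: "\<And>t s'. I s' \<Longrightarrow> \<not> test_val p s' \<Longrightarrow> t + V s' \<le> V s + test_cost p \<Longrightarrow> Q t s'"
  shows "wp b (While p P) Q s"
proof -
  have "\<exists>t s'. exec b (While p P) s t s' \<and> I s' \<and> \<not> test_val p s' \<and> t + V s' \<le> V s + test_cost p"
    using assms(1)
  proof (induction "V s" arbitrary: s rule: less_induct)
    case less
    show ?case
    proof (cases "test_val p s")
      case False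
      then show ?thesis using less.prems by (intro exI[of _ "test_cost p"] exI[of _ s])
          (auto intro: exec.WhileFalse)
    next
      case True
      from body[OF less.prems True] obtain t s' where
        s': "exec b P s t s'" "I s'" "test_cost p + t + V s' \<le> V s" by (auto simp: wp_def)
      \<comment> \<open>Every test costs at least one unit, so the potential for the time is also a
        termination measure.\<close>
      then have "V s' < V s" using test_cost_pos[of p] by linarith
      from less.hyps[OF this s'(2)] obtain t' s'' where
        s'': "exec b (While p P) s' t' s''" "I s''" "\<not> test_val p s''" "t' + V s'' \<le> V s' + test_cost p"
        by blast
      have "exec b (While p P) s (test_cost p + t + t') s''"
        by (rule exec.WhileTrue[OF True s'(1) s''(1)])
      moreover have "test_cost p + t + t' + V s'' \<le> V s + test_cost p" using s' s'' by linarith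
      ultimately show ?thesis using s'' by blast
    qed
  qed
  then show ?thesis using Q unfolding wp_def by blast
qed

section \<open>The algorithm\<close>

text \<open>Registers: 3 and 23 hold the constants 1 and 0, 5 and 6 the extent of the band of diagonals below
  and above the main one, 7 the threshold for phrases, 8 the current position in \<open>X\<close>, 9 the number
  of strips so far, 10 and 11 positions in \<open>Y\<close> to which register 8 may be matched, 17 the end of the
  current match, 19 and 20 the start and the number of the current phrase; the others are temporary.
  In integer arrays 0 and 1, nonzero cells mark the deleted positions of \<open>X\<close> and \<open>Y\<close>; array 2 holds
  the starts of the phrases of the current match.\<close>

abbreviation move :: "nat \<Rightarrow> nat \<Rightarrow> com" where
  "move r i \<equiv> Arith Add r i 23"

abbreviation increment :: "nat \<Rightarrow> com" where
  "increment r \<equiv> Arith Add r r 3"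

fun block :: "com list \<Rightarrow> com" where
  "block [] = Skip"
| "block [P] = P"
| "block (P # Ps) = Seq P (block Ps)"

text \<open>With \<open>A = 1\<close> this extends a match between \<open>X\<close> and
  \<open>Y\<close>, with \<open>A = 0\<close> a match of \<open>X\<close> with itself, that is, a
  periodic run. Register 16 bounds the position in register 14 only.\<close>

definition extend_match :: "nat \<Rightarrow> com" where
  "extend_match A = While (Conj (Less 14 16) (SymEq 0 14 A 15)) (block [increment 14, increment 15])"

lemma wp_extend_match:
  assumes "reg s 3 = 1" "reg s 14 \<le> reg s 16" "reg s 15 + reg s 16 < 2 ^ b"
    and Q: "\<And>l t. reg s 14 + l \<le> reg s 16 \<Longrightarrow>
      (\<forall>u<l. syms s 0 (reg s 14 + u) = syms s A (reg s 15 + u)) \<Longrightarrow>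
      (reg s 14 + l < reg s 16 \<Longrightarrow> syms s 0 (reg s 14 + l) \<noteq> syms s A (reg s 15 + l)) \<Longrightarrow>
      t \<le> 5 * l + 3 \<Longrightarrow>
      Q t (s\<lparr>reg := (reg s)(14 := reg s 14 + l, 15 := reg s 15 + l)\<rparr>)"
  shows "wp b (extend_match A) Q s"
proof -
  define I where "I = (\<lambda>s'. \<exists>l. s' = s\<lparr>reg := (reg s)(14 := reg s 14 + l, 15 := reg s 15 + l)\<rparr> \<and>
    reg s 14 + l \<le> reg s 16 \<and> (\<forall>u<l. syms s 0 (reg s 14 + u) = syms s A (reg s 15 + u)))"
  show ?thesis
    unfolding extend_match_def
  proof (rule wp_While[where I = I and V = "\<lambda>s'. 5 * (reg s 16 - reg s' 14)"])
    show "I s" unfolding I_def using assms(2) by (intro exI[of _ 0]) simp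
  next
    fix s' assume "I s'" and t: "test_val (Conj (Less 14 16) (SymEq 0 14 A 15)) s'"
    then obtain l where l: "s' = s\<lparr>reg := (reg s)(14 := reg s 14 + l, 15 := reg s 15 + l)\<rparr>"
      "reg s 14 + l \<le> reg s 16" "\<forall>u<l. syms s 0 (reg s 14 + u) = syms s A (reg s 15 + u)"
      by (auto simp: I_def)
    have "reg s 14 + l < reg s 16" "syms s 0 (reg s 14 + l) = syms s A (reg s 15 + l)"
      using t by (simp_all add: l)
    moreover have "I (s\<lparr>reg := (reg s)(14 := Suc (reg s 14 + l), 15 := Suc (reg s 15 + l))\<rparr>)"
      unfolding I_def using calculation l(3) by (intro exI[of _ "Suc l"]) (simp add: less_Suc_eq)
    ultimately show "wp b (block [increment 14, increment 15])
        (\<lambda>t s''. I s'' \<and> test_cost (Conj (Less 14 16) (SymEq 0 14 A 15)) + t +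
          5 * (reg s 16 - reg s'' 14) \<le> 5 * (reg s 16 - reg s' 14)) s'"
      using assms(1,3) by (simp add: wp_simps l(1) fun_upd_twist)
  next
    fix t s' assume "I s'" and f: "\<not> test_val (Conj (Less 14 16) (SymEq 0 14 A 15)) s'"
      and t: "t + 5 * (reg s 16 - reg s' 14) \<le>
        5 * (reg s 16 - reg s 14) + test_cost (Conj (Less 14 16) (SymEq 0 14 A 15))"
    then obtain l where l: "s' = s\<lparr>reg := (reg s)(14 := reg s 14 + l, 15 := reg s 15 + l)\<rparr>"
      "reg s 14 + l \<le> reg s 16" "\<forall>u<l. syms s 0 (reg s 14 + u) = syms s A (reg s 15 + u)"
      by (auto simp: I_def)
    have "t \<le> 5 * l + 3" using t l(2) by (simp add: l(1))
    then show "Q t s'" unfolding l(1) by (intro Q l(2,3)) (use f in \<open>simp_all add: l(1)\<close>)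
  qed
qed

text \<open>Registers 8 and 11 determine the diagonal on which the interval of \<open>X\<close> is
  transferred to \<open>Y\<close>. Its offset may be negative, so the addition precedes the
  subtraction.\<close>

definition mark :: com where
  "mark = block
     [Arith Add 15 14 11, Arith Sub 15 15 8,
      While (Less 14 16) (block [Store 0 14 3, Store 1 15 3, increment 14, increment 15])]"

definition set_cells :: "nat \<Rightarrow> nat \<Rightarrow> (nat \<Rightarrow> nat) \<Rightarrow> nat \<Rightarrow> nat" where
  "set_cells a l f x = (if a \<le> x \<and> x < a + l then 1 else f x)"

lemma set_cells_0 [simp]: "set_cells a 0 f = f"
  by (simp add: set_cells_def fun_eq_iff)

lemma set_cells_Suc: "(set_cells a l f)(a + l := Suc 0) = set_cells a (Suc l) f"
  by (auto simp: set_cells_def fun_eq_iff)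

lemma wp_mark:
  assumes "reg s 3 = 1" "reg s 14 + reg s 11 + reg s 16 < 2 ^ b"
    and y: "y = reg s 14 + reg s 11 - reg s 8" and l: "l = reg s 16 - reg s 14"
    and Q: "\<And>t. t \<le> 5 * l + 3 \<Longrightarrow>
      Q t (s\<lparr>reg := (reg s)(14 := reg s 14 + l, 15 := y + l),
             mem := (mem s)(0 := set_cells (reg s 14) l (mem s 0), 1 := set_cells y l (mem s 1))\<rparr>)"
  shows "wp b mark Q s"
proof -
  define F where "F = (\<lambda>u. s\<lparr>reg := (reg s)(14 := reg s 14 + u, 15 := y + u),
    mem := (mem s)(0 := set_cells (reg s 14) u (mem s 0), 1 := set_cells y u (mem s 1))\<rparr>)"
  have F: "F (Suc u) = F u\<lparr>mem := (mem (F u))(0 := (mem (F u) 0)(reg (F u) 14 := Suc 0),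
      1 := (mem (F u) 1)(reg (F u) 15 := Suc 0)),
      reg := (reg (F u))(14 := Suc (reg (F u) 14), 15 := Suc (reg (F u) 15))\<rparr>" for u
    by (simp add: F_def set_cells_Suc fun_upd_twist)
  have regF: "reg (F u) r = (if r = 15 then y + u else if r = 14 then reg s 14 + u else reg s r)" for u r
    by (simp add: F_def)
  have "s\<lparr>reg := (reg s)(15 := y)\<rparr> = F 0"
    by (simp add: F_def)
  moreover have "wp b (While (Less 14 16) (block [Store 0 14 3, Store 1 15 3, increment 14, increment 15]))
      (\<lambda>t. Q (1 + (1 + t))) (F 0)"
  proof (rule wp_While[where I = "\<lambda>s'. \<exists>u\<le>l. s' = F u" and V = "\<lambda>s'. 5 * (reg s 16 - reg s' 14)"])
    show "\<exists>u\<le>l. F 0 = F u" by (intro exI[of _ 0]) simp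
  next
    fix s' assume "\<exists>u\<le>l. s' = F u" and t: "test_val (Less 14 16) s'"
    then obtain u where u: "s' = F u" by blast
    have lt: "reg s 14 + u < reg s 16" using t by (simp add: u regF)
    have "wp b (block [Store 0 14 3, Store 1 15 3, increment 14, increment 15])
        (\<lambda>t s''. s'' = F (Suc u) \<and> t = 4) (F u)"
      using assms(1,2) lt by (simp add: wp_simps F regF y fun_upd_twist)
    then show "wp b (block [Store 0 14 3, Store 1 15 3, increment 14, increment 15])
        (\<lambda>t s''. (\<exists>u\<le>l. s'' = F u) \<and>
          test_cost (Less 14 16) + t + 5 * (reg s 16 - reg s'' 14) \<le> 5 * (reg s 16 - reg s' 14)) s'"
      unfolding u by (rule wp_mono) (use lt in \<open>auto simp: regF l intro!: exI[of _ "Suc u"]\<close>)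
  next
    fix t s' assume "\<exists>u\<le>l. s' = F u" and f: "\<not> test_val (Less 14 16) s'"
      and t: "t + 5 * (reg s 16 - reg s' 14) \<le> 5 * (reg s 16 - reg (F 0) 14) + test_cost (Less 14 16)"
    then obtain u where u: "u \<le> l" "s' = F u" by blast
    have "u = l" using f u by (auto simp: regF l)
    with t Q[of "1 + (1 + t)"] show "Q (1 + (1 + t)) s'" by (simp add: u(2) regF l F_def)
  qed
  ultimately show ?thesis
    using assms(2) by (simp add: mark_def wp_simps y)
qed

text \<open>The same \<open>A\<close> names the symbols, the marks and the length register of a
  string. Working in place is safe because the write position never overtakes the read
  position.\<close>

definition compact :: "nat \<Rightarrow> com" where
  "compact A = block
     [move 14 23, move 15 23,
      While (Less 14 A)
        (block [Load 21 A 14,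
                Cond (Equal 21 23) (block [SymCopy A 15 A 14, increment 15]) Skip,
                increment 14]),
      move A 15]"

definition marks :: "'a state \<Rightarrow> nat \<Rightarrow> nat set" where
  "marks s A = {x. mem s A x \<noteq> 0}"

lemma kept_Suc: "a \<le> b \<Longrightarrow> kept L M a (Suc b) = kept L M a b @ (if b \<in> M then [] else [L ! b])"
  by (simp add: kept_def)

lemma wp_compact:
  fixes L :: "'a list"
  assumes "reg s 3 = 1" "reg s 23 = 0" "reg s A = length L" "A < 3" "length L < 2 ^ b"
    and L: "\<And>x. x < length L \<Longrightarrow> syms s A x = Some (L ! x)"
    and Q: "\<And>t s'. (\<And>r. r \<notin> {A, 14, 15, 21} \<Longrightarrow> reg s' r = reg s r) \<Longrightarrow>
      mem s' = mem s \<Longrightarrow> (\<And>B. B \<noteq> A \<Longrightarrow> syms s' B = syms s B) \<Longrightarrow>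
      reg s' A = length (kept L (marks s A) 0 (length L)) \<Longrightarrow>
      (\<And>x. x < reg s' A \<Longrightarrow> syms s' A x = Some (kept L (marks s A) 0 (length L) ! x)) \<Longrightarrow>
      t \<le> 7 * length L + 4 \<Longrightarrow> Q t s'"
  shows "wp b (compact A) Q s"
proof -
  let ?K = "\<lambda>x. kept L (marks s A) 0 x"
  define I :: "'a state \<Rightarrow> bool" where "I = (\<lambda>s'. (\<forall>r. r \<notin> {14, 15, 21} \<longrightarrow> reg s' r = reg s r) \<and> mem s' = mem s \<and>
    (\<forall>B. B \<noteq> A \<longrightarrow> syms s' B = syms s B) \<and> reg s' 14 \<le> length L \<and>
    reg s' 15 = length (?K (reg s' 14)) \<and>
    (\<forall>x < reg s' 15. syms s' A x = Some (?K (reg s' 14) ! x)) \<and>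
    (\<forall>x. reg s' 14 \<le> x \<longrightarrow> x < length L \<longrightarrow> syms s' A x = Some (L ! x)))"
  let ?body = "block [Load 21 A 14, Cond (Equal 21 23) (block [SymCopy A 15 A 14, increment 15]) Skip,
                increment 14]"
  have "wp b (While (Less 14 A) ?body) (\<lambda>t s'. wp b (move A 15) (\<lambda>t'. Q (1 + (1 + (t + t')))) s')
      (s\<lparr>reg := (reg s)(14 := 0, 15 := 0)\<rparr>)"
  proof (rule wp_While[where I = I and V = "\<lambda>s'. 7 * (length L - reg s' 14)"])
    show "I (s\<lparr>reg := (reg s)(14 := 0, 15 := 0)\<rparr>)" using L by (simp add: I_def)
  next
    fix s' assume I: "I s'" and "test_val (Less 14 A) s'"
    then have lt: "reg s' 14 < length L" using assms(3,4) by (simp add: I_def)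
    define x where "x = reg s' 14"
    define v where "v = reg s' 15"
    have v: "v = length (?K x)" "v \<le> x"
      using I length_kept_le[of L "marks s A" 0 x] by (simp_all add: I_def x_def v_def)
    have regs: "reg s' r = reg s r" if "r \<notin> {14, 15, 21}" for r using I that by (simp add: I_def)
    have lo: "syms s' A z = Some (?K x ! z)" if "z < v" for z
      using I that by (simp add: I_def x_def v_def)
    have hi: "syms s' A z = Some (L ! z)" if "x \<le> z" "z < length L" for z
      using I that by (simp add: I_def x_def)
    have m: "mem s' = mem s" "\<And>B. B \<noteq> A \<Longrightarrow> syms s' B = syms s B" using I by (simp_all add: I_def)
    have xl: "x < length L" using lt by (simp add: x_def)
    have r3: "reg s' 3 = 1" "reg s' 23 = 0" using regs assms(1,2) by simp_all
    have xv: "reg s' 14 = x" "reg s' 15 = v" by (simp_all add: x_def v_def)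
    have b: "Suc v < 2 ^ b" "Suc x < 2 ^ b" using xl v(2) assms(5) by linarith+
    show "wp b ?body (\<lambda>t s''. I s'' \<and>
        test_cost (Less 14 A) + t + 7 * (length L - reg s'' 14) \<le> 7 * (length L - reg s' 14)) s'"
    proof (cases "x \<in> marks s A")
      case True
      have "I (s'\<lparr>reg := (reg s')(21 := mem s A x, 14 := Suc x)\<rparr>)"
      proof -
        have "?K (Suc x) = ?K x" using True by (simp add: kept_Suc)
        then show ?thesis unfolding I_def using xl v(1) lo hi by (simp add: regs m xv)
      qed
      then show ?thesis using True xl b by (simp add: wp_simps r3 xv m(1) marks_def)
    next
      case False
      have "I (s'\<lparr>syms := (syms s')(A := (syms s' A)(v := Some (L ! x))),
          reg := (reg s')(21 := 0, 15 := Suc v, 14 := Suc x)\<rparr>)"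
      proof -
        have K: "?K (Suc x) = ?K x @ [L ! x]" using False by (simp add: kept_Suc)
        have "(if z = v then Some (L ! x) else syms s' A z) = Some (?K (Suc x) ! z)"
          if "z < Suc v" for z
          using that v(1) lo[of z] by (auto simp: K nth_append less_Suc_eq)
        moreover have "(if z = v then Some (L ! x) else syms s' A z) = Some (L ! z)"
          if "Suc x \<le> z" "z < length L" for z
          using that v(2) hi[of z] by auto
        moreover have "Suc v = length (?K (Suc x))" by (simp add: K v(1))
        ultimately show ?thesis unfolding I_def using xl by (auto simp: regs m)
      qed
      then show ?thesis using False xl b hi[of x] by (simp add: wp_simps r3 xv m(1) marks_def)
    qed
  next
    fix t s' assume I: "I s'" and f: "\<not> test_val (Less 14 A) s'"
      and t: "t + 7 * (length L - reg s' 14) \<le>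
        7 * (length L - reg (s\<lparr>reg := (reg s)(14 := 0, 15 := 0)\<rparr>) 14) + test_cost (Less 14 A)"
    have "reg s' A = length L" using I assms(3,4) by (simp add: I_def)
    then have "reg s' 14 = length L" using I f by (simp add: I_def)
    then have r15: "reg s' 15 = length (?K (length L))"
      "\<And>x. x < reg s' 15 \<Longrightarrow> syms s' A x = Some (?K (length L) ! x)"
      using I by (simp_all add: I_def)
    have regs: "reg s' r = reg s r" if "r \<notin> {14, 15, 21}" for r using I that by (simp add: I_def)
    have m: "mem s' = mem s" "\<And>B. B \<noteq> A \<Longrightarrow> syms s' B = syms s B" using I by (simp_all add: I_def)
    have "reg s' 15 < 2 ^ b" using length_kept_le[of L "marks s A" 0 "length L"] assms(5) r15(1) by simp
    moreover have "Q (1 + (1 + (t + 1))) (s'\<lparr>reg := (reg s')(A := reg s' 15)\<rparr>)"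
    proof (rule Q)
      show "1 + (1 + (t + 1)) \<le> 7 * length L + 4" using t by simp
    qed (use r15 m in \<open>simp_all add: regs\<close>)
    ultimately show "wp b (move A 15) (\<lambda>t'. Q (1 + (1 + (t + t')))) s'"
      by (simp add: wp_simps regs assms(2))
  qed
  then show ?thesis by (simp add: compact_def wp_simps assms(2))
qed

section \<open>The longest match over the band of diagonals\<close>

definition agree :: "nat set \<Rightarrow> (nat \<Rightarrow> nat) \<Rightarrow> (nat \<Rightarrow> nat) \<Rightarrow> bool" where
  "agree R f g \<longleftrightarrow> (\<forall>r. r \<notin> R \<longrightarrow> g r = f r)"

lemma agree_refl [simp]: "agree R f f"
  by (simp add: agree_def)

lemma agree_upd [simp]: "r \<in> R \<Longrightarrow> agree R f g \<Longrightarrow> agree R f (g(r := v))"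
  by (simp add: agree_def)

lemma agree_trans: "agree R f g \<Longrightarrow> agree R' g h \<Longrightarrow> R \<union> R' \<subseteq> R'' \<Longrightarrow> agree R'' f h"
  unfolding agree_def by (metis Un_iff subsetD)

lemma agreeD: "agree R f g \<Longrightarrow> r \<notin> R \<Longrightarrow> g r = f r"
  by (simp add: agree_def)

text \<open>Register 13 runs through the band up to register 18. Register 12 tells whether a match
  of length \<open>k\<close> has been found, and 10 and 11 hold the first and the last one.\<close>

definition scan :: com where
  "scan = block
     [Arith Sub 13 8 5, Arith Add 18 8 6, move 12 23,
      While (Neg (Less 18 13)) (block
        [move 14 8, move 15 13, Arith Add 16 8 2, extend_match 1,
         Cond (Equal 14 16)
           (block [Cond (Equal 12 23) (block [move 10 13, move 12 3]) Skip, move 11 13])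
           Skip,
         increment 13])]"

text \<open>Besides the first and the last position found by \<open>scan\<close>, only the one computed in register 21
  can have the longest match, by \<open>longest_match_between\<close>.\<close>

definition best :: com where
  "best = block
     [move 14 8, move 15 11, move 16 0, extend_match 1, move 17 14,
      move 14 8, move 15 10, extend_match 1,
      Cond (Less 17 14)
        (block
          [Arith Add 21 11 17, Arith Sub 21 21 14, move 17 14, move 11 10,
           Cond (Less 10 21)
             (block [move 14 8, move 15 21, extend_match 1,
                Cond (Less 17 14) (block [move 17 14, move 11 21]) Skip])
             Skip])
        Skip]"

text \<open>\<open>large\<close> is available because short inputs are returned unchanged. It makes
  \<open>k\<close> and \<open>threshold k\<close> small against the total length, so that all
  computed numbers fit into words, and it provides a string with more than \<open>k\<close> symbols
  for \<open>reject\<close>.\<close>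

locale ram_input =
  fixes X Y :: "'a list" and k b :: nat
  assumes k_pos: "0 < k"
    and near: "absdiff (length X) (length Y) \<le> k"
    and words: "4 * (length X + length Y + 1) \<le> 2 ^ b"
    and large: "threshold k + 4 * k \<le> length X + length Y"
begin

lemma word: "v < 4 * length X + 4 * length Y + 4 \<Longrightarrow> v < 2 ^ b"
  using words by simp

lemma word_pos: "Suc 0 < 2 ^ b"
  by (rule word) simp

definition lo :: nat where
  "lo = (k - absdiff (length X) (length Y)) div 2 + (length X - length Y)"

definition hi :: nat where
  "hi = (k - absdiff (length X) (length Y)) div 2 + (length Y - length X)"

definition in_band :: "nat \<Rightarrow> nat \<Rightarrow> bool" where
  "in_band i j \<longleftrightarrow> i \<le> j + lo \<and> j \<le> i + hi"

text \<open>The band has at most \<open>k + 1\<close> diagonals. This bounds the work of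
  \<open>scan\<close>, and the distance of two candidates in
  \<open>longest_match_between\<close>.\<close>

lemma lo_hi: "lo + hi \<le> k"
  using near unfolding lo_def hi_def absdiff_def by linarith

lemma in_band_iff:
  "i \<le> length X \<Longrightarrow> j \<le> length Y \<Longrightarrow>
     in_band i j \<longleftrightarrow> absdiff i j + absdiff (length X - i) (length Y - j) \<le> k"
  using band_iff[of i "length X" j "length Y" k] near by (simp add: in_band_def lo_def hi_def)

definition ready :: "'a state \<Rightarrow> bool" where
  "ready s \<longleftrightarrow> reg s 0 = length X \<and> reg s 1 = length Y \<and> reg s 2 = k \<and> reg s 3 = 1 \<and>
     reg s 5 = lo \<and> reg s 6 = hi \<and> reg s 7 = threshold k \<and> reg s 23 = 0 \<and>
     syms s 0 = sym_array X \<and> syms s 1 = sym_array Y"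

lemma readyD:
  assumes "ready s"
  shows "reg s 0 = length X" "reg s 1 = length Y" "reg s 2 = k" "reg s 3 = 1" "reg s 5 = lo"
    "reg s 6 = hi" "reg s 7 = threshold k" "reg s 23 = 0" "syms s 0 = sym_array X"
    "syms s 1 = sym_array Y" "reg s (Suc 0) = length Y"
    "syms s (Suc 0) = sym_array Y"
  using assms by (simp_all add: ready_def)

lemma ready_agree:
  assumes "ready s" "agree R (reg s) (reg s')" "syms s' = syms s" "R \<inter> {0, 1, 2, 3, 5, 6, 7, 23} = {}"
  shows "ready s'"
  using assms by (auto simp: ready_def agree_def)

abbreviation scan_regs :: "nat set" where
  "scan_regs \<equiv> {10, 11, 12, 13, 14, 15, 16, 18}"

lemma wp_scan:
  assumes r: "ready s" and i: "reg s 8 = i" "i + k \<le> length X"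
    and Q: "\<And>t s'. agree scan_regs (reg s) (reg s') \<Longrightarrow> syms s' = syms s \<Longrightarrow> mem s' = mem s \<Longrightarrow>
      reg s' 12 = 0 \<and> (\<forall>j. in_band i j \<longrightarrow> \<not> matches X Y i j k) \<or>
      reg s' 12 = 1 \<and> in_band i (reg s' 10) \<and> in_band i (reg s' 11) \<and>
      matches X Y i (reg s' 10) k \<and> matches X Y i (reg s' 11) k \<and>
      (\<forall>j. in_band i j \<longrightarrow> matches X Y i j k \<longrightarrow> reg s' 10 \<le> j \<and> j \<le> reg s' 11) \<Longrightarrow>
      t \<le> (k + 1) * (5 * k + 20) + 10 \<Longrightarrow> Q t s'"
  shows "wp b scan Q s"
proof -
  \<comment> \<open>The invariant is phrased for plain numbers (first hit, last hit, flag, next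
    position), which separates the reasoning about the band from the register updates.\<close>
  define J where "J = (\<lambda>j1 jr f j. i \<le> j + lo \<and> j \<le> i + hi + 1 \<and>
    (f = 0 \<and> (\<forall>j'<j. in_band i j' \<longrightarrow> \<not> matches X Y i j' k) \<or>
     f = Suc 0 \<and> j1 < j \<and> in_band i j1 \<and> in_band i jr \<and> matches X Y i j1 k \<and> matches X Y i jr k \<and>
      (\<forall>j'<j. in_band i j' \<longrightarrow> matches X Y i j' k \<longrightarrow> j1 \<le> j' \<and> j' \<le> jr)))"
  have J0: "J j1 jr 0 (i - lo)" for j1 jr by (auto simp: J_def in_band_def)
  have Jfirst: "J j j (Suc 0) (Suc j)" if "J j1 jr 0 j" "matches X Y i j k" "j \<le> i + hi" for j1 jr j
    using that by (auto simp: J_def in_band_def less_Suc_eq)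
  have Jnext: "J j1 j (Suc 0) (Suc j)" if "J j1 jr f j" "f \<noteq> 0" "matches X Y i j k" "j \<le> i + hi" for j1 jr f j
    using that by (auto simp: J_def in_band_def less_Suc_eq)
  have Jskip: "J j1 jr f (Suc j)" if "J j1 jr f j" "\<not> matches X Y i j k" "j \<le> i + hi" for j1 jr f j
    using that by (auto simp: J_def less_Suc_eq)
  have Jf: "f = 0 \<or> f = Suc 0" if "J j1 jr f j" for j1 jr f j using that by (auto simp: J_def)
  define I :: "'a state \<Rightarrow> bool" where "I = (\<lambda>s'. agree scan_regs (reg s) (reg s') \<and> syms s' = syms s \<and>
    mem s' = mem s \<and> reg s' 18 = i + hi \<and> J (reg s' 10) (reg s' 11) (reg s' 12) (reg s' 13))"
  let ?body = "block
        [move 14 8, move 15 13, Arith Add 16 8 2, extend_match 1,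
         Cond (Equal 14 16)
           (block [Cond (Equal 12 23) (block [move 10 13, move 12 3]) Skip, move 11 13])
           Skip,
         increment 13]"
  let ?V = "\<lambda>s'. (5 * k + 20) * (i + hi + 1 - reg s' 13)"
  have "wp b (While (Neg (Less 18 13)) ?body) (\<lambda>t. Q (1 + (1 + (1 + t))))
      (s\<lparr>reg := (reg s)(13 := i - lo, 18 := i + hi, 12 := 0)\<rparr>)"
  proof (rule wp_While[where I = I and V = ?V])
    show "I (s\<lparr>reg := (reg s)(13 := i - lo, 18 := i + hi, 12 := 0)\<rparr>)"
      by (simp add: I_def J0)
  next
    fix s' assume I: "I s'" and "test_val (Neg (Less 18 13)) s'"
    then have le: "reg s' 13 \<le> i + hi" by (simp add: I_def)
    define j where "j = reg s' 13"
    have ag: "agree scan_regs (reg s) (reg s')" "syms s' = syms s" "mem s' = mem s" "reg s' 18 = i + hi"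
      and J: "J (reg s' 10) (reg s' 11) (reg s' 12) j" using I by (simp_all add: I_def j_def)
    have "ready s'" by (rule ready_agree[OF r ag(1,2)]) simp
    note rd = readyD[OF this]
    have r8: "reg s' 8 = i" using agreeD[OF ag(1), of 8] i(1) by simp
    have j: "reg s' 13 = j" "j \<le> i + hi" using le by (simp_all add: j_def)
    have V: "(5 * k + 20) * (i + hi + 1 - j) = (5 * k + 20) * (i + hi - j) + (5 * k + 20)"
    proof -
      have "i + hi + 1 - j = Suc (i + hi - j)" using j(2) by simp
      then show ?thesis by simp
    qed
    have bounds: "i + k < 2 ^ b" "j + (i + k) < 2 ^ b" "Suc j < 2 ^ b" "i < 2 ^ b" "j < 2 ^ b"
      "j + i + k < 2 ^ b"
      by (rule word, use i(2) j(2) lo_hi large in linarith)+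
    have m1: "matches X Y i j k" if "\<forall>u<k. sym_array X (i + u) = sym_array Y (j + u)"
      using that by (simp add: matches_def)
    have m2: "\<not> matches X Y i j k" if "l < k" "sym_array X (i + l) \<noteq> sym_array Y (j + l)" for l
      using that by (auto simp: matches_def)
    show "wp b ?body (\<lambda>t s''. I s'' \<and> test_cost (Neg (Less 18 13)) + t + ?V s'' \<le> ?V s') s'"
      apply (simp add: wp_simps r8 j(1) rd bounds del: One_nat_def)
      apply (rule wp_extend_match)
         apply (simp add: rd)
        apply simp
       apply (use bounds in simp)
      subgoal for l t
        using J Jf[OF J] V Jfirst[OF _ _ j(2)] Jnext[OF J _ _ j(2)] Jskip[OF J _ j(2)] m1 m2[of l]
        by (auto simp: wp_simps r8 j(1) rd bounds I_def ag readyD(9,12)[OF r] word_pos)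
      done
  next
    fix t s' assume I: "I s'" and "\<not> test_val (Neg (Less 18 13)) s'"
      and t: "t + ?V s' \<le> ?V (s\<lparr>reg := (reg s)(13 := i - lo, 18 := i + hi, 12 := 0)\<rparr>) +
        test_cost (Neg (Less 18 13))"
    then have gt: "i + hi < reg s' 13" and J: "J (reg s' 10) (reg s' 11) (reg s' 12) (reg s' 13)"
      by (simp_all add: I_def)
    have "i + hi + 1 - (i - lo) \<le> k + 1" using lo_hi by linarith
    then have "(5 * k + 20) * (i + hi + 1 - (i - lo)) \<le> (5 * k + 20) * (k + 1)"
      by (rule mult_le_mono2)
    then have "1 + (1 + (1 + t)) \<le> (k + 1) * (5 * k + 20) + 10" using t by (simp add: mult.commute)
    then show "Q (1 + (1 + (1 + t))) s'"
      using I J gt by (intro Q) (auto simp: I_def J_def in_band_def)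
  qed
  moreover have "i < 2 ^ b" "i + hi < 2 ^ b"
    by (rule word, use i(2) lo_hi large in linarith)+
  ultimately show ?thesis
    by (simp add: scan_def wp_simps readyD[OF r] i(1))
qed

definition maximal_match :: "nat \<Rightarrow> nat \<Rightarrow> nat \<Rightarrow> bool" where
  "maximal_match i j l \<longleftrightarrow> i + l \<le> length X \<and> matches X Y i j l \<and>
     (i + l < length X \<longrightarrow> sym_array X (i + l) \<noteq> sym_array Y (j + l))"

lemma maximal_match_ge:
  assumes "maximal_match i j l" "matches X Y i j h" "i + h \<le> length X"
  shows "h \<le> l"
proof (rule ccontr)
  assume "\<not> h \<le> l"
  then show False using assms by (auto simp: maximal_match_def matches_def)
qed

text \<open>All candidates match \<open>k\<close> symbols and lie within distance \<open>k\<close>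
  of each other, as \<open>longest_match_between\<close> requires. A better position exists only if
  \<open>t < u\<close>, and then it is unique and computable from \<open>t\<close> and
  \<open>u\<close>.\<close>

lemma match_candidates:
  assumes t: "maximal_match i jr t" and u: "maximal_match i j1 u"
    and j1: "in_band i j1" "matches X Y i j1 k" and jr: "in_band i jr" "matches X Y i jr k"
    and bw: "\<forall>j. in_band i j \<longrightarrow> matches X Y i j k \<longrightarrow> j1 \<le> j \<and> j \<le> jr"
    and i: "i + k \<le> length X"
    and h: "in_band i j" "matches X Y i j h" "i + h \<le> length X" "t < h" "u < h"
  shows "j1 < j \<and> t < u \<and> j = jr + t - u"
proof -
  have kt: "k \<le> t" using maximal_match_ge[OF t jr(2) i] .
  have ku: "k \<le> u" using maximal_match_ge[OF u j1(2) i] .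
  have "matches X Y i j k" using h(2,4) kt by (simp add: matches_def)
  with bw h(1) have "j1 \<le> j" "j \<le> jr" by auto
  moreover have "j \<noteq> j1" "j \<noteq> jr"
    using maximal_match_ge[OF t, of h] maximal_match_ge[OF u, of h] h by auto
  ultimately have j: "j1 < j" "j < jr" by auto
  have d: "jr - j1 \<le> k" using j1(1) jr(1) lo_hi by (auto simp: in_band_def)
  have "j + u = jr + t"
  proof (rule longest_match_between[of j1 j jr t u "\<lambda>a. sym_array X (i + a)" "sym_array Y" h])
    show "jr - j1 \<le> t" "jr - j1 \<le> u" using d kt ku by simp_all
    show "sym_array X (i + t) \<noteq> sym_array Y (jr + t)" "sym_array X (i + u) \<noteq> sym_array Y (j1 + u)"
      using t u h(3-5) by (simp_all add: maximal_match_def)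
  qed (use j h t u in \<open>simp_all add: maximal_match_def matches_def\<close>)
  with j show ?thesis by auto
qed

text \<open>At most three extensions are run, and none gets further than the match finally chosen;
  hence the factor 15, at 5 units per symbol.\<close>

lemma wp_best:
  assumes r: "ready s" and i: "reg s 8 = i" "i + k \<le> length X"
    and j1: "in_band i (reg s 10)" "matches X Y i (reg s 10) k"
    and jr: "in_band i (reg s 11)" "matches X Y i (reg s 11) k"
    and bw: "\<forall>j. in_band i j \<longrightarrow> matches X Y i j k \<longrightarrow> reg s 10 \<le> j \<and> j \<le> reg s 11"
    and Q: "\<And>t s'. agree {11, 14, 15, 16, 17, 21} (reg s) (reg s') \<Longrightarrow> syms s' = syms s \<Longrightarrow>
      mem s' = mem s \<Longrightarrow> in_band i (reg s' 11) \<Longrightarrow> i + k \<le> reg s' 17 \<Longrightarrow> reg s' 17 \<le> length X \<Longrightarrow>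
      matches X Y i (reg s' 11) (reg s' 17 - i) \<Longrightarrow>
      (\<And>j. in_band i j \<Longrightarrow> reg s' 17 < length X \<Longrightarrow> \<not> matches X Y i j (Suc (reg s' 17) - i)) \<Longrightarrow>
      t \<le> 15 * (reg s' 17 - i) + 40 \<Longrightarrow> Q t s'"
  shows "wp b best Q s"
proof -
  define j1 jr where "j1 = reg s 10" and "jr = reg s 11"
  note jj = j1_def[symmetric] jr_def[symmetric]
  note rd = readyD[OF r]
  have jb: "jr \<le> length X + k" "j1 \<le> length X + k"
    using i(2) lo_hi j1(1) jr(1) unfolding in_band_def jj by linarith+
  then have bounds: "i < 2 ^ b" "jr < 2 ^ b" "j1 < 2 ^ b" "length X < 2 ^ b" "jr + length X < 2 ^ b"
    "j1 + length X < 2 ^ b"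
    using i(2) large by (intro word; linarith)+
  have mm: "maximal_match i j l" if "i + l \<le> length X"
    "\<forall>u<l. sym_array X (i + u) = sym_array Y (j + u)"
    "i + l < length X \<Longrightarrow> sym_array X (i + l) \<noteq> sym_array Y (j + l)" for j l
    using that by (auto simp: maximal_match_def matches_def)
  have fin: "Q t s'" if "maximal_match i j l" "in_band i j" "k \<le> l"
    "\<And>j' h. in_band i j' \<Longrightarrow> matches X Y i j' h \<Longrightarrow> i + h \<le> length X \<Longrightarrow> h \<le> l"
    "reg s' 11 = j" "reg s' 17 = i + l" "agree {11, 14, 15, 16, 17, 21} (reg s) (reg s')"
    "syms s' = syms s" "mem s' = mem s" "t \<le> 15 * l + 40" for j l t s'
  proof (rule Q)
    fix j' assume "in_band i j'" "reg s' 17 < length X"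
    then show "\<not> matches X Y i j' (Suc (reg s' 17) - i)"
      using that(4)[of j' "Suc l"] that(6) by (auto simp: Suc_diff_le)
  qed (use that in \<open>auto simp: maximal_match_def\<close>)
  have sy: "syms s 0 = sym_array X" "syms s (Suc 0) = sym_array Y" by (simp_all add: rd)
  show ?thesis
    unfolding best_def
    apply (simp add: wp_simps rd i(1) jj bounds)
    apply (rule wp_extend_match)
       apply (simp add: rd)
      apply (use i(2) in simp)
     apply (use bounds in simp)
    subgoal premises t for t c1
    proof -
      have t': "i + t \<le> length X" "c1 \<le> 5 * t + 3" using t(1,4) by simp_all
      have T: "maximal_match i jr t"
        by (rule mm) (use t in \<open>simp_all add: sy\<close>)
      have kt: "k \<le> t" by (rule maximal_match_ge[OF T]) (use jr(2) i(2) in \<open>simp_all add: jj\<close>)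
      have bt: "i + t < 2 ^ b" "jr + (i + t) < 2 ^ b"
        using bounds(4,5) t'(1) by linarith+
      show ?thesis
        apply (simp add: wp_simps rd i(1) jj bounds bt)
        apply (rule wp_extend_match)
           apply (simp add: rd)
          apply (use i(2) in simp)
         apply (use bounds in simp)
        subgoal premises u for u c2
        proof -
          have u': "i + u \<le> length X" "c2 \<le> 5 * u + 3" using u(1,4) by simp_all
          have U: "maximal_match i j1 u"
            by (rule mm) (use u in \<open>simp_all add: sy\<close>)
          have bu: "i + u < 2 ^ b" using bounds(4) u'(1) by linarith
          have cand: "j1 < j \<and> t < u \<and> j = jr + t - u"
            if "in_band i j" "matches X Y i j h" "i + h \<le> length X" "t < h" "u < h" for j h
            using match_candidates[OF T U _ _ _ _ _ i(2) that] j1 jr bw unfolding jj by blast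
          show ?thesis
          proof (cases "t < u")
            case False
            have "h \<le> t" if "in_band i j" "matches X Y i j h" "i + h \<le> length X" for j h
              using cand[OF that] False by linarith
            then show ?thesis
              using False t' u'
              by (simp add: wp_simps rd i(1) jj bounds)
                (rule fin[OF T _ kt], use jr in \<open>simp_all add: jj\<close>)
          next
            case True
            define j3 where "j3 = jr + t - u"
            have j3: "jr + (i + t) - (i + u) = j3" by (simp add: j3_def)
            have b3: "j3 < 2 ^ b" "j3 + length X < 2 ^ b" using bounds(2,5) True unfolding j3_def by linarith+
            have ku: "k \<le> u" using kt True by simp
            show ?thesis
            proof (cases "j1 < j3")
              case False
              have "h \<le> u" if "in_band i j" "matches X Y i j h" "i + h \<le> length X" for j h
                using cand[OF that] False True unfolding j3_def by linarith
              then show ?thesis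
                using False True t' u'
                by (simp add: wp_simps rd i(1) jj bounds bt bu b3 j3)
                  (rule fin[OF U _ ku], use j1 in \<open>simp_all add: jj\<close>)
            next
              case j13: True
              have "j3 \<le> jr" using True by (simp add: j3_def)
              then have band3: "in_band i j3" using j13 j1(1) jr(1) by (auto simp: in_band_def jj)
              show ?thesis
                using j13 True
                apply (simp add: wp_simps rd i(1) jj bounds bt bu b3 j3)
                apply (rule wp_extend_match)
                   apply (simp add: rd)
                  apply (use i(2) in simp)
                 apply (use b3 in simp)
                subgoal premises v for v c3
                proof -
                  have v': "i + v \<le> length X" "c3 \<le> 5 * v + 3" using v(3,6) by simp_all
                  have V: "maximal_match i j3 v"
                    by (rule mm) (use v in \<open>simp_all add: sy\<close>)
                  have bv: "i + v < 2 ^ b" using bounds(4) v'(1) by linarith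
                  have m: "h \<le> max u v" if "in_band i j" "matches X Y i j h" "i + h \<le> length X" for j h
                  proof (rule ccontr)
                    assume "\<not> h \<le> max u v"
                    then have "j = j3" using cand[OF that] True by (auto simp: j3_def)
                    then have "h \<le> v" using maximal_match_ge[OF V] that by simp
                    with \<open>\<not> h \<le> max u v\<close> show False by simp
                  qed
                  show ?thesis
                  proof (cases "u < v")
                    case uv: True
                    then have m': "h \<le> v" if "in_band i j" "matches X Y i j h" "i + h \<le> length X" for j h
                      using m[OF that] by simp
                    show ?thesis
                      using uv True t' u' v' ku m'
                      by (simp add: wp_simps rd i(1) jj bounds bt bu b3 bv)
                        (rule fin[OF V band3], simp_all)
                  next
                    case uv: False
                    then have m': "h \<le> u" if "in_band i j" "matches X Y i j h" "i + h \<le> length X" for j h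
                      using m[OF that] by simp
                    show ?thesis
                      using uv True t' u' v' m'
                      by (simp add: wp_simps rd i(1) jj bounds bt bu b3 bv)
                        (rule fin[OF U _ ku], use j1 in \<open>simp_all add: jj\<close>)
                  qed
                qed
                done
            qed
          qed
        qed
        done
    qed
    done
qed

end

text \<open>The periods 1, 2, ... are tried until the window, which ends at register 22, agrees with
  itself shifted. The window has length \<open>2 * k\<close>, as \<open>aperiodic_break\<close>
  demands. Starting with register 14 at the beginning of the window makes the first test
  succeed.\<close>

definition find_period :: com where
  "find_period = block
     [move 18 23, move 14 19,
      While (Conj (Less 18 2) (Neg (Equal 14 22)))
        (block [increment 18, Arith Add 14 19 18, move 15 19, move 16 22, extend_match 0])]"

text \<open>At the conditional, register 18 is a period of the first \<open>2 * k\<close> symbols of the phrase if register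
  14 has reached register 22, and otherwise there is no period up to \<open>k\<close>.\<close>

definition parse_phrase :: com where
  "parse_phrase = block
     [Store 2 20 19, Arith Add 22 19 2, Arith Add 22 22 2, find_period,
      Cond (Equal 14 22)
        (block
          [move 16 17, extend_match 0,
           Arith Sub 21 14 19, Arith Sub 21 21 7, Arith Div 21 21 18, Arith Mul 21 21 18,
           move 22 14, move 14 19, Arith Add 16 19 21, mark,
           Cond (Less 22 17)
             (block [increment 20, Arith Add 19 22 3, Cond (Less 19 24) (move 19 24) Skip])
             (move 19 17)])
        (block [increment 20, move 19 24]),
      Arith Add 24 19 7]"

lemma marks_set_cells:
  "{x. 0 < set_cells a l f x} = {x. 0 < f x} \<union> {a..<a + l}"
  by (auto simp: set_cells_def)

context ram_input
begin

lemma wp_find_period: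
  assumes r: "ready s" and p: "reg s 19 = p" "reg s 22 = p + 2 * k" "p + 2 * k \<le> length X"
    and Q: "\<And>t s'. agree {14, 15, 16, 18} (reg s) (reg s') \<Longrightarrow> syms s' = syms s \<Longrightarrow>
      mem s' = mem s \<Longrightarrow>
      reg s' 14 = p + 2 * k \<and> 0 < reg s' 18 \<and> reg s' 18 \<le> k \<and> reg s' 15 + reg s' 18 = p + 2 * k \<and>
        (\<forall>x. p + reg s' 18 \<le> x \<longrightarrow> x < p + 2 * k \<longrightarrow> sym_array X x = sym_array X (x - reg s' 18)) \<or>
      reg s' 14 \<noteq> p + 2 * k \<and> (\<forall>q. 0 < q \<longrightarrow> q \<le> k \<longrightarrow>
        (\<exists>x. p + q \<le> x \<and> x < p + 2 * k \<and> sym_array X x \<noteq> sym_array X (x - q))) \<Longrightarrow>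
      t \<le> k * (10 * k + 20) + 10 \<Longrightarrow> Q t s'"
  shows "wp b find_period Q s"
proof -
  define J where "J = (\<lambda>q x y. q \<le> k \<and>
     (x = p + 2 * k \<and> 0 < q \<and> y + q = p + 2 * k \<and>
        (\<forall>x. p + q \<le> x \<longrightarrow> x < p + 2 * k \<longrightarrow> sym_array X x = sym_array X (x - q)) \<or>
      x \<noteq> p + 2 * k \<and> (\<forall>q'. 0 < q' \<longrightarrow> q' \<le> q \<longrightarrow>
        (\<exists>x. p + q' \<le> x \<and> x < p + 2 * k \<and> sym_array X x \<noteq> sym_array X (x - q')))))"
  have J0: "J 0 p y" for y using k_pos by (simp add: J_def)
  have J1: "J (Suc q) (Suc (p + q + l)) (p + l)"
    if "J q x y" "x \<noteq> p + 2 * k" "q < k" "Suc (p + q + l) \<le> p + 2 * k"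
      and eqs: "\<forall>u<l. sym_array X (Suc (p + q + u)) = sym_array X (p + u)"
      and "Suc (p + q + l) < p + 2 * k \<Longrightarrow> sym_array X (Suc (p + q + l)) \<noteq> sym_array X (p + l)" for q x y l
  proof (cases "Suc (p + q + l) = p + 2 * k")
    case True
    have "sym_array X z = sym_array X (z - Suc q)" if "p + Suc q \<le> z" "z < p + 2 * k" for z
    proof -
      have eq: "Suc (p + q + (z - (p + Suc q))) = z" "p + (z - (p + Suc q)) = z - Suc q"
        using that(1) by simp_all
      have "z - (p + Suc q) < l" using that True by linarith
      from eqs[rule_format, OF this] show ?thesis unfolding eq .
    qed
    then show ?thesis using True that(3) by (simp add: J_def)
  next
    case False
    have "\<exists>x. p + q' \<le> x \<and> x < p + 2 * k \<and> sym_array X x \<noteq> sym_array X (x - q')"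
      if "0 < q'" "q' \<le> Suc q" for q'
    proof (cases "q' = Suc q")
      case True
      have "sym_array X (Suc (p + q + l)) \<noteq> sym_array X (Suc (p + q + l) - q')"
        using False \<open>Suc (p + q + l) \<le> p + 2 * k\<close> \<open>Suc (p + q + l) < p + 2 * k \<Longrightarrow> _\<close>
        by (simp add: True)
      then show ?thesis using False \<open>Suc (p + q + l) \<le> p + 2 * k\<close> True
        by (intro exI[of _ "Suc (p + q + l)"]) simp
    next
      case False
      then show ?thesis using \<open>J q x y\<close> \<open>x \<noteq> p + 2 * k\<close> that by (auto simp: J_def)
    qed
    then show ?thesis using False that(3) by (simp add: J_def)
  qed
  define I :: "'a state \<Rightarrow> bool" where "I = (\<lambda>s'. agree {14, 15, 16, 18} (reg s) (reg s') \<and>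
    syms s' = syms s \<and> mem s' = mem s \<and> J (reg s' 18) (reg s' 14) (reg s' 15))"
  let ?body = "block [increment 18, Arith Add 14 19 18, move 15 19, move 16 22, extend_match 0]"
  let ?p = "Conj (Less 18 2) (Neg (Equal 14 22))"
  let ?V = "\<lambda>s'. (10 * k + 20) * (k - reg s' 18)"
  note rd = readyD[OF r]
  have "wp b (While ?p ?body) (\<lambda>t. Q (1 + (1 + t))) (s\<lparr>reg := (reg s)(18 := 0, 14 := p)\<rparr>)"
  proof (rule wp_While[where I = I and V = ?V])
    show "I (s\<lparr>reg := (reg s)(18 := 0, 14 := p)\<rparr>)"
      by (simp add: I_def J0)
  next
    fix s' assume I: "I s'" and tv: "test_val ?p s'"
    define q where "q = reg s' 18"
    have ag: "agree {14, 15, 16, 18} (reg s) (reg s')" "syms s' = syms s" "mem s' = mem s"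
      and J: "J q (reg s' 14) (reg s' 15)" using I by (simp_all add: I_def q_def)
    have regs: "reg s' 2 = k" "reg s' 3 = 1" "reg s' 19 = p" "reg s' 22 = p + 2 * k" "reg s' 23 = 0"
      "reg s' 18 = q"
      using agreeD[OF ag(1), of 2] agreeD[OF ag(1), of 3] agreeD[OF ag(1), of 19]
        agreeD[OF ag(1), of 22] agreeD[OF ag(1), of 23] by (simp_all add: rd p q_def)
    have q: "q < k" "reg s' 14 \<noteq> p + 2 * k" using tv by (simp_all add: regs)
    have V: "(10 * k + 20) * (k - q) = (10 * k + 20) * (k - Suc q) + (10 * k + 20)"
    proof -
      have "k - q = Suc (k - Suc q)" using q(1) by simp
      then show ?thesis by simp
    qed
    have bounds: "Suc q < 2 ^ b" "Suc (p + q) < 2 ^ b" "p < 2 ^ b" "p + 2 * k < 2 ^ b"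
      "p + (p + 2 * k) < 2 ^ b"
      by (rule word, use q(1) p(3) in linarith)+
    show "wp b ?body (\<lambda>t s''. I s'' \<and> test_cost ?p + t + ?V s'' \<le> ?V s') s'"
      apply (simp add: wp_simps regs bounds)
      apply (rule wp_extend_match)
         apply (simp add: regs)
        apply (use q(1) in simp)
       apply (use bounds in simp)
      subgoal premises l for l t
      proof -
        have l': "p + q + l < p + 2 * k" "t \<le> 5 * l + 3" using l(1,4) by simp_all
        have "J (Suc q) (Suc (p + q + l)) (p + l)"
          by (rule J1[OF J q(2,1)]) (use l in \<open>simp_all add: ag rd\<close>)
        then show ?thesis using V l' by (simp add: I_def ag regs)
      qed
      done
  next
    fix t s' assume I: "I s'" and "\<not> test_val ?p s'"
      and t: "t + ?V s' \<le> ?V (s\<lparr>reg := (reg s)(18 := 0, 14 := p)\<rparr>) + test_cost ?p"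
    then have "reg s' 18 < k \<Longrightarrow> reg s' 14 = p + 2 * k"
      using agreeD[of "{14, 15, 16, 18}" "reg s" "reg s'" 2]
        agreeD[of "{14, 15, 16, 18}" "reg s" "reg s'" 22] by (simp add: I_def rd p)
    moreover have "1 + (1 + t) \<le> k * (10 * k + 20) + 10" using t by (simp add: mult.commute)
    moreover have J: "J (reg s' 18) (reg s' 14) (reg s' 15)" using I by (simp add: I_def)
    moreover have "reg s' 14 = p + 2 * k \<or> reg s' 18 = k"
      using J calculation(1) by (auto simp: J_def)
    ultimately show "Q (1 + (1 + t)) s'"
      using I by (cases "reg s' 14 = p + 2 * k"; intro Q) (simp_all add: I_def J_def)
  qed
  moreover have "p < 2 ^ b" by (rule word) (use p(3) in linarith)
  ultimately show ?thesis by (simp add: find_period_def wp_simps rd p)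
qed

abbreviation parse_regs :: "nat set" where
  "parse_regs \<equiv> {14, 15, 16, 18, 19, 20, 21, 22, 24}"

text \<open>The third inequality is the reason for padding phrases to \<open>threshold k\<close>:
  trying all periods costs only a constant per symbol of a phrase.\<close>

lemma threshold_ge: "4 \<le> threshold k" "2 * k \<le> threshold k" "k * (10 * k + 20) \<le> 10 * threshold k"
  "k < threshold k"
proof -
  have "1 \<le> k" "1 \<le> k * k" using k_pos by simp_all
  then show "4 \<le> threshold k" unfolding threshold_def by linarith
  show "2 * k \<le> threshold k" "k * (10 * k + 20) \<le> 10 * threshold k" "k < threshold k"
    using k_pos by (simp_all add: threshold_def algebra_simps)
qed

text \<open>The search for a period, the scan of the run and the marking are each linear in the
  advance of register 19, which is at least \<open>threshold k\<close>; the factor 40 absorbs all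
  three.\<close>

lemma wp_parse_phrase:
  assumes r: "ready s" and regs: "reg s 8 = i" "reg s 11 = j" "reg s 17 = t" "reg s 19 = p"
      "reg s 20 = N" "reg s 24 = p + threshold k"
    and p: "i \<le> p" "p + threshold k \<le> t" "t \<le> length X" "N \<le> p" "j \<le> i + k"
    and Q: "\<And>tm s' a. agree parse_regs (reg s) (reg s') \<Longrightarrow> syms s' = syms s \<Longrightarrow>
      mem s' 2 = (mem s 2)(N := p) \<Longrightarrow> marks s' 0 = marks s 0 \<union> {p..<p + a} \<Longrightarrow>
      marks s' 1 = marks s 1 \<union> {j + (p - i)..<j + (p - i) + a} \<Longrightarrow>
      p + threshold k \<le> reg s' 19 \<Longrightarrow> reg s' 19 \<le> t \<Longrightarrow> p + a \<le> reg s' 19 \<Longrightarrow>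
      reg s' 24 = reg s' 19 + threshold k \<Longrightarrow>
      fragment_equiv k (slice X p (reg s' 19)) (kept X {p..<p + a} p (reg s' 19)) \<Longrightarrow>
      length (kept X {p..<p + a} p (reg s' 19)) \<le> threshold k + k \<Longrightarrow>
      reg s' 20 = Suc N \<and> aperiodic k (kept X {p..<p + a} p (reg s' 19)) \<or>
      reg s' 20 = N \<and> reg s' 19 = t \<Longrightarrow>
      tm \<le> 40 * (reg s' 19 - p) \<Longrightarrow> Q tm s'"
  shows "wp b parse_phrase Q s"
proof -
  let ?T = "threshold k"
  note rd = readyD[OF r]
  note T = threshold_ge
  have bounds: "p + k < 2 ^ b" "p + k + k < 2 ^ b"
    by (rule word, use p T in linarith)+
  show ?thesis
    unfolding parse_phrase_def
    apply (simp add: wp_simps regs rd bounds)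
    apply (rule wp_find_period[of _ p])
        apply (use r in \<open>simp add: ready_def\<close>)
       apply (simp add: regs)
      apply simp
     apply (use p T in simp)
    subgoal premises f for c1 s1
    proof -
      note ag = agreeD[OF f(1)]
      have regs1: "reg s1 3 = 1" "reg s1 7 = ?T" "reg s1 8 = i" "reg s1 11 = j" "reg s1 17 = t"
        "reg s1 19 = p" "reg s1 20 = N" "reg s1 22 = p + 2 * k" "reg s1 23 = 0" "reg s1 24 = p + ?T"
        using ag[of 3] ag[of 7] ag[of 8] ag[of 11] ag[of 17] ag[of 19] ag[of 20] ag[of 22] ag[of 23]
          ag[of 24] by (simp_all add: regs rd)
      have agr: "agree parse_regs (reg s) (reg s1)" using f(1) by (auto simp: agree_def)
      have sy: "syms s1 = syms s" "syms s 0 = sym_array X" using f(2) rd(9) by simp_all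
      have me: "mem s1 = (mem s)(2 := (mem s 2)(N := p))" using f(3) by simp
      have c1: "c1 \<le> 10 * ?T + 10" using f(5) T(3) by simp
      define q where "q = reg s1 18"
      have bounds1: "Suc N < 2 ^ b" "p + ?T < 2 ^ b" "p + ?T + ?T < 2 ^ b" "t < 2 ^ b"
        "t + ?T < 2 ^ b" "p < 2 ^ b"
        by (rule word, use p T large in linarith)+
      from f(4)[folded q_def] show ?thesis
      proof (elim disjE conjE)
        assume aper: "reg s1 14 \<noteq> p + 2 * k" "\<forall>q. 0 < q \<longrightarrow> q \<le> k \<longrightarrow>
            (\<exists>x. p + q \<le> x \<and> x < p + 2 * k \<and> sym_array X x \<noteq> sym_array X (x - q))"
        \<comment> \<open>Without a period in the window, the phrase has length exactly
          \<open>threshold k\<close> and nothing is deleted.\<close>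
        have ap: "aperiodic k (slice X p (p + ?T))"
        proof (rule aperiodic_sliceI)
          fix q assume "0 < q" "q \<le> k"
          from aper(2)[rule_format, OF this] obtain x where x: "p + q \<le> x" "x < p + 2 * k"
            "sym_array X x \<noteq> sym_array X (x - q)" by blast
          have "x < length X" using x(2) p T by linarith
          then show "\<exists>x\<ge>p + q. x < p + 2 * k \<and> X ! x \<noteq> X ! (x - q)"
            using x by (intro exI[of _ x]) (auto simp: sym_array_def split: if_splits)
        qed (use T in simp_all)
        show ?thesis
          using aper(1) bounds1
          apply (simp add: wp_simps regs1)
          apply (rule Q[where a = 0])
          using agr p T c1 ap
          by (simp_all add: sy me marks_def regs1)
      next
        assume per: "reg s1 14 = p + 2 * k" "0 < q" "q \<le> k" "reg s1 15 + q = p + 2 * k"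
          "\<forall>x. p + q \<le> x \<longrightarrow> x < p + 2 * k \<longrightarrow> sym_array X x = sym_array X (x - q)"
        note q = per(2,3)
        have b15: "reg s1 15 + t < 2 ^ b"
          by (rule word) (use per(4) p T large in linarith)
        show ?thesis
          using per(1) bounds1
          apply (simp add: wp_simps regs1 q_def[symmetric])
          apply (rule wp_extend_match)
             apply (simp add: regs1)
            apply (use p T in simp)
           apply (use b15 in simp)
          subgoal premises l for l c2
          proof -
            define e where "e = p + 2 * k + l"
            have e: "e \<le> t" "p + 2 * k \<le> e" using l by (simp_all add: e_def)
            have c2: "c2 \<le> 5 * l + 3" using l by simp
            \<comment> \<open>\<open>find_period\<close> leaves register 15 exactly \<open>q\<close>
              behind register 14, so the extension continues the comparison at the end of the
              window.\<close>
            have y: "reg s1 15 + u = p + 2 * k + u - q" for u using per(4) q(1) by linarith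
            have perX: "X ! x = X ! (x - q)" if "p + q \<le> x" "x < e" for x
            proof -
              have "sym_array X x = sym_array X (x - q)"
              proof (cases "x < p + 2 * k")
                case True
                then show ?thesis using per(5) that by simp
              next
                case False
                have "\<forall>u<l. sym_array X (p + 2 * k + u) = sym_array X (p + 2 * k + u - q)"
                  using l(6) by (simp add: sy y per(1))
                from this[rule_format, of "x - (p + 2 * k)"] show ?thesis
                  using False that(2) by (simp add: e_def)
              qed
              moreover have "x < length X" using that e p by linarith
              ultimately show ?thesis by (simp add: sym_array_def split: if_splits)
            qed
            have brk: "X ! e \<noteq> X ! (e - q)" if "e < t"
            proof -
              have "sym_array X (p + 2 * k + l) \<noteq> sym_array X (p + 2 * k + l - q)"
                using l(7) that by (simp add: sy y e_def per(1))
              moreover have "e < length X" using that p by linarith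
              ultimately show ?thesis by (auto simp: sym_array_def e_def split: if_splits)
            qed
            define a where "a = (e - p - ?T) div q * q"
            note run = periodic_run[OF perX q e(2) a_def]
            have run4: "e - (p + a) \<le> ?T + k" using run(4) q by linarith
            have a': "(e - (p + ?T)) div q * q = a" by (simp add: a_def)
            have le2: "(e - (p + ?T)) div q \<le> e" by (meson diff_le_self div_le_dividend le_trans)
            have be: "e < 2 ^ b" "(e - (p + ?T)) div q < 2 ^ b" "a < 2 ^ b" "p + a < 2 ^ b"
              "p + j + (p + a) < 2 ^ b" "Suc e < 2 ^ b" "e - p < 2 ^ b" "e - (p + ?T) < 2 ^ b"
              by (rule word, use p e run(1) le2 large in linarith)+
            have yy: "p + j - i = j + (p - i)" using p(1) by simp
            show ?thesis
              using bounds1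
              apply (simp add: wp_simps regs1 per(1) q_def[symmetric] e_def[symmetric] be a')
              apply (rule wp_mark[OF _ _ refl refl])
                apply (simp add: regs1)
               apply (use be in \<open>simp add: regs1\<close>)
              subgoal premises m for c3
              proof -
                have c3: "c3 \<le> 5 * a + 3" using m by simp
                show ?thesis
                proof (cases "e < t")
                  \<comment> \<open>The run is unbroken up to the end of the match: it is shortened
                    but forms no phrase, and \<open>N\<close> stays.\<close>
                  case False
                  then have et: "e = t" using e by simp
                  have "l \<le> t - p" "a \<le> t - p" "?T \<le> t - p" using run(1) p(2) et e_def by linarith+
                  then have tm: "c1 + c2 + c3 + 30 \<le> 40 * (t - p)" using c1 c2 c3 T(1) by linarith
                  have fin: "kept X {p..<p + a} p t = slice X (p + a) t" "p + a \<le> t"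
                    "fragment_equiv k (slice X p t) (slice X (p + a) t)" "t \<le> ?T + k + (p + a)"
                    using run(1,2,3) run4 unfolding et by simp_all
                  show ?thesis
                    using bounds1 be(2-7)
                    apply (simp add: wp_simps regs1 yy et)
                    apply (rule Q[where a = a])
                    using agr p(2) tm fin(2-4)
                    by (simp_all add: sy me marks_def regs1 marks_set_cells yy fin(1))
                next
                  case True
                  define p' where "p' = max (e + 1) (p + ?T)"
                  note br = broken_run[OF perX q e(2) a_def brk[OF True] p'_def]
                  have p': "p' \<le> t" "p + ?T \<le> p'" "e < p'" using True p by (auto simp: p'_def)
                  have "l \<le> p' - p" "a \<le> p' - p" "?T \<le> p' - p"
                    using br(1) p' e_def by linarith+
                  then have tm: "c1 + c2 + c3 + 30 \<le> 40 * (p' - p)" using c1 c2 c3 T(1) by linarith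
                  show ?thesis
                  proof (cases "Suc e < p + ?T")
                    case lt: True
                    then have pe: "p' = p + ?T" by (simp add: p'_def)
                    show ?thesis
                      using True lt bounds1 be
                      apply (simp add: wp_simps regs1 yy)
                      apply (rule Q[where a = a])
                      using agr p(2) tm br p' unfolding pe
                      by (simp_all add: sy me marks_def regs1 marks_set_cells yy)
                  next
                    case ge: False
                    then have pe: "p' = Suc e" by (simp add: p'_def)
                    have be2: "Suc (e + ?T) < 2 ^ b"
                      by (rule word) (use p e large in linarith)
                    show ?thesis
                      using True ge bounds1 be be2
                      apply (simp add: wp_simps regs1 yy)
                      apply (rule Q[where a = a])
                      using agr p(2) tm br p' unfolding pe
                      by (simp_all add: sy me marks_def regs1 marks_set_cells yy)
                  qed
                qed
              qed
              done
          qed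
          done
      qed
    qed
    done
qed

end

text \<open>All of \<open>[s0, p)\<close> is parsed, except possibly, if \<open>p = t\<close>, for an unbroken periodic run at
  the end.\<close>

definition parse_inv ::
    "nat \<Rightarrow> 'a list \<Rightarrow> nat \<Rightarrow> nat \<Rightarrow> nat set \<Rightarrow> (nat \<Rightarrow> nat) \<Rightarrow> nat \<Rightarrow> nat \<Rightarrow> bool" where
  "parse_inv k X s0 t D S N p \<longleftrightarrow> (\<exists>D1 D2 p1. D = D1 \<union> D2 \<and> parsed k X D1 S s0 N p1 \<and> p1 \<le> p \<and>
     D2 \<subseteq> {p1..<p} \<and> (p1 = p \<or> p = t) \<and> fragment_equiv k (slice X p1 p) (kept X D2 p1 p) \<and>
     length (kept X D2 p1 p) \<le> threshold k + k)"

lemma parsed_imp_inv: "parsed k X D S s0 N p \<Longrightarrow> parse_inv k X s0 t D S N p"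
  unfolding parse_inv_def by (intro exI[of _ D] exI[of _ "{}"] exI[of _ p]) simp

lemma parse_inv_parsed:
  assumes "parse_inv k X s0 t D S N p" "p < t"
  shows "parsed k X D S s0 N p"
  using assms unfolding parse_inv_def by auto

lemma parsed_cong:
  "parsed k X D S s0 N p \<Longrightarrow> (\<And>q. q < N \<Longrightarrow> S' q = S q) \<Longrightarrow> parsed k X D S' s0 N p"
  unfolding parsed_def by auto

lemma parse_inv_remainder:
  assumes "parsed k X D S s0 N p" "p \<le> t" "D' \<subseteq> {p..<t}"
    "fragment_equiv k (slice X p t) (kept X D' p t)" "length (kept X D' p t) \<le> threshold k + k"
  shows "parse_inv k X s0 t (D \<union> D') S N t"
  unfolding parse_inv_def using assms by (intro exI[of _ D] exI[of _ D'] exI[of _ p]) simp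

lemma parse_inv_cuts:
  assumes "parse_inv k X s0 t D S N p" "q < N"
  shows "s0 \<le> S q" "S q \<le> p"
  using assms unfolding parse_inv_def parsed_def by (auto intro: order_trans)

text \<open>What follows the last phrase is either an unbroken run, already shortened, or fewer than
  \<open>threshold k\<close> symbols, which are kept. In both cases it obeys the length bound of a
  phrase.\<close>

lemma parse_inv_finish:
  assumes inv: "parse_inv k X s0 t D S N p" and p: "p \<le> t" "t < p + threshold k"
    and M: "M = (if 2 * k + 2 < N then {S (Suc k)..<S (N - Suc k)} else {})"
  shows "D \<union> M \<subseteq> {s0..<t}" "fragment_equiv k (slice X s0 t) (kept X (D \<union> M) s0 t)"
    "length (kept X (D \<union> M) s0 t) \<le> (2 * k + 3) * (threshold k + k)"
proof -
  have "\<exists>D1 D2 p1. D = D1 \<union> D2 \<and> parsed k X D1 S s0 N p1 \<and> p1 \<le> t \<and> D2 \<subseteq> {p1..<t} \<and>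
     fragment_equiv k (slice X p1 t) (kept X D2 p1 t) \<and> length (kept X D2 p1 t) \<le> threshold k + k"
  proof (cases "p = t")
    case True
    with inv show ?thesis unfolding parse_inv_def by blast
  next
    case False
    then have "parsed k X D S s0 N p" using parse_inv_parsed[OF inv] p(1) by simp
    then show ?thesis using p by (intro exI[of _ D] exI[of _ "{}"] exI[of _ p]) simp
  qed
  then obtain D1 D2 p1 where d: "D = D1 \<union> D2" "parsed k X D1 S s0 N p1" "p1 \<le> t" "D2 \<subseteq> {p1..<t}"
     "fragment_equiv k (slice X p1 t) (kept X D2 p1 t)" "length (kept X D2 p1 t) \<le> threshold k + k"
    by blast
  note f = parsed_finish[OF d(2-6) M]
  have "D1 \<subseteq> {s0..<p1}" "s0 \<le> p1" using d(2) by (simp_all add: parsed_def)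
  with f(1) d(1,3,4) show "D \<union> M \<subseteq> {s0..<t}" by auto
  show "fragment_equiv k (slice X s0 t) (kept X (D \<union> M) s0 t)"
    "length (kept X (D \<union> M) s0 t) \<le> (2 * k + 3) * (threshold k + k)"
    using f(2,3) by (simp_all only: d(1))
qed

definition cut_middle :: com where
  "cut_middle = block
     [Arith Add 21 2 3, Arith Add 22 21 21,
      Cond (Less 22 20) (block [Load 14 2 21, Arith Sub 21 20 21, Load 16 2 21, mark]) Skip]"

definition parse :: com where
  "parse = block
     [Arith Add 19 8 2, move 20 23, Arith Add 24 19 7,
      While (Neg (Less 17 24)) parse_phrase, cut_middle]"

lemma image_shift_interval:
  assumes "s \<le> (p::nat)"
  shows "(\<lambda>x. s' + (x - s)) ` {p..<p + a} = {s' + (p - s)..<s' + (p - s) + a}"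
proof (intro equalityI subsetI)
  fix y assume y: "y \<in> {s' + (p - s)..<s' + (p - s) + a}"
  then show "y \<in> (\<lambda>x. s' + (x - s)) ` {p..<p + a}"
    using assms by (intro image_eqI[of _ _ "y + s - s'"]) auto
qed (use assms in auto)

context ram_input
begin

lemma wp_parse:
  assumes r: "ready s" and regs: "reg s 8 = i" "reg s 11 = j" "reg s 17 = t"
    and t: "i + k \<le> t" "t \<le> length X" "j \<le> i + k"
    and Q: "\<And>tm s' D. agree parse_regs (reg s) (reg s') \<Longrightarrow> syms s' = syms s \<Longrightarrow>
      D \<subseteq> {i + k..<t} \<Longrightarrow> marks s' 0 = marks s 0 \<union> D \<Longrightarrow>
      marks s' 1 = marks s 1 \<union> (\<lambda>x. j + k + (x - (i + k))) ` D \<Longrightarrow>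
      fragment_equiv k (slice X (i + k) t) (kept X D (i + k) t) \<Longrightarrow>
      length (kept X D (i + k) t) \<le> (2 * k + 3) * (threshold k + k) \<Longrightarrow>
      tm \<le> 50 * (t - i) + 50 \<Longrightarrow> Q tm s'"
  shows "wp b parse Q s"
proof -
  let ?T = "threshold k" and ?f = "\<lambda>x. j + k + (x - (i + k))"
  note rd = readyD[OF r] and T = threshold_ge
  define I :: "'a state \<Rightarrow> bool" where "I = (\<lambda>s'. agree parse_regs (reg s) (reg s') \<and>
    syms s' = syms s \<and> i + k \<le> reg s' 19 \<and> reg s' 19 \<le> t \<and> reg s' 20 \<le> reg s' 19 \<and>
    reg s' 24 = reg s' 19 + ?T \<and>
    (\<exists>D. marks s' 0 = marks s 0 \<union> D \<and> marks s' 1 = marks s 1 \<union> ?f ` D \<and>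
       parse_inv k X (i + k) t D (mem s' 2) (reg s' 20) (reg s' 19)))"
  let ?V = "\<lambda>s'. 45 * (t - reg s' 19)"
  let ?s0 = "s\<lparr>reg := (reg s)(19 := i + k, 20 := 0, 24 := i + k + ?T)\<rparr>"
  have "wp b (While (Neg (Less 17 24)) parse_phrase)
      (\<lambda>tm s'. wp b cut_middle (\<lambda>tm'. Q (1 + (1 + (1 + (tm + tm'))))) s') ?s0"
  proof (rule wp_While[where I = I and V = ?V])
    show "I ?s0"
      using t by (auto simp: I_def marks_def intro!: exI[of _ "{}"] parsed_imp_inv parsed_0)
  next
    fix s' assume I: "I s'" and tv: "test_val (Neg (Less 17 24)) s'"
    then obtain D where D: "marks s' 0 = marks s 0 \<union> D" "marks s' 1 = marks s 1 \<union> ?f ` D"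
      "parse_inv k X (i + k) t D (mem s' 2) (reg s' 20) (reg s' 19)" by (auto simp: I_def)
    define p N where "p = reg s' 19" and "N = reg s' 20"
    note pN = p_def[symmetric] N_def[symmetric]
    have ag: "agree parse_regs (reg s) (reg s')" "syms s' = syms s" "i + k \<le> p" "N \<le> p"
      "reg s' 24 = p + ?T" using I by (simp_all add: I_def p_def N_def)
    have "ready s'" by (rule ready_agree[OF r ag(1,2)]) simp
    have regs': "reg s' 8 = i" "reg s' 11 = j" "reg s' 17 = t"
      using agreeD[OF ag(1), of 8] agreeD[OF ag(1), of 11] agreeD[OF ag(1), of 17] by (simp_all add: regs)
    have pt: "p + ?T \<le> t" using tv by (simp add: regs' ag)
    have ps: "parsed k X D (mem s' 2) (i + k) N p"
      using parse_inv_parsed[OF D(3)] pt T(1) by (simp add: pN)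
    have sh: "?f ` {p..<p + a} = {j + (p - i)..<j + (p - i) + a}" for a
    proof -
      have "j + k + (p - (i + k)) = j + (p - i)" using ag(3) by simp
      then show ?thesis by (simp only: image_shift_interval[OF ag(3), of "j + k" a])
    qed
    show "wp b parse_phrase (\<lambda>tm s''. I s'' \<and> test_cost (Neg (Less 17 24)) + tm + ?V s'' \<le> ?V s') s'"
    proof (rule wp_parse_phrase[OF \<open>ready s'\<close> regs' p_def[symmetric] N_def[symmetric] ag(5) _ pt t(2) ag(4) t(3)])
      show "i \<le> p" using ag(3) by simp
      fix tm s'' a
      assume h: "agree parse_regs (reg s') (reg s'')" "syms s'' = syms s'" "mem s'' 2 = (mem s' 2)(N := p)"
        "marks s'' 0 = marks s' 0 \<union> {p..<p + a}"
        "marks s'' 1 = marks s' 1 \<union> {j + (p - i)..<j + (p - i) + a}"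
        "p + ?T \<le> reg s'' 19" "reg s'' 19 \<le> t" "p + a \<le> reg s'' 19" "reg s'' 24 = reg s'' 19 + ?T"
        "fragment_equiv k (slice X p (reg s'' 19)) (kept X {p..<p + a} p (reg s'' 19))"
        "length (kept X {p..<p + a} p (reg s'' 19)) \<le> ?T + k"
        "reg s'' 20 = Suc N \<and> aperiodic k (kept X {p..<p + a} p (reg s'' 19)) \<or> reg s'' 20 = N \<and> reg s'' 19 = t"
        "tm \<le> 40 * (reg s'' 19 - p)"
      define p' where "p' = reg s'' 19"
      have sub: "{p..<p + a} \<subseteq> {p..<p'}" using h(8) by (auto simp: p'_def)
      have "parse_inv k X (i + k) t (D \<union> {p..<p + a}) (mem s'' 2) (reg s'' 20) p'"
        using h(12)
      proof (elim disjE conjE)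
        assume a: "reg s'' 20 = Suc N" "aperiodic k (kept X {p..<p + a} p (reg s'' 19))"
        show ?thesis
          unfolding a(1)
          by (rule parsed_imp_inv, rule parsed_Suc[OF ps])
            (use h a(2) sub in \<open>simp_all add: p'_def\<close>)
      next
        assume a: "reg s'' 20 = N" "reg s'' 19 = t"
        have p't: "p' = t" using a(2) by (simp add: p'_def)
        show ?thesis
          unfolding a(1) p't
          by (rule parse_inv_remainder[OF parsed_cong[OF ps]]) (use h pt sub a(2) in \<open>simp_all add: p't\<close>)
      qed
      moreover have "marks s'' 0 = marks s 0 \<union> (D \<union> {p..<p + a})" using h(4) D(1) by auto
      moreover have "marks s'' 1 = marks s 1 \<union> ?f ` (D \<union> {p..<p + a})"
        unfolding image_Un sh using h(5) D(2) by auto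
      moreover have "agree parse_regs (reg s) (reg s'')" by (rule agree_trans[OF ag(1) h(1)]) simp
      moreover have "reg s'' 20 \<le> p'" "i + k \<le> p'" "p' \<le> t"
        using h(6,7,12) ag(3,4) T(1) by (auto simp: p'_def)
      ultimately have "I s''" unfolding I_def using h(2,9) ag(2) by (auto simp: p'_def)
      moreover have "2 + tm + 45 * (t - p') \<le> 45 * (t - p)"
        using h(6,7,13) T(1) unfolding p'_def[symmetric] by linarith
      ultimately show "I s'' \<and> test_cost (Neg (Less 17 24)) + tm + ?V s'' \<le> ?V s'"
        by (simp add: p'_def p_def)
    qed
  next
    fix tm s' assume I: "I s'" and ntv: "\<not> test_val (Neg (Less 17 24)) s'"
      and tm: "tm + ?V s' \<le> ?V ?s0 + test_cost (Neg (Less 17 24))"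
    then obtain D where D: "marks s' 0 = marks s 0 \<union> D" "marks s' 1 = marks s 1 \<union> ?f ` D"
      "parse_inv k X (i + k) t D (mem s' 2) (reg s' 20) (reg s' 19)" by (auto simp: I_def)
    define p N S where "p = reg s' 19" and "N = reg s' 20" and "S = mem s' 2"
    have ag: "agree parse_regs (reg s) (reg s')" "syms s' = syms s" "p \<le> t" "N \<le> p"
      "reg s' 24 = p + ?T" using I by (simp_all add: I_def p_def N_def)
    have regs': "reg s' 8 = i" "reg s' 11 = j" "reg s' 17 = t" "reg s' 2 = k" "reg s' 3 = 1"
      "reg s' 20 = N" "mem s' 2 = S"
      using agreeD[OF ag(1), of 8] agreeD[OF ag(1), of 11] agreeD[OF ag(1), of 17]
        agreeD[OF ag(1), of 2] agreeD[OF ag(1), of 3] by (simp_all add: regs rd N_def S_def)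
    have pt: "t < p + ?T" using ntv by (simp add: regs' ag)
    have inv: "parse_inv k X (i + k) t D S N p" using D(3) by (simp add: p_def N_def S_def)
    define M where "M = (if 2 * k + 2 < N then {S (Suc k)..<S (N - Suc k)} else {})"
    note fin = parse_inv_finish[OF inv ag(3) pt M_def]
    have bounds: "Suc k < 2 ^ b" "Suc (Suc (k + k)) < 2 ^ b" "N < 2 ^ b"
      by (rule word, use large T t ag in linarith)+
    have tm': "tm \<le> 45 * (t - i) + 2" using tm by simp
    show "wp b cut_middle (\<lambda>tm'. Q (1 + (1 + (1 + (tm + tm'))))) s'"
    proof (cases "2 * k + 2 < N")
      case False
      then have "M = {}" by (simp add: M_def)
      show ?thesis
        using False bounds
        apply (simp add: cut_middle_def wp_simps regs')
        apply (rule Q[where D = D])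
        using ag(1,2) fin D(1,2) tm' unfolding \<open>M = {}\<close>
        by (simp_all add: marks_def)
    next
      case True
      define A B where "A = S (Suc k)" and "B = S (N - Suc k)"
      have AB: "i + k \<le> A" "A \<le> t" "i + k \<le> B" "B \<le> t"
        using parse_inv_cuts[OF inv, of "Suc k"] parse_inv_cuts[OF inv, of "N - Suc k"] True ag(3)
        by (auto simp: A_def B_def)
      have M: "M = {A..<A + (B - A)}" using True by (auto simp: M_def A_def B_def)
      have sh: "?f ` M = {A + j - i..<A + j - i + (B - A)}"
      proof -
        have "j + k + (A - (i + k)) = A + j - i" using AB(1) by simp
        then show ?thesis by (simp only: M image_shift_interval[OF AB(1), of "j + k" "B - A"])
      qed
      have bm: "A + j + B < 2 ^ b" "N - Suc k < 2 ^ b"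
        by (rule word, use large T t AB ag in linarith)+
      show ?thesis
        using True bounds bm(2)
        apply (simp add: cut_middle_def wp_simps regs' A_def[symmetric] B_def[symmetric])
        apply (rule wp_mark[OF _ _ refl refl])
          apply (simp add: regs')
         apply (use bm(1) in \<open>simp add: regs'\<close>)
        subgoal premises m for c
        proof -
          have c: "c \<le> 5 * (t - i) + 3" using m AB by simp
          show ?thesis
            apply (rule Q[where D = "D \<union> M"])
            using ag(1,2) fin D(1,2) tm' c
            by (simp_all add: marks_def regs' marks_set_cells M[symmetric] sh[symmetric] image_Un Un_assoc)
        qed
        done
    qed
  qed
  moreover have "i + k < 2 ^ b" "i + k + ?T < 2 ^ b"
    by (rule word, use large t in linarith)+
  ultimately show ?thesis by (simp add: parse_def wp_simps rd regs)
qed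

end

section \<open>One strip of the greedy matching\<close>

definition consume :: com where
  "consume = block
     [Cond (Equal 12 23) (Arith Add 8 8 2) (block [best, parse, Arith Add 8 17 3]),
      increment 9, Arith Add 22 8 2]"

definition strip :: com where
  "strip = block [scan, consume]"

context ram_input
begin

text \<open>Symbols of \<open>X\<close> that one strip may keep: the shortened part of the match,
  its exempt first \<open>k\<close> symbols, and the mismatch behind it.\<close>

definition strip_bound :: nat where
  "strip_bound = (2 * k + 3) * (threshold k + k) + k + 1"

text \<open>A match that ends with \<open>X\<close> has no mismatch behind it; register 8 then
  becomes \<open>Suc (length X)\<close> and no edit is claimed, whence the guard on
  \<open>edit_progress\<close>. The last conjunct bounds the symbols kept so far.\<close>

definition strip_inv :: "'a state \<Rightarrow> bool" where
  "strip_inv s \<longleftrightarrow> ready s \<and> reg s 22 = reg s 8 + k \<and> reg s 8 \<le> Suc (length X) \<and> reg s 9 \<le> Suc k \<and>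
     marks s 0 \<subseteq> {..<reg s 8} \<and> marks s 0 \<subseteq> {..<length X} \<and>
     marks s 1 \<subseteq> {..<reg s 8 + hi} \<and> marks s 1 \<subseteq> {..<length Y} \<and> card (marks s 0) = card (marks s 1) \<and>
     kernel_equiv k X Y (kept X (marks s 0) 0 (length X)) (kept Y (marks s 1) 0 (length Y)) \<and>
     (reg s 8 \<le> length X \<longrightarrow> edit_progress k X Y (reg s 8) (reg s 9)) \<and>
     reg s 8 \<le> card (marks s 0) + reg s 9 * strip_bound"

text \<open>Each symbol of \<open>X\<close> pays for \<open>best\<close> and \<open>parse\<close>
  (15 + 50 units), and each strip for \<open>scan\<close> and the additive constants.\<close>

definition strip_potential :: "'a state \<Rightarrow> nat" where
  "strip_potential s = 70 * (Suc (length X) - reg s 8) + 250 * (k * k) * (Suc k - reg s 9)"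

lemma wp_strip:
  assumes inv: "strip_inv s" and i: "reg s 8 + k \<le> length X" and c: "reg s 9 \<le> k"
  shows "wp b strip (\<lambda>t s'. strip_inv s' \<and> 5 + t + strip_potential s' \<le> strip_potential s) s"
proof -
  define i c where "i = reg s 8" and "c = reg s 9"
  have r: "ready s" and M: "marks s 0 \<subseteq> {..<i}" "marks s 0 \<subseteq> {..<length X}"
    "marks s 1 \<subseteq> {..<i + hi}" "marks s 1 \<subseteq> {..<length Y}" "card (marks s 0) = card (marks s 1)"
    and ke: "kernel_equiv k X Y (kept X (marks s 0) 0 (length X)) (kept Y (marks s 1) 0 (length Y))"
    and ep: "edit_progress k X Y i c" and size: "i \<le> card (marks s 0) + c * strip_bound"
    and ik: "i + k \<le> length X" and ck: "c \<le> k"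
    using inv assms(2,3) by (simp_all add: strip_inv_def i_def c_def)
  note rd = readyD[OF r]
  have kk: "1 \<le> k * k" "k \<le> k * k" using k_pos by simp_all
  have scan_time: "(k + 1) * (5 * k + 20) + 10 \<le> 60 * (k * k)"
  proof -
    have "(k + 1) * (5 * k + 20) + 10 = 5 * (k * k) + 25 * k + 30" by (simp add: algebra_simps)
    then show ?thesis using kk by linarith
  qed
  have pot: "5 + t + strip_potential s' \<le> strip_potential s"
    if "reg s' 8 = i'" "reg s' 9 = Suc c" "i' \<le> Suc (length X)" "i \<le> i'"
      "t \<le> 70 * (i' - i) + 240 * (k * k)" for s' i' t
  proof -
    have "Suc k - c = Suc (k - c)" using ck by simp
    then have "250 * (k * k) * (Suc k - c) = 250 * (k * k) * (k - c) + 250 * (k * k)" by simp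
    then show ?thesis using that kk(1)
      unfolding strip_potential_def that i_def[symmetric] c_def[symmetric] diff_Suc_Suc by linarith
  qed
  have bounds: "i + k < 2 ^ b" "Suc c < 2 ^ b" "i + k + k < 2 ^ b" "Suc (length X) < 2 ^ b"
    "Suc (length X) + k < 2 ^ b"
    by (rule word, use ik ck large in linarith)+
  let ?P = "\<lambda>t s'. strip_inv s' \<and> 5 + t + strip_potential s' \<le> strip_potential s"
  have "wp b scan (\<lambda>t s'. wp b consume (\<lambda>t'. ?P (t + t')) s') s"
  proof (rule wp_scan[OF r i_def[symmetric] ik])
    fix t1 and s1 :: "'a state"
    assume s1: "agree scan_regs (reg s) (reg s1)" "syms s1 = syms s" "mem s1 = mem s"
      and res: "reg s1 12 = 0 \<and> (\<forall>j. in_band i j \<longrightarrow> \<not> matches X Y i j k) \<or>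
      reg s1 12 = 1 \<and> in_band i (reg s1 10) \<and> in_band i (reg s1 11) \<and>
      matches X Y i (reg s1 10) k \<and> matches X Y i (reg s1 11) k \<and>
      (\<forall>j. in_band i j \<longrightarrow> matches X Y i j k \<longrightarrow> reg s1 10 \<le> j \<and> j \<le> reg s1 11)"
      and t1: "t1 \<le> (k + 1) * (5 * k + 20) + 10"
    have ready1: "ready s1" by (rule ready_agree[OF r s1(1,2)]) simp
    note rd1 = readyD[OF this]
    have regs1: "reg s1 8 = i" "reg s1 9 = c"
      using agreeD[OF s1(1), of 8] agreeD[OF s1(1), of 9] by (simp_all add: i_def c_def)
    have marks1: "marks s1 A = marks s A" for A by (simp add: marks_def s1(3))
    have no_match: "edit_progress k X Y i' (Suc c)"
      if "i \<le> i'" "i' \<le> length X" "\<And>j. in_band i j \<Longrightarrow> \<not> matches X Y i j (i' - i)" for i'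
      by (rule edit_progress_step[OF ep that(1,2)]) (use that in \<open>simp add: in_band_iff\<close>)
    from res show "wp b consume (\<lambda>t'. ?P (t1 + t')) s1"
    proof (elim disjE conjE)
      \<comment> \<open>If no diagonal matches \<open>k\<close> symbols, these symbols form a strip
        that costs an edit and is kept entirely.\<close>
      assume a: "reg s1 12 = 0" "\<forall>j. in_band i j \<longrightarrow> \<not> matches X Y i j k"
      define s2 where "s2 = s1\<lparr>reg := (reg s1)(8 := i + k, 9 := Suc c, 22 := i + k + k)\<rparr>"
      have m2: "marks s2 A = marks s A" for A by (simp add: s2_def marks_def s1(3))
      have "ready s2" by (rule ready_agree[OF ready1, of "{8, 9, 22}"]) (simp_all add: s2_def)
      moreover have "edit_progress k X Y (i + k) (Suc c)"
        by (rule no_match) (use ik a(2) in simp_all)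
      moreover have "k \<le> strip_bound" by (simp add: strip_bound_def)
      moreover have "{..<i} \<subseteq> {..<i + k}" "{..<i + hi} \<subseteq> {..<i + k + hi}" by auto
      ultimately have "strip_inv s2"
        unfolding strip_inv_def m2 using M ke size ik ck by (auto simp: s2_def)
      moreover have "5 + (t1 + 5) + strip_potential s2 \<le> strip_potential s"
        by (rule pot[of _ "i + k"]) (use ik t1 scan_time kk in \<open>simp_all add: s2_def\<close>)
      ultimately show ?thesis
        using a(1) bounds by (simp add: consume_def wp_simps rd1 regs1 s2_def)
    next
      assume a: "reg s1 12 = 1" "in_band i (reg s1 10)" "in_band i (reg s1 11)"
        "matches X Y i (reg s1 10) k" "matches X Y i (reg s1 11) k"
        "\<forall>j. in_band i j \<longrightarrow> matches X Y i j k \<longrightarrow> reg s1 10 \<le> j \<and> j \<le> reg s1 11"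
      have "wp b best (\<lambda>t s'. wp b parse (\<lambda>t' s'. \<forall>t''. t'' \<le> 10 \<longrightarrow>
          ?P (t1 + (t + t' + t'')) (s'\<lparr>reg := (reg s')(8 := Suc (reg s' 17), 9 := Suc (reg s' 9),
            22 := Suc (reg s' 17) + k)\<rparr>) \<and> ready s' \<and> reg s' 17 \<le> length X \<and> reg s' 9 = c) s') s1"
      proof (rule wp_best[OF ready1 regs1(1) ik a(2,4,3,5,6)])
        fix t2 and s2 :: "'a state"
        define j t where "j = reg s2 11" and "t = reg s2 17"
        assume s2: "agree {11, 14, 15, 16, 17, 21} (reg s1) (reg s2)" "syms s2 = syms s1" "mem s2 = mem s1"
          and "in_band i (reg s2 11)" "i + k \<le> reg s2 17" "reg s2 17 \<le> length X"
            "matches X Y i (reg s2 11) (reg s2 17 - i)"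
          and "\<And>j. in_band i j \<Longrightarrow> reg s2 17 < length X \<Longrightarrow> \<not> matches X Y i j (Suc (reg s2 17) - i)"
            "t2 \<le> 15 * (reg s2 17 - i) + 40"
        then have jt: "in_band i j" "i + k \<le> t" "t \<le> length X" "matches X Y i j (t - i)"
          and mis: "\<And>j. in_band i j \<Longrightarrow> t < length X \<Longrightarrow> \<not> matches X Y i j (Suc t - i)"
          and t2: "t2 \<le> 15 * (t - i) + 40" unfolding j_def t_def by blast+
        have ready2: "ready s2" by (rule ready_agree[OF ready1 s2(1,2)]) simp
        have regs2: "reg s2 8 = i" "reg s2 9 = c"
          using agreeD[OF s2(1), of 8] agreeD[OF s2(1), of 9] regs1 by simp_all
        have marks2: "marks s2 A = marks s A" for A by (simp add: marks_def s1(3) s2(3))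
        have jik: "j \<le> i + k" using jt(1) lo_hi by (simp add: in_band_def)
        show "wp b parse (\<lambda>t' s'. \<forall>t''. t'' \<le> 10 \<longrightarrow>
          ?P (t1 + (t2 + t' + t'')) (s'\<lparr>reg := (reg s')(8 := Suc (reg s' 17), 9 := Suc (reg s' 9),
            22 := Suc (reg s' 17) + k)\<rparr>) \<and> ready s' \<and> reg s' 17 \<le> length X \<and> reg s' 9 = c) s2"
        proof (rule wp_parse[OF ready2 regs2(1) j_def[symmetric] t_def[symmetric] jt(2,3) jik])
          fix t3 D and s3 :: "'a state"
          assume s3: "agree parse_regs (reg s2) (reg s3)" "syms s3 = syms s2"
            and D: "D \<subseteq> {i + k..<t}" "marks s3 0 = marks s2 0 \<union> D"
              "marks s3 1 = marks s2 1 \<union> (\<lambda>x. j + k + (x - (i + k))) ` D"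
              "fragment_equiv k (slice X (i + k) t) (kept X D (i + k) t)"
              "length (kept X D (i + k) t) \<le> (2 * k + 3) * (threshold k + k)"
            and t3: "t3 \<le> 50 * (t - i) + 50"
          have ready3: "ready s3" by (rule ready_agree[OF ready2 s3]) simp
          have regs3: "reg s3 17 = t" "reg s3 9 = c"
            using agreeD[OF s3(1), of 17] agreeD[OF s3(1), of 9] regs2 by (simp_all add: t_def)
          define l where "l = t - (i + k)"
          have tl: "t = i + k + l" using jt(2) by (simp add: l_def)
          define D' where "D' = (\<lambda>x. j + k + (x - (i + k))) ` D"
          have jm: "j + k + l \<le> length Y"
            using matches_bound[OF jt(4)] jt(2,3) k_pos by (simp add: tl)
          have match: "matches X Y (i + k) (j + k) l"
            using jt(4) unfolding matches_def tl by (auto dest: spec[of _ "k + _"] simp: add.assoc)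
          have "in_band t (j + k + l)" using jt(1) by (simp add: in_band_def tl)
          then have "absdiff t (j + k + l) + absdiff (length X - t) (length Y - (j + k + l)) \<le> k"
            using in_band_iff[OF jt(3) jm] by simp
          then have band: "absdiff (i + k) (j + k) + absdiff (length X - (i + k + l)) (length Y - (j + k + l)) \<le> k"
            by (simp add: absdiff_def tl)
          \<comment> \<open>The purpose of the exempt symbols: earlier marks in \<open>Y\<close> lie
            before \<open>i + hi\<close>, new ones start at \<open>j + k\<close>, and
            \<open>lo + hi \<le> k\<close> separates them on any two diagonals of the band.\<close>
          have hij: "i + hi \<le> j + k" using jt(1) lo_hi by (simp add: in_band_def)
          have Mi: "marks s 0 \<subseteq> {..<i + k}" "marks s 1 \<subseteq> {..<j + k}" using M(1,3) hij by auto
          note km = kernel_equiv_marks[OF ke Mi M(5) _ jm match band D(1)[unfolded tl] D'_def D(4)[unfolded tl]]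
          have tX: "i + k + l \<le> length X" using jt(3) tl by simp
          note km = km[OF tX]
          have marks3: "marks s3 0 = marks s 0 \<union> D" "marks s3 1 = marks s 1 \<union> D'"
            unfolding D(2,3) marks2 D'_def by (rule refl)+
          have D'sub: "D' \<subseteq> {j + k..<j + k + l}"
            using image_mono[OF D(1)[unfolded tl], of "\<lambda>x. j + k + (x - (i + k))"]
              image_shift_interval[of "i + k" "i + k" "j + k" l] by (simp add: D'_def)
          define s4 where "s4 = s3\<lparr>reg := (reg s3)(8 := Suc t, 9 := Suc c, 22 := Suc t + k)\<rparr>"
          have m4: "marks s4 A = marks s3 A" for A by (simp add: s4_def marks_def)
          have r4: "ready s4" by (rule ready_agree[OF ready3, of "{8, 9, 22}"]) (simp_all add: s4_def)
          have "card D + length (kept X D (i + k) t) = l"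
            using length_kept_interval[OF D(1), of X] by (simp add: l_def)
          then have size4: "Suc t \<le> card (marks s 0 \<union> D) + Suc c * strip_bound"
            using D(5) size km(3) by (simp add: strip_bound_def tl)
          \<comment> \<open>By maximality over the band, no diagonal matches the strip once the
            mismatch at \<open>t\<close> is included.\<close>
          have ep4: "edit_progress k X Y (Suc t) (Suc c)" if "Suc t \<le> length X"
            by (rule no_match) (use that jt(2) mis in simp_all)
          have subs: "marks s 0 \<union> D \<subseteq> {..<Suc t}" "marks s 0 \<union> D \<subseteq> {..<length X}"
            "marks s 1 \<union> D' \<subseteq> {..<Suc t + hi}" "marks s 1 \<union> D' \<subseteq> {..<length Y}"
          proof -
            have "j \<le> i + hi" using jt(1) by (simp add: in_band_def)
            then show "marks s 1 \<union> D' \<subseteq> {..<Suc t + hi}" using M(3) D'sub by (fastforce simp: tl)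
            show "marks s 1 \<union> D' \<subseteq> {..<length Y}" using M(4) D'sub jm by fastforce
            show "marks s 0 \<union> D \<subseteq> {..<Suc t}" "marks s 0 \<union> D \<subseteq> {..<length X}"
              using M(1,2) D(1) jt(2,3) by fastforce+
          qed
          have "strip_inv s4"
            unfolding strip_inv_def m4 marks3 using subs km(1,2) r4 ck jt(3) ep4 size4
            by (simp add: s4_def)
          moreover have "5 + (t1 + (t2 + t3 + t'')) + strip_potential s4 \<le> strip_potential s"
            if "t'' \<le> 10" for t''
            by (rule pot[of _ "Suc t"])
              (use that jt(2,3) t1 t2 t3 scan_time kk in \<open>simp_all add: s4_def\<close>)
          ultimately show "\<forall>t''. t'' \<le> 10 \<longrightarrow>
            ?P (t1 + (t2 + t3 + t'')) (s3\<lparr>reg := (reg s3)(8 := Suc (reg s3 17), 9 := Suc (reg s3 9),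
              22 := Suc (reg s3 17) + k)\<rparr>) \<and> ready s3 \<and> reg s3 17 \<le> length X \<and> reg s3 9 = c"
            using ready3 jt(3) by (simp add: regs3 s4_def)
        qed
      qed
      note main = this
      show ?thesis
        apply (simp add: consume_def wp_simps a(1) rd1)
        apply (rule wp_mono[OF main])
        apply (erule wp_mono)
        subgoal premises h for t s2 t' s3
        proof -
          have "(4::nat) \<le> 10" by simp
          from h[rule_format, OF this] have h4: "?P (t1 + (t + t' + 4)) (s3\<lparr>reg := (reg s3)(8 := Suc (reg s3 17),
              9 := Suc (reg s3 9), 22 := Suc (reg s3 17) + k)\<rparr>)"
            and s3: "ready s3" "reg s3 17 \<le> length X" "reg s3 9 = c" by blast+
          have "Suc (reg s3 17) < 2 ^ b" "Suc (reg s3 17) + k < 2 ^ b"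
            using s3(2) bounds(4,5) by linarith+
          then show ?thesis using h4 bounds(2) by (simp add: readyD[OF s3(1)] s3(3) add_ac)
        qed
        done
    qed
  qed
  then show ?thesis by (simp only: strip_def block.simps wp_Seq)
qed

end

text \<open>Symbols cannot be created, so the far pair is a prefix of length \<open>k + 1\<close> of
  a long enough input string and the empty string.\<close>

definition reject :: com where
  "reject = block
     [Arith Add 4 2 3,
      Cond (Less 2 0) (block [move 0 4, move 1 23]) (block [move 0 23, move 1 4])]"

text \<open>Register 22 is kept \<open>k\<close> ahead of register 8, so that the loop test needs no
  arithmetic. If the loop ends with at least \<open>k\<close> symbols of \<open>X\<close> unread,
  then \<open>k + 1\<close> strips have been counted.\<close>

definition strips :: com where
  "strips = block
     [Arith Add 22 8 2,
      While (Conj (Neg (Less 0 22)) (Neg (Less 2 9))) strip,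
      Cond (Neg (Less 0 22)) reject (block [compact 0, compact 1])]"

definition set_up_band :: com where
  "set_up_band = block
     [Const 24 2, Arith Sub 22 2 21, Arith Div 22 22 24, Arith Add 5 22 5, Arith Add 6 22 6,
      Arith Mul 7 2 2, Arith Add 7 7 2, Arith Add 7 7 2, Arith Add 7 7 2]"

definition kernelize_large :: com where
  "kernelize_large = block
     [Arith Sub 5 0 1, Arith Sub 6 1 0, Arith Add 21 5 6,
      Cond (Less 2 21) reject (block [set_up_band, strips])]"

definition kernelize :: com where
  "kernelize = block
     [Const 3 1, Const 4 85, Arith Mul 21 2 2, Arith Mul 21 21 21, Arith Mul 4 4 21,
      Cond (Conj (Neg (Less 4 0)) (Neg (Less 4 1))) Skip kernelize_large]"

lemma kernel_equiv_refl [simp]: "kernel_equiv k X Y X Y"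
  by (simp add: kernel_equiv_def)

lemma kernel_equiv_far:
  assumes "\<And>w. weight_function w \<Longrightarrow> real k < ed w X Y" "\<And>w. weight_function w \<Longrightarrow> real k < ed w X' Y'"
  shows "kernel_equiv k X Y X' Y'"
  using assms by (force simp: kernel_equiv_def ed_le_def)

lemma wp_reject:
  assumes regs: "reg s 0 = length X" "reg s 1 = length Y" "reg s 2 = k" "reg s 3 = 1" "reg s 23 = 0"
    and syms: "syms s 0 = sym_array X" "syms s 1 = sym_array Y"
    and k: "k < length X \<or> k < length Y" "Suc k < 2 ^ b"
    and Q: "\<And>t s' X' Y'. t \<le> 5 \<Longrightarrow> outputs s' X' Y' \<Longrightarrow> length X' \<le> Suc k \<Longrightarrow> length Y' \<le> Suc k \<Longrightarrow>
      k < absdiff (length X') (length Y') \<Longrightarrow> Q t s'"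
  shows "wp b reject Q s"
proof (cases "k < length X")
  case True
  have "outputs (s\<lparr>reg := (reg s)(4 := Suc k, 0 := Suc k, Suc 0 := 0)\<rparr>) (take (Suc k) X) []"
    using True by (simp add: outputs_def syms sym_array_def)
  then show ?thesis
    using True k(2) Q[of "Suc (Suc (Suc (Suc 0)))" _ "take (Suc k) X" "[]"] regs
    by (simp add: reject_def wp_simps absdiff_def)
next
  case False
  then have "k < length Y" using k(1) by simp
  then have "outputs (s\<lparr>reg := (reg s)(4 := Suc k, 0 := 0, Suc 0 := Suc k)\<rparr>) [] (take (Suc k) Y)"
    using syms(2) by (simp add: outputs_def sym_array_def)
  then show ?thesis
    using \<open>k < length Y\<close> False k(2) Q[of "Suc (Suc (Suc (Suc 0)))" _ "[]" "take (Suc k) Y"] regs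
    by (simp add: reject_def wp_simps absdiff_def)
qed

definition is_kernel :: "nat \<Rightarrow> 'a list \<Rightarrow> 'a list \<Rightarrow> 'a list \<Rightarrow> 'a list \<Rightarrow> bool" where
  "is_kernel k X Y X' Y' \<longleftrightarrow> length X' \<le> 85 * k ^ 4 \<and> length Y' \<le> 85 * k ^ 4 \<and> kernel_equiv k X Y X' Y'"

lemma power_le_k4:
  assumes "0 < (k::nat)"
  shows "1 \<le> k ^ 4" "k \<le> k ^ 4" "k * k \<le> k ^ 4" "k * k * k \<le> k ^ 4"
proof -
  have *: "k ^ i \<le> k ^ 4" if "i \<le> 4" for i using assms that by (intro power_increasing) auto
  show "1 \<le> k ^ 4" "k \<le> k ^ 4" "k * k \<le> k ^ 4" "k * k * k \<le> k ^ 4"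
    using *[of 0] *[of 1] *[of 2] *[of 3] by (simp_all add: power2_eq_square power3_eq_cube)
qed

lemma is_kernel_far:
  assumes "0 < k" "\<And>w. weight_function w \<Longrightarrow> real k < ed w X Y"
    "length X' \<le> Suc k" "length Y' \<le> Suc k" "k < absdiff (length X') (length Y')"
  shows "is_kernel k X Y X' Y'"
proof -
  have "Suc k \<le> 85 * k ^ 4" using power_le_k4[OF assms(1)] by linarith
  moreover have "kernel_equiv k X Y X' Y'"
    by (rule kernel_equiv_far) (use assms length_diff_imp_ed_gt in blast)+
  ultimately show ?thesis using assms(3,4) by (simp add: is_kernel_def)
qed

context ram_input
begin

text \<open>One \<open>k\<close> in \<open>2 * k\<close> accounts for the unread end of
  \<open>X\<close>, the other for a longer \<open>Y\<close>. After expansion every monomial is at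
  most \<open>k ^ 4\<close>.\<close>

lemma strips_size: "(k + 1) * strip_bound + 2 * k \<le> 85 * k ^ 4"
proof -
  have "(k + 1) * strip_bound + 2 * k = 2 * k ^ 4 + 13 * (k * k * k) + 24 * (k * k) + 16 * k + 1"
    by (simp add: strip_bound_def threshold_def algebra_simps numeral_eq_Suc)
  then show ?thesis using power_le_k4[OF k_pos] by linarith
qed

lemma wp_strips:
  assumes r: "ready s" and z: "reg s 8 = 0" "reg s 9 = 0" "marks s 0 = {}" "marks s 1 = {}"
    and Q: "\<And>t s' X' Y'. outputs s' X' Y' \<Longrightarrow> is_kernel k X Y X' Y' \<Longrightarrow>
      t \<le> 70 * Suc (length X) + 250 * (k * k) * Suc k + 7 * (length X + length Y) + 50 \<Longrightarrow> Q t s'"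
  shows "wp b strips Q s"
proof -
  let ?t = "Conj (Neg (Less 0 22)) (Neg (Less 2 9))"
  let ?bound = "70 * Suc (length X) + 250 * (k * k) * Suc k"
  have kb: "k < 2 ^ b" "Suc k < 2 ^ b" "length X < 2 ^ b" "length Y < 2 ^ b"
    by (rule word, use large in linarith)+
  have "wp b (While ?t strip) (\<lambda>t s'. wp b (Cond (Neg (Less 0 22)) reject (block [compact 0, compact 1]))
      (\<lambda>t'. Q (1 + (t + t'))) s') (s\<lparr>reg := (reg s)(22 := k)\<rparr>)"
  proof (rule wp_While[where I = strip_inv and V = strip_potential])
    have "ready (s\<lparr>reg := (reg s)(22 := k)\<rparr>)"
      by (rule ready_agree[OF r, of "{22}"]) simp_all
    then show "strip_inv (s\<lparr>reg := (reg s)(22 := k)\<rparr>)"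
      using z by (simp add: strip_inv_def marks_def)
  next
    fix s' assume I: "strip_inv s'" and t: "test_val ?t s'"
    have "reg s' 0 = length X" "reg s' 2 = k" "reg s' 22 = reg s' 8 + k"
      using I by (simp_all add: strip_inv_def readyD)
    then have "reg s' 8 + k \<le> length X" "reg s' 9 \<le> k" using t by simp_all
    then show "wp b strip (\<lambda>t s''. strip_inv s'' \<and> test_cost ?t + t + strip_potential s'' \<le> strip_potential s') s'"
      by (intro wp_mono[OF wp_strip[OF I]]) simp_all
  next
    fix t and s' :: "'a state"
    assume I: "strip_inv s'" and nt: "\<not> test_val ?t s'"
      and "t + strip_potential s' \<le> strip_potential (s\<lparr>reg := (reg s)(22 := k)\<rparr>) + test_cost ?t"
    then have t: "t \<le> ?bound + 5" using z by (simp add: strip_potential_def)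
    have r': "ready s'" and s': "reg s' 22 = reg s' 8 + k" "reg s' 9 \<le> Suc k"
      "marks s' 0 \<subseteq> {..<length X}" "marks s' 1 \<subseteq> {..<length Y}" "card (marks s' 0) = card (marks s' 1)"
      "kernel_equiv k X Y (kept X (marks s' 0) 0 (length X)) (kept Y (marks s' 1) 0 (length Y))"
      "reg s' 8 \<le> length X \<Longrightarrow> edit_progress k X Y (reg s' 8) (reg s' 9)"
      "reg s' 8 \<le> card (marks s' 0) + reg s' 9 * strip_bound"
      using I by (simp_all add: strip_inv_def)
    note rd = readyD[OF r']
    show "wp b (Cond (Neg (Less 0 22)) reject (block [compact 0, compact 1])) (\<lambda>t'. Q (1 + (t + t'))) s'"
    proof (cases "reg s' 8 + k \<le> length X")
      case True
      then have "reg s' 9 = Suc k" using nt s'(2) by (simp add: rd s'(1))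
      then have far: "real k < ed w X Y" if "weight_function w" for w
        using edit_progress_imp_ed_gt[OF _ that] s'(7) True by simp
      have "wp b reject (\<lambda>t'. Q (1 + (t + (2 + t')))) s'"
      proof (rule wp_reject[OF rd(1-4,8-10) _ kb(2)])
        have "length X \<le> k \<Longrightarrow> length Y \<le> k \<Longrightarrow> False"
          using large threshold_ge by linarith
        then show "k < length X \<or> k < length Y" by (meson leI)
      next
        fix t' :: nat and X' Y' and s'' :: "'a state"
        assume h: "t' \<le> 5" "outputs s'' X' Y'" "length X' \<le> Suc k" "length Y' \<le> Suc k"
          "k < absdiff (length X') (length Y')"
        show "Q (1 + (t + (2 + t'))) s''"
          by (rule Q[OF h(2) is_kernel_far[OF k_pos far h(3-5)]]) (use t h(1) in simp_all)
      qed
      then show ?thesis using True by (simp add: wp_Cond rd s'(1))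
    next
      case False
      let ?X = "kept X (marks s' 0) 0 (length X)" and ?Y = "kept Y (marks s' 1) 0 (length Y)"
      have lX: "length ?X + card (marks s' 0) = length X" "length ?Y + card (marks s' 0) = length Y"
        using length_kept[OF s'(3), of X] length_kept[OF s'(4), of Y] s'(5) by simp_all
      have "reg s' 9 * strip_bound \<le> Suc k * strip_bound" using s'(2) by (rule mult_le_mono1)
      then have "length ?X + k \<le> Suc k * strip_bound + 2 * k"
        using s'(8) False lX(1) by linarith
      then have lX': "length ?X + k \<le> 85 * k ^ 4" using strips_size by simp
      moreover have "length ?Y \<le> length ?X + k" using near lX unfolding absdiff_def by linarith
      ultimately have ker: "is_kernel k X Y ?X ?Y" using s'(6) by (simp add: is_kernel_def)
      have "wp b (compact 0) (\<lambda>t' s''. wp b (compact 1) (\<lambda>t''. Q (1 + (t + (2 + (t' + t''))))) s'') s'"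
      proof (rule wp_compact[of _ _ X])
        fix t1 :: nat and s1 :: "'a state"
        assume s1: "\<And>r. r \<notin> {0, 14, 15, 21} \<Longrightarrow> reg s1 r = reg s' r" "mem s1 = mem s'"
          "\<And>B. B \<noteq> 0 \<Longrightarrow> syms s1 B = syms s' B" "reg s1 0 = length ?X"
          "\<And>x. x < reg s1 0 \<Longrightarrow> syms s1 0 x = Some (?X ! x)" "t1 \<le> 7 * length X + 4"
        have m1: "marks s1 1 = marks s' 1" by (simp add: marks_def s1(2))
        show "wp b (compact 1) (\<lambda>t''. Q (1 + (t + (2 + (t1 + t''))))) s1"
        proof (rule wp_compact[of _ _ Y])
          fix t2 :: nat and s2 :: "'a state"
          assume s2: "\<And>r. r \<notin> {1, 14, 15, 21} \<Longrightarrow> reg s2 r = reg s1 r" "mem s2 = mem s1"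
            "\<And>B. B \<noteq> 1 \<Longrightarrow> syms s2 B = syms s1 B" "reg s2 1 = length (kept Y (marks s1 1) 0 (length Y))"
            "\<And>x. x < reg s2 1 \<Longrightarrow> syms s2 1 x = Some (kept Y (marks s1 1) 0 (length Y) ! x)"
            "t2 \<le> 7 * length Y + 4"
          have "outputs s2 ?X ?Y"
            unfolding outputs_def using s1(4,5) s2(4,5) m1 s2(1)[of 0] s2(3)[of 0] by simp
          then show "Q (1 + (t + (2 + (t1 + t2)))) s2"
            by (rule Q[OF _ ker]) (use t s1(6) s2(6) in simp)
        qed (use kb in \<open>simp_all add: s1 rd sym_array_def\<close>)
      qed (use kb in \<open>simp_all add: rd sym_array_def\<close>)
      then show ?thesis using False by (simp add: wp_simps rd s'(1))
    qed
  qed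
  then show ?thesis using kb(1) by (simp add: strips_def wp_Seq wp_Arith readyD[OF r] z)
qed

end

lemma wp_kernelize:
  assumes k: "0 < k" and b: "(length X + length Y + k + 2) ^ 12 \<le> (2::nat) ^ b"
    and Q: "\<And>t s' X' Y'. outputs s' X' Y' \<Longrightarrow> is_kernel k X Y X' Y' \<Longrightarrow>
      t \<le> 1000 * (length X + length Y + 1) \<Longrightarrow> Q t s'"
  shows "wp b kernelize Q (input_state X Y k)"
proof -
  let ?n = "length X" and ?m = "length Y"
  define Z where "Z = ?n + ?m + k + 2"
  have Z4: "k ^ 4 \<le> Z ^ 4" "Z \<le> Z ^ 4" "0 < Z ^ 4"
    using power_mono[of k Z 4] self_le_power[of Z 4] by (simp_all add: Z_def)
  \<comment> \<open>Origin of the exponent 12: the numbers that occur here are below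
    \<open>256 * Z ^ 4\<close>, and \<open>Z \<ge> 2\<close> gives
    \<open>256 \<le> Z ^ 8\<close>.\<close>
  have "(2::nat) ^ 8 \<le> Z ^ 8" by (rule power_mono) (simp_all add: Z_def)
  then have "256 * Z ^ 4 \<le> Z ^ 8 * Z ^ 4" by (intro mult_le_mono1) simp
  also have "\<dots> = Z ^ 12" by (simp flip: power_add)
  also have "\<dots> \<le> 2 ^ b" using b by (simp add: Z_def)
  finally have Zb: "256 * Z ^ 4 \<le> 2 ^ b" .
  define L where "L = 85 * k ^ 4"
  note p4 = power_le_k4[OF k]
  have kkkk: "k * k * (k * k) = k ^ 4" by (simp add: power4_eq_xxxx mult.assoc)
  have Z_sum: "?n + ?m + k + 2 = Z" by (simp add: Z_def)
  have small: "v < 2 ^ b" if "v < 256 * Z ^ 4" for v using that Zb by simp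
  have bounds: "85 < (2::nat) ^ b" "L < 2 ^ b" "k * k < 2 ^ b" "k * k * (k * k) < 2 ^ b" "2 < (2::nat) ^ b"
    "k < 2 ^ b" "Suc k < 2 ^ b" "?n < 2 ^ b" "?m < 2 ^ b" "?n - ?m + (?m - ?n) < 2 ^ b"
    "k * k + k < 2 ^ b" "k * k + k + k < 2 ^ b" "k * k + k + k + k < 2 ^ b" "Suc 0 < 2 ^ b"
    "?n - ?m < 2 ^ b" "?m - ?n < 2 ^ b"
    by (rule small, use Z4 p4 kkkk L_def Z_sum in linarith)+
  have L: "85 * (k * k * (k * k)) = L" by (simp add: L_def kkkk)
  define s1 :: "'a state" where "s1 = input_state X Y k
    \<lparr>reg := (reg (input_state X Y k))(3 := 1, 21 := k * k * (k * k), 4 := L)\<rparr>"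
  have r1: "reg s1 0 = ?n" "reg s1 1 = ?m" "reg s1 2 = k" "reg s1 3 = 1" "reg s1 4 = L" "reg s1 23 = 0"
    "reg s1 8 = 0" "reg s1 9 = 0" "reg s1 (Suc 0) = ?m" "mem s1 = (\<lambda>_ _. 0)"
    "syms s1 0 = sym_array X" "syms s1 1 = sym_array Y" "syms s1 (Suc 0) = sym_array Y"
    by (simp_all add: s1_def input_state_def)
  have "wp b (Cond (Conj (Neg (Less 4 0)) (Neg (Less 4 1))) Skip kernelize_large) (\<lambda>t. Q (5 + t)) s1"
  proof (cases "?n \<le> L \<and> ?m \<le> L")
    case True
    have "Q 11 s1"
      by (rule Q[of _ X Y]) (use True in \<open>simp_all add: outputs_def is_kernel_def r1 L_def sym_array_def\<close>)
    then show ?thesis using True by (simp add: wp_simps r1)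
  next
    case exceeds: False
    then have L_less: "L < ?n + ?m" by auto
    define D where "D = absdiff ?n ?m"
    have Dnm: "?n - ?m + (?m - ?n) = D" by (simp add: D_def absdiff_def)
    define s2 where "s2 = s1\<lparr>reg := (reg s1)(5 := ?n - ?m, 6 := ?m - ?n, 21 := D)\<rparr>"
    have "wp b (Cond (Less 2 21) reject (block [set_up_band, strips])) (\<lambda>t. Q (13 + t)) s2"
    proof (cases "k < D")
      case True
      then have far: "real k < ed w X Y" if "weight_function w" for w
        using length_diff_imp_ed_gt[OF _ that] by (simp add: D_def)
      have "wp b reject (\<lambda>t. Q (14 + t)) s2"
      proof (rule wp_reject[of _ X Y k])
        show "k < ?n \<or> k < ?m" using True by (auto simp: D_def absdiff_def)
        fix t :: nat and X' Y' and s' :: "'a state"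
        assume h: "t \<le> 5" "outputs s' X' Y'" "length X' \<le> Suc k" "length Y' \<le> Suc k"
          "k < absdiff (length X') (length Y')"
        show "Q (14 + t) s'"
          by (rule Q[OF h(2) is_kernel_far[OF k far h(3-5)]]) (use h(1) in simp_all)
      qed (simp_all add: s2_def r1 bounds)
      then show ?thesis using True by (simp add: wp_Cond s2_def r1)
    next
      case False
      have L85: "85 * (k * k * k) \<le> L" "85 * (k * k) \<le> L" "85 * k \<le> L" using p4 by (simp_all add: L_def)
      interpret ram_input X Y k b
      proof
        show "0 < k" by (rule k)
        show "absdiff ?n ?m \<le> k" using False by (simp add: D_def)
        have "4 * ?n + 4 * ?m + 4 \<le> 256 * Z ^ 4" using Z4 Z_sum by linarith
        then show "4 * (?n + ?m + 1) \<le> 2 ^ b" using Zb by simp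
        show "threshold k + 4 * k \<le> ?n + ?m" using L_less L85 unfolding threshold_def by linarith
      qed
      define h where "h = (k - D) div 2"
      have lo_eq: "h + (?n - ?m) = lo" and hi_eq: "h + (?m - ?n) = hi"
        by (simp_all add: h_def lo_def hi_def D_def)
      define s3 where "s3 = s2\<lparr>reg := (reg s2)(24 := 2, 22 := h, 5 := lo, 6 := hi, 7 := threshold k)\<rparr>"
      have T: "k * k + k + k + k = threshold k" by (simp add: threshold_def)
      have hb: "h < 2 ^ b" "lo < 2 ^ b" "hi < 2 ^ b" "k - D < 2 ^ b"
        using lo_hi lo_eq bounds(6) by linarith+
      have r3: "ready s3" by (simp add: ready_def s3_def s2_def r1)
      have "wp b strips (\<lambda>t. Q (23 + t)) s3"
      proof (rule wp_strips[OF r3])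
        fix t :: nat and X' Y' and s' :: "'a state"
        assume o: "outputs s' X' Y'" "is_kernel k X Y X' Y'"
          "t \<le> 70 * Suc ?n + 250 * (k * k) * Suc k + 7 * (?n + ?m) + 50"
        \<comment> \<open>Linearity rests on returning short inputs at once: the total length now
          exceeds \<open>85 * k ^ 4\<close>, which dominates the cubic cost of all strips.\<close>
        have "250 * (k * k) * Suc k = 250 * (k * k * k) + 250 * (k * k)" by simp
        also have "\<dots> \<le> 500 * ?n + 500 * ?m" using L_less L85 by linarith
        finally show "Q (23 + t) s'" using o by (intro Q) simp_all
      qed (simp_all add: s3_def s2_def r1 marks_def)
      moreover have "wp b set_up_band (\<lambda>t s'. t = 9 \<and> s' = s3) s2"
        by (simp add: bounds bounds(13)[unfolded T] hb set_up_band_def wp_simps s2_def s3_def r1 h_def[symmetric] lo_eq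
            hi_eq T fun_upd_twist)
      ultimately have "wp b (block [set_up_band, strips]) (\<lambda>t. Q (14 + t)) s2"
        unfolding block.simps wp_Seq by (elim wp_mono) (simp add: add_ac)
      then show ?thesis using False by (simp add: wp_Cond s2_def r1)
    qed
    then have "wp b kernelize_large (\<lambda>t. Q (10 + t)) s1"
      by (simp add: bounds bounds(10)[unfolded Dnm] kernelize_large_def wp_Seq wp_Arith r1 Dnm s2_def)
    then show ?thesis using exceeds by (auto simp: wp_Cond r1)
  qed
  then have "wp b (Cond (Conj (Neg (Less 4 0)) (Neg (Less 4 1))) Skip kernelize_large)
      (\<lambda>t. Q (Suc (Suc (Suc (Suc (Suc t)))))) s1"
    by (rule wp_mono) (simp add: numeral_eq_Suc)
  then show ?thesis
    by (simp add: bounds kernelize_def wp_Seq wp_Arith wp_Const input_state_def s1_def L fun_upd_twist)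
qed

theorem theorem2p13:
  "\<exists>P. linear_time_algorithm P
     (\<lambda>(X :: 'a list) Y k X' Y'.
        length X' \<le> 85 * k ^ 4 \<and> length Y' \<le> 85 * k ^ 4 \<and>
        (\<forall>w. weight_function w \<longrightarrow> ed_le w k X Y = ed_le w k X' Y'))"
proof (intro exI)
  show "linear_time_algorithm kernelize
     (\<lambda>(X :: 'a list) Y k X' Y'.
        length X' \<le> 85 * k ^ 4 \<and> length Y' \<le> 85 * k ^ 4 \<and>
        (\<forall>w. weight_function w \<longrightarrow> ed_le w k X Y = ed_le w k X' Y'))"
    unfolding linear_time_algorithm_def
  proof (rule exI[of _ 1000], rule exI[of _ 12], intro allI impI)
    fix X Y :: "'a list" and k b :: nat
    assume k: "0 < k" and b: "(length X + length Y + k + 2) ^ 12 \<le> (2::nat) ^ b"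
    have "wp b kernelize (\<lambda>t s. \<exists>X' Y'. t \<le> 1000 * (length X + length Y + 1) \<and> outputs s X' Y' \<and>
        is_kernel k X Y X' Y') (input_state X Y k)"
      by (rule wp_kernelize[OF k b]) blast
    then show "\<exists>t s X' Y'. exec b kernelize (input_state X Y k) t s \<and>
        t \<le> 1000 * (length X + length Y + 1) \<and> outputs s X' Y' \<and>
        length X' \<le> 85 * k ^ 4 \<and> length Y' \<le> 85 * k ^ 4 \<and>
        (\<forall>w. weight_function w \<longrightarrow> ed_le w k X Y = ed_le w k X' Y')"
      unfolding wp_def is_kernel_def kernel_equiv_def by blast
  qed
qed

end
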